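(* For every finite-dimensional quantum state $\rho$ (a $d\times d$ density matrix), \[ C_{d,\mathrm{SIO}}(\rho)=C_{d,\mathrm{PIO}}(\rho)=Q(\rho), \] where the quintessential coherence is $Q(\rho):=S(\Delta(\rho))-S(\bar\rho)$ with \[ \bar\rho:=\sum_{(i,j):\ |\rho_{ij}|=\sqrt{\rho_{ii}\rho_{jj}}}\rho_{ij}\,|i\rangle\langle j| . \]
   Context: Fix the computational (incoherent) basis $\{|i\rangle\}_{i=1}^d$ of $\mathbb{C}^d$; $[d]=\{1,\dots,d\}$. $\Delta(X)=\sum_i |i\rangle\langle i|X|i\rangle\langle i|$ is the dephasing map, $S(\rho)=-\mathrm{Tr}\,\rho\log\rho$ the von Neumann entropy, logarithms base 2. A matrix $K$ is incoherent if each $K|i\rangle$ is proportional to some computational basis vector. Incoherent unitaries are products of a permutation matrix and a diagonal unitary; incoherent projectors are $\Pi_I=\sum_{i\in I}|i\rangle\langle i|$, $I\subseteq[d]$. A strictly incoherent operation (SIO) is a quantum channel admitting a Kraus decomposition $\Lambda(X)=\sum_\alpha K_\alpha XK_\alpha^\dagger$ in which every $K_\alpha$ and every $K_\alpha^\dagger$ is incoherent. A physically incoherent operation (PIO) is a channel of the form $\Lambda(X)=\sum_{\alpha,\beta}p_\alpha U_{\alpha,\beta}\Pi_{\beta|\alpha}X\Pi_{\beta|\alpha}U_{\alpha,\beta}^\dagger$, with $p$ a probability distribution, $U_{\alpha,\beta}$ incoherent unitaries, and for each $\alpha$ the $\Pi_{\beta|\alpha}$ incoherent projectors with $\sum_\beta\Pi_{\beta|\alpha}=\mathbb{1}$.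 When input and output dimensions differ, input and output spaces are identified with spans of subsets of computational basis vectors of a common space (lifting by incoherent isometries and compressing by incoherent projectors); in particular appending incoherent states, relabelling basis vectors and discarding subsystems are allowed. For $m\ge0$, $\Psi_{2^m}$ denotes the maximally coherent state $|\Psi_{2^m}\rangle=2^{-m/2}\sum_{i=1}^{2^m}|i\rangle$ (so $\Psi_{2^m}=\Psi_2^{\otimes m}$). For a class of channels $\mathcal{O}$, the distillable coherence is $C_{d,\mathcal{O}}(\rho)=\sup\{r:\lim_{n\to\infty}\inf_{\Lambda\in\mathcal{O}}\|\Lambda(\rho^{\otimes n})-\Psi_{2^{\lfloor rn\rfloor}}\|_1=0\}$. *)

theory Defs
  imports Complex_Main "Jordan_Normal_Form.Matrix" "Jordan_Normal_Form.Char_Poly"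
begin

text \<open>Matrices are complex JNF matrices; the computational basis vector |i> (i = 1..d in the
paper) is the standard unit vector with index i-1 in {0..<d}.\<close>

definition adj :: "complex mat \<Rightarrow> complex mat" where
  "adj A = mat (dim_col A) (dim_row A) (\<lambda>(i,j). cnj (A $$ (j,i)))"

definition mtrace :: "complex mat \<Rightarrow> complex" where
  "mtrace A = (\<Sum>i<dim_row A. A $$ (i,i))"

definition msum :: "nat \<Rightarrow> nat \<Rightarrow> ('i \<Rightarrow> complex mat) \<Rightarrow> 'i set \<Rightarrow> complex mat" where
  "msum n m f I = mat n m (\<lambda>(i,j). \<Sum>x\<in>I. f x $$ (i,j))"

definition density :: "nat \<Rightarrow> complex mat \<Rightarrow> bool" where
  "density d \<rho> \<longleftrightarrow> \<rho> \<in> carrier_mat d d \<and> adj \<rho> = \<rho> \<and>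
     (\<forall>v :: nat \<Rightarrow> complex. 0 \<le> Re (\<Sum>i<d. \<Sum>j<d. cnj (v i) * \<rho> $$ (i,j) * v j)) \<and>
     mtrace \<rho> = 1"

definition kron :: "complex mat \<Rightarrow> complex mat \<Rightarrow> complex mat" where
  "kron A B = mat (dim_row A * dim_row B) (dim_col A * dim_col B)
     (\<lambda>(i,j). A $$ (i div dim_row B, j div dim_col B) * B $$ (i mod dim_row B, j mod dim_col B))"

fun tpow :: "complex mat \<Rightarrow> nat \<Rightarrow> complex mat" where
  "tpow A 0 = 1\<^sub>m 1"
| "tpow A (Suc n) = kron (tpow A n) A"

definition ptrace2 :: "nat \<Rightarrow> nat \<Rightarrow> complex mat \<Rightarrow> complex mat" where
  "ptrace2 b e Y = mat b b (\<lambda>(i,j). \<Sum>k<e. Y $$ (i * e + k, j * e + k))"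

definition spec_sum :: "(complex \<Rightarrow> real) \<Rightarrow> complex mat \<Rightarrow> real" where
  "spec_sum f A = (\<Sum>z\<in>{z. poly (char_poly A) z = 0}. real (order z (char_poly A)) * f z)"

definition xlogx :: "real \<Rightarrow> real" where
  "xlogx x = (if x = 0 then 0 else x * log 2 x)"

definition entropy :: "complex mat \<Rightarrow> real" where
  "entropy \<rho> = - spec_sum (\<lambda>z. xlogx (Re z)) \<rho>"

definition trace_norm :: "complex mat \<Rightarrow> real" where
  "trace_norm X = spec_sum (\<lambda>\<mu>. sqrt (Re \<mu>)) (adj X * X)"

definition dephase :: "complex mat \<Rightarrow> complex mat" where
  "dephase A = mat (dim_row A) (dim_col A) (\<lambda>(i,j). if i = j then A $$ (i,j) else 0)"

definition rhobar :: "complex mat \<Rightarrow> complex mat" where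
  "rhobar \<rho> = mat (dim_row \<rho>) (dim_col \<rho>)
     (\<lambda>(i,j). if cmod (\<rho> $$ (i,j)) = sqrt (Re (\<rho> $$ (i,i)) * Re (\<rho> $$ (j,j)))
              then \<rho> $$ (i,j) else 0)"

definition Qcoh :: "complex mat \<Rightarrow> real" where
  "Qcoh \<rho> = entropy (dephase \<rho>) - entropy (rhobar \<rho>)"

definition Psi :: "nat \<Rightarrow> complex mat" where
  "Psi m = mat (2^m) (2^m) (\<lambda>_. 1 / 2^m)"

definition incoherent :: "complex mat \<Rightarrow> bool" where
  "incoherent K \<longleftrightarrow> (\<forall>j<dim_col K. \<exists>i<dim_row K. \<forall>i'<dim_row K. i' \<noteq> i \<longrightarrow> K $$ (i',j) = 0)"

definition perm_mat :: "nat \<Rightarrow> (nat \<Rightarrow> nat) \<Rightarrow> complex mat" where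
  "perm_mat D \<sigma> = mat D D (\<lambda>(i,j). if i = \<sigma> j then 1 else 0)"

definition diag_phase :: "nat \<Rightarrow> (nat \<Rightarrow> complex) \<Rightarrow> complex mat" where
  "diag_phase D ph = mat D D (\<lambda>(i,j). if i = j then ph i else 0)"

definition incoh_unitary :: "nat \<Rightarrow> complex mat \<Rightarrow> bool" where
  "incoh_unitary D U \<longleftrightarrow> (\<exists>\<sigma> ph. \<sigma> permutes {..<D} \<and> (\<forall>i<D. cmod (ph i) = 1) \<and>
       U = perm_mat D \<sigma> * diag_phase D ph)"

definition incoh_proj :: "nat \<Rightarrow> nat set \<Rightarrow> complex mat" where
  "incoh_proj D I = mat D D (\<lambda>(i,j). if i = j \<and> i \<in> I then 1 else 0)"

definition SIO_sq :: "nat \<Rightarrow> (complex mat \<Rightarrow> complex mat) \<Rightarrow> bool" where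
  "SIO_sq D \<Phi> \<longleftrightarrow> (\<exists>(N::nat) K.
     (\<forall>a<N. K a \<in> carrier_mat D D \<and> incoherent (K a) \<and> incoherent (adj (K a))) \<and>
     msum D D (\<lambda>a. adj (K a) * K a) {..<N} = 1\<^sub>m D \<and>
     (\<forall>X \<in> carrier_mat D D. \<Phi> X = msum D D (\<lambda>a. K a * X * adj (K a)) {..<N}))"

definition PIO_sq :: "nat \<Rightarrow> (complex mat \<Rightarrow> complex mat) \<Rightarrow> bool" where
  "PIO_sq D \<Phi> \<longleftrightarrow> (\<exists>(A::nat) (p::nat \<Rightarrow> real) (B::nat \<Rightarrow> nat) U I.
     (\<forall>a<A. 0 \<le> p a) \<and> (\<Sum>a<A. p a) = 1 \<and>
     (\<forall>a<A. \<forall>b<B a. incoh_unitary D (U a b) \<and> I a b \<subseteq> {..<D}) \<and>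
     (\<forall>a<A. msum D D (\<lambda>b. incoh_proj D (I a b)) {..<B a} = 1\<^sub>m D) \<and>
     (\<forall>X \<in> carrier_mat D D. \<Phi> X =
        msum D D (\<lambda>a. complex_of_real (p a) \<cdot>\<^sub>m
          msum D D (\<lambda>b. U a b * incoh_proj D (I a b) * X * incoh_proj D (I a b) * adj (U a b))
            {..<B a}) {..<A}))"

text \<open>Channels from C^a to C^b in class O (given on square spaces): lift the input by an
  incoherent isometry V into a common space C^D = C^b (x) C^e, apply a channel of the class on
  C^D, and discard the second subsystem.  Relabellings of basis vectors are incoherent unitaries
  and so are absorbed into the middle channel.\<close>
definition lifted :: "(nat \<Rightarrow> (complex mat \<Rightarrow> complex mat) \<Rightarrow> bool) \<Rightarrow> nat \<Rightarrow> nat \<Rightarrow>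
    (complex mat \<Rightarrow> complex mat) \<Rightarrow> bool" where
  "lifted Cls a b \<Lambda> \<longleftrightarrow> (\<exists>e V \<Phi>. V \<in> carrier_mat (b * e) a \<and> incoherent V \<and> adj V * V = 1\<^sub>m a \<and>
      Cls (b * e) \<Phi> \<and> (\<forall>X \<in> carrier_mat a a. \<Lambda> X = ptrace2 b e (\<Phi> (V * X * adj V))))"

definition distillable :: "(nat \<Rightarrow> (complex mat \<Rightarrow> complex mat) \<Rightarrow> bool) \<Rightarrow> nat \<Rightarrow> complex mat \<Rightarrow> real" where
  "distillable Cls d \<rho> = Sup {r::real. 0 \<le> r \<and>
     (\<lambda>n. INF \<Lambda> \<in> {\<Lambda>. lifted Cls (d ^ n) (2 ^ nat \<lfloor>r * real n\<rfloor>) \<Lambda>}.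
           trace_norm (\<Lambda> (tpow \<rho> n) - Psi (nat \<lfloor>r * real n\<rfloor>))) \<longlonglongrightarrow> 0}"

end

theory Submission
  imports Defs "Jordan_Normal_Form.Schur_Decomposition" "HOL-Real_Asymp.Real_Asymp" "HOL-Library.FuncSet"
begin

text \<open>Write \<open>p\<close> for the diagonal of \<open>\<rho>\<close>. Positivity makes ``\<open>|\<rho>_ij| = sqrt (p_i p_j)\<close>'' an equivalence
  relation on the support of \<open>p\<close>; inside a class \<open>\<rho>\<close> is rank one, and between classes
  \<open>|\<rho>_ij| \<le> \<mu> sqrt (p_i p_j)\<close> with a constant \<open>\<mu> < 1\<close>. If \<open>\<lambda>_k\<close> is the weight of class \<open>k\<close> then \<open>Q\<close>
  is the mean of the conditional surprisal \<open>log (\<lambda>_{k(i)} / p_i)\<close>, and by Chebyshev's inequality a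
  typical sequence \<open>x\<close> has \<open>p_x\<close> close to \<open>2^{-nQ}\<close> times the weight of its sequence of classes.

  Achievability: group the sequences into cells with the same classes and the same probability. A
  cell is cut into blocks of \<open>2^m\<close> elements; the state on a block is, up to phases, maximally
  coherent. For each sequence of classes there are polynomially many leftover sets of fewer than
  \<open>2^m\<close> elements; their total weight vanishes when \<open>m = rn\<close> with \<open>r < Q\<close>.

  Converse: the overlap of a strictly incoherent output with the maximally coherent state is an
  average of quadratic forms of \<open>\<rho>^n\<close> in vectors supported on at most \<open>2^m\<close> sequences. Pairs of
  typical sequences with the same classes contribute at most \<open>2^{n(Q+\<epsilon>)} / 2^m\<close>, and pairs with different classes at most
  \<open>\<mu>\<close>, so the overlap stays away from 1 when \<open>r > Q\<close>.\<close>

section \<open>Spectral sums and power traces\<close>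

text \<open>Both equalities come from one sandwich: the block protocol is physically incoherent,
  while the converse uses only that every Kraus operator has at most one nonzero entry in each row
  and each column, which covers both classes. The converse is weak: it keeps the error above a
  positive constant without driving it to its maximum. Two words of classes may differ at a single
  site, so the factor between them is only \<mu>, with no decay in n. A limit of 0 is excluded all
  the same. Spectral quantities are defined through roots of the characteristic polynomial, counted
  with multiplicity. They are reached through traces of powers, which are explicit for the two
  entropies and for the only trace norm that is computed exactly, that of a multiple of |0><0| minus
  a maximally coherent state. For arbitrary protocols the trace norm is bounded below by the
  Frobenius norm, which already controls the overlap with the maximally coherent state.\<close>

lemma order_prod_linear:
  fixes es :: "'a::field list"
  shows "Polynomial.order z (\<Prod>e\<leftarrow>es. [:- e, 1:]) = count_list es z"
proof (induction es)
  case Nil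
  then show ?case by (simp add: order_1_eq_0)
next
  case (Cons e es)
  have nz: "(\<Prod>e\<leftarrow>es. [:- e, 1:]) \<noteq> 0"
    by (auto simp: prod_list_zero_iff)
  have "Polynomial.order z [:- e, 1:] = (if e = z then 1 else 0)"
  proof (cases "e = z")
    case True
    then show ?thesis using order_power_n_n[of e 1] by simp
  next
    case False
    then show ?thesis by (auto intro!: order_0I)
  qed
  moreover have "[:- e, 1:] * (\<Prod>e\<leftarrow>es. [:- e, 1:]) \<noteq> 0"
    using nz by (simp del: mult_pCons_left)
  ultimately show ?case using Cons
    by (simp add: order_mult del: mult_pCons_left)
qed

lemma sum_list_map_eq_sum_count_list:
  fixes f :: "'a \<Rightarrow> real"
  assumes "finite S" "set xs \<subseteq> S"
  shows "(\<Sum>x\<leftarrow>xs. f x) = (\<Sum>z\<in>S. real (count_list xs z) * f z)"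
  using assms(2)
proof (induction xs)
  case (Cons x xs)
  have "(\<Sum>z\<in>S. real (count_list (x # xs) z) * f z)
      = (\<Sum>z\<in>S. (if z = x then f x else 0) + real (count_list xs z) * f z)"
    by (intro sum.cong) (auto simp: distrib_right)
  also have "\<dots> = f x + (\<Sum>x\<leftarrow>xs. f x)"
    using Cons assms(1) by (simp add: sum.distrib)
  finally show ?case by simp
qed simp

text \<open>A list with repetitions absorbs the algebraic multiplicities, and it is the form in
  which the Schur decomposition handles eigenvalues.\<close>

lemma spec_sum_eq_sum_list:
  assumes "char_poly A = (\<Prod>e\<leftarrow>es. [:- e, 1:])"
  shows "spec_sum f A = (\<Sum>e\<leftarrow>es. f e)"
proof -
  have "{z. poly (char_poly A) z = 0} = set es"
    unfolding assms by (auto simp: poly_prod_list prod_list_zero_iff)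
  then show ?thesis
    unfolding spec_sum_def assms order_prod_linear
    by (simp add: sum_list_map_eq_sum_count_list[of "set es"])
qed

lemma mtrace_mult_commute:
  assumes "A \<in> carrier_mat n m" "B \<in> carrier_mat m n"
  shows "mtrace (A * B) = mtrace (B * A)"
proof -
  have "mtrace (A * B) = (\<Sum>i<n. \<Sum>j<m. A $$ (i,j) * B $$ (j,i))"
    using assms by (auto simp: mtrace_def scalar_prod_def atLeast0LessThan intro!: sum.cong)
  also have "\<dots> = (\<Sum>j<m. \<Sum>i<n. B $$ (j,i) * A $$ (i,j))"
    by (subst sum.swap) (simp add: mult.commute)
  also have "\<dots> = mtrace (B * A)"
    using assms by (auto simp: mtrace_def scalar_prod_def atLeast0LessThan intro!: sum.cong)
  finally show ?thesis .
qed

lemma upper_triangular_mult_diag: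
  fixes A B :: "'a::comm_semiring_1 mat"
  assumes A: "A \<in> carrier_mat n n" "upper_triangular A"
    and B: "B \<in> carrier_mat n n" "upper_triangular B"
  shows "upper_triangular (A * B)"
    and "i < n \<Longrightarrow> (A * B) $$ (i,i) = A $$ (i,i) * B $$ (i,i)"
proof -
  have entry: "(A * B) $$ (i,j) = (\<Sum>k<n. A $$ (i,k) * B $$ (k,j))" if "i < n" "j < n" for i j
    using that A B by (simp add: scalar_prod_def atLeast0LessThan)
  have Az: "A $$ (i,k) = 0" if "k < i" "i < n" for i k
    using A that by (simp add: upper_triangular_def)
  have Bz: "B $$ (i,k) = 0" if "k < i" "i < n" for i k
    using B that by (simp add: upper_triangular_def)
  show "upper_triangular (A * B)"
  proof (rule upper_triangularI)
    fix i j assume ij: "j < i" "i < dim_row (A * B)"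
    then have lt: "i < n" "j < n" using A by auto
    have "A $$ (i,k) * B $$ (k,j) = 0" if "k < n" for k
      using Az[of k i] Bz[of j k] ij lt that by (cases "k < i") auto
    then show "(A * B) $$ (i,j) = 0" using entry[OF lt] by simp
  qed
  show "(A * B) $$ (i,i) = A $$ (i,i) * B $$ (i,i)" if "i < n"
  proof -
    have "A $$ (i,k) * B $$ (k,i) = (if k = i then A $$ (i,i) * B $$ (i,i) else 0)" if "k < n" for k
      using Az[of k i] Bz[of i k] \<open>i < n\<close> that by (cases "k < i"; cases "k = i") auto
    then have "(\<Sum>k<n. A $$ (i,k) * B $$ (k,i)) = (\<Sum>k<n. if k = i then A $$ (i,i) * B $$ (i,i) else 0)"
      by (intro sum.cong) auto
    then show ?thesis using entry[OF that that] that by simp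
  qed
qed

lemma upper_triangular_pow_diag:
  fixes A :: "'a::comm_semiring_1 mat"
  assumes A: "A \<in> carrier_mat n n" "upper_triangular A"
  shows "upper_triangular (A ^\<^sub>m k) \<and> (\<forall>i<n. (A ^\<^sub>m k) $$ (i,i) = (A $$ (i,i)) ^ k)"
proof (induction k)
  case 0
  then show ?case using A by (auto intro!: upper_triangularI)
next
  case (Suc k)
  have "A ^\<^sub>m k \<in> carrier_mat n n" using A by simp
  then show ?case
    using upper_triangular_mult_diag[of "A ^\<^sub>m k" n A] Suc A by (simp add: mult.commute)
qed

text \<open>Similarity preserves traces of powers, and the powers of a triangular matrix carry the
  powers of its diagonal entries, so Schur triangularisation gives the claim.\<close>

lemma mtrace_pow_eq_sum_list:
  fixes A :: "complex mat"
  assumes A: "A \<in> carrier_mat n n" and cp: "char_poly A = (\<Prod>e\<leftarrow>es. [:- e, 1:])"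
  shows "mtrace (A ^\<^sub>m k) = (\<Sum>e\<leftarrow>es. e ^ k)"
proof -
  obtain B P Q where "schur_decomposition A es = (B, P, Q)"
    by (cases "schur_decomposition A es") auto
  from schur_decomposition[OF A cp this]
  have wit: "similar_mat_wit A B P Q" and ut: "upper_triangular B" and diag: "diag_mat B = es"
    by auto
  from similar_mat_witD2[OF A wit]
  have c: "B \<in> carrier_mat n n" "P \<in> carrier_mat n n" "Q \<in> carrier_mat n n" "Q * P = 1\<^sub>m n"
    by auto
  have Bk: "B ^\<^sub>m k \<in> carrier_mat n n" using c by simp
  have "mtrace (A ^\<^sub>m k) = mtrace (P * B ^\<^sub>m k * Q)"
    using similar_mat_wit_pow_id[OF wit] by simp
  also have "\<dots> = mtrace (Q * (P * B ^\<^sub>m k))"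
    using c Bk by (intro mtrace_mult_commute) auto
  also have "Q * (P * B ^\<^sub>m k) = B ^\<^sub>m k"
    using c Bk by (simp flip: assoc_mult_mat[of Q n n P n "B ^\<^sub>m k" n])
  also have "mtrace (B ^\<^sub>m k) = (\<Sum>i<n. (B $$ (i,i)) ^ k)"
    using upper_triangular_pow_diag[OF c(1) ut, of k] carrier_matD[OF Bk] by (simp add: mtrace_def)
  also have "\<dots> = (\<Sum>e\<leftarrow>es. e ^ k)"
    unfolding diag[symmetric] diag_mat_def using c
    by (simp add: interv_sum_list_conv_sum_set_nat atLeast0LessThan o_def flip: sum_list_sum_nth)
  finally show ?thesis .
qed

lemma interpolating_poly_exists:
  fixes f :: "'a::field \<Rightarrow> 'a"
  assumes "finite S"
  shows "\<exists>q. \<forall>z\<in>S. poly q z = f z"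
  using assms
proof induction
  case empty
  then show ?case by simp
next
  case (insert s S)
  then obtain q where q: "\<forall>z\<in>S. poly q z = f z" by blast
  \<comment> \<open>\<open>w\<close> vanishes at all old nodes and not at the new one, so a multiple
    of it repairs the value at \<open>s\<close> alone.\<close>
  define w where "w = (\<Prod>z\<in>S. [:- z, 1:])"
  have w0: "poly w z = 0" if "z \<in> S" for z
    using that insert(1) by (auto simp: w_def poly_prod)
  have ws: "poly w s \<noteq> 0"
    using insert(1,2) by (auto simp: w_def poly_prod)
  let ?q = "q + Polynomial.smult ((f s - poly q s) / poly w s) w"
  have "\<forall>z\<in>insert s S. poly ?q z = f z"
    using q w0 ws insert(2) by auto
  then show ?case by blast
qed

text \<open>Interpolating \<open>f\<close> by a polynomial without constant term turns a spectral sum into a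
  combination of power traces, so no eigenvector has to be exhibited.\<close>

lemma spec_sum_eqI_power_sums:
  fixes A :: "complex mat" and c :: "'i \<Rightarrow> complex"
  assumes A: "A \<in> carrier_mat n n" and I: "finite I"
    and tr: "\<And>k. 0 < k \<Longrightarrow> mtrace (A ^\<^sub>m k) = (\<Sum>i\<in>I. c i ^ k)"
    and f0: "f 0 = 0"
  shows "spec_sum f A = (\<Sum>i\<in>I. f (c i))"
proof -
  obtain es where es: "char_poly A = (\<Prod>e\<leftarrow>es. [:- e, 1:])"
    using char_poly_factorized[OF A] by auto
  \<comment> \<open>The node 0 removes the constant term of \<open>q\<close>. Traces of the zeroth
    power would compare the dimension with \<open>card I\<close>, and these differ whenever zero
    eigenvalues are left out of \<open>c\<close>.\<close>
  let ?S = "insert 0 (set es \<union> c ` I)"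
  obtain q where q: "\<And>z. z \<in> ?S \<Longrightarrow> poly q z = complex_of_real (f z)"
    using interpolating_poly_exists[of ?S "\<lambda>z. complex_of_real (f z)"] I by auto
  have "coeff q 0 = 0" using q[of 0] f0 by (simp add: poly_0_coeff_0)
  then have pq: "poly q z = (\<Sum>k\<in>{1..degree q}. coeff q k * z ^ k)" for z
    by (simp add: poly_altdef atMost_atLeast0 sum.atLeast_Suc_atMost)
  have "complex_of_real (spec_sum f A) = (\<Sum>e\<leftarrow>es. complex_of_real (f e))"
    unfolding spec_sum_eq_sum_list[OF es] by (induction es) auto
  also have "\<dots> = (\<Sum>e\<leftarrow>es. poly q e)"
    using q by (intro arg_cong[of _ _ sum_list] map_cong) auto
  also have "\<dots> = (\<Sum>k\<in>{1..degree q}. coeff q k * (\<Sum>e\<leftarrow>es. e ^ k))"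
    unfolding pq by (induction es) (simp_all add: sum.distrib distrib_left)
  also have "\<dots> = (\<Sum>k\<in>{1..degree q}. coeff q k * (\<Sum>i\<in>I. c i ^ k))"
    using tr mtrace_pow_eq_sum_list[OF A es] by (intro sum.cong) auto
  also have "\<dots> = (\<Sum>i\<in>I. poly q (c i))"
    unfolding pq by (simp add: sum_distrib_left, rule sum.swap)
  also have "\<dots> = complex_of_real (\<Sum>i\<in>I. f (c i))"
    using q by simp
  finally show ?thesis using of_real_eq_iff by blast
qed

section \<open>Adjoints, and the Frobenius norm as a lower bound for the trace norm\<close>

lemma adj_carrier [simp]: "A \<in> carrier_mat n m \<Longrightarrow> adj A \<in> carrier_mat m n"
  by (simp add: adj_def)

lemma adj_index [simp]: "i < dim_col A \<Longrightarrow> j < dim_row A \<Longrightarrow> adj A $$ (i,j) = cnj (A $$ (j,i))"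
  by (simp add: adj_def)

lemma adj_dim [simp]: "dim_row (adj A) = dim_col A" "dim_col (adj A) = dim_row A"
  by (simp_all add: adj_def)

text \<open>Pairing the eigenvector equation with the eigenvector \<open>v\<close> itself gives
  \<open>e\<close> times the squared norm of \<open>v\<close> on one side and the squared norm of
  \<open>X v\<close> on the other.\<close>

lemma eigenvalue_adj_mult_nonneg:
  assumes X: "X \<in> carrier_mat n m" and e: "eigenvalue (adj X * X) e"
  shows "0 \<le> Re e" "Im e = 0"
proof -
  from e X obtain v where v: "v \<in> carrier_vec m" "v \<noteq> 0\<^sub>v m" "(adj X * X) *\<^sub>v v = e \<cdot>\<^sub>v v"
    by (auto simp: eigenvalue_def eigenvector_def)
  define N where "N = (\<Sum>j<m. (cmod (v $ j))\<^sup>2)"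
  define W where "W = (\<Sum>i<n. (cmod ((X *\<^sub>v v) $ i))\<^sup>2)"
  have "N \<ge> 0" by (simp add: N_def sum_nonneg)
  moreover have "N \<noteq> 0"
  proof
    assume "N = 0"
    then have "\<forall>j<m. v $ j = 0"
      unfolding N_def by (subst (asm) sum_nonneg_eq_0_iff) auto
    then show False using v by (metis carrier_vecD eq_vecI index_zero_vec(1) index_zero_vec(2))
  qed
  ultimately have N: "N > 0" by simp
  have Xv: "X *\<^sub>v v \<in> carrier_vec n" using X v by (intro mult_mat_vec_carrier)
  have "e * of_real N = (\<Sum>j<m. cnj (v $ j) * (e * v $ j))"
    by (simp add: N_def sum_distrib_left complex_norm_square mult_ac del: of_real_power)
  also have "\<dots> = (\<Sum>j<m. cnj (v $ j) * ((adj X * X) *\<^sub>v v) $ j)"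
    using v by simp
  also have "(adj X * X) *\<^sub>v v = adj X *\<^sub>v (X *\<^sub>v v)"
    using X v by (intro assoc_mult_mat_vec) auto
  also have "(\<Sum>j<m. cnj (v $ j) * (adj X *\<^sub>v (X *\<^sub>v v)) $ j) =
      (\<Sum>j<m. \<Sum>i<n. cnj (v $ j) * cnj (X $$ (i,j)) * (X *\<^sub>v v) $ i)"
    using X Xv by (intro sum.cong refl)
      (simp add: scalar_prod_def atLeast0LessThan sum_distrib_left mult.assoc)
  also have "\<dots> = (\<Sum>i<n. (\<Sum>j<m. cnj (v $ j) * cnj (X $$ (i,j))) * (X *\<^sub>v v) $ i)"
    by (subst sum.swap) (simp add: sum_distrib_right)
  also have "\<dots> = (\<Sum>i<n. cnj ((X *\<^sub>v v) $ i) * (X *\<^sub>v v) $ i)"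
    using X v by (intro sum.cong refl)
      (auto simp add: scalar_prod_def atLeast0LessThan cnj_sum mult.commute)
  also have "\<dots> = of_real W"
    by (simp add: W_def complex_norm_square mult.commute del: of_real_power)
  finally have eq: "e * of_real N = of_real W" .
  have "W \<ge> 0" by (simp add: W_def sum_nonneg)
  have "e = of_real (W / N)" using eq N by (simp add: field_simps)
  then show "0 \<le> Re e" "Im e = 0" using \<open>W \<ge> 0\<close> N by auto
qed

lemma sqrt_sum_list_le:
  assumes "\<And>x. x \<in> set xs \<Longrightarrow> 0 \<le> x"
  shows "sqrt (sum_list xs) \<le> (\<Sum>x\<leftarrow>xs. sqrt x)"
  using assms
proof (induction xs)
  case (Cons x xs)
  have "sqrt (x + sum_list xs) \<le> sqrt x + sqrt (sum_list xs)"
    using Cons by (intro sqrt_add_le_add_sqrt sum_list_nonneg) auto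
  also have "\<dots> \<le> sqrt x + (\<Sum>x\<leftarrow>xs. sqrt x)"
    using Cons by simp
  finally show ?case by simp
qed simp

text \<open>The eigenvalues of \<open>adj X * X\<close> are nonnegative and add up to the squared
  Frobenius norm, and the square root is subadditive. The converse bounds the trace norm from below
  through this estimate.\<close>

lemma frobenius_le_trace_norm:
  assumes X: "X \<in> carrier_mat n m"
  shows "sqrt (\<Sum>i<n. \<Sum>j<m. (cmod (X $$ (i,j)))\<^sup>2) \<le> trace_norm X"
proof -
  let ?A = "adj X * X"
  have A: "?A \<in> carrier_mat m m" by (rule mult_carrier_mat[OF adj_carrier[OF X] X])
  obtain es where es: "char_poly ?A = (\<Prod>e\<leftarrow>es. [:- e, 1:])"
    using char_poly_factorized[OF A] by auto
  have nn: "0 \<le> Re e" if "e \<in> set es" for e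
  proof -
    have "poly (char_poly ?A) e = 0"
      unfolding es using that by (auto simp: poly_prod_list prod_list_zero_iff)
    then show ?thesis
      using eigenvalue_adj_mult_nonneg[OF X] eigenvalue_root_char_poly[OF A] by blast
  qed
  have "mtrace ?A = (\<Sum>j<m. \<Sum>i<n. cnj (X $$ (i,j)) * X $$ (i,j))"
    using X by (auto simp: mtrace_def scalar_prod_def atLeast0LessThan intro!: sum.cong)
  also have "\<dots> = of_real (\<Sum>i<n. \<Sum>j<m. (cmod (X $$ (i,j)))\<^sup>2)"
    by (subst sum.swap) (simp add: complex_norm_square mult.commute del: of_real_power)
  finally have "of_real (\<Sum>i<n. \<Sum>j<m. (cmod (X $$ (i,j)))\<^sup>2) = (\<Sum>e\<leftarrow>es. e)"
    using mtrace_pow_eq_sum_list[OF A es, of 1] A by simp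
  then have "(\<Sum>i<n. \<Sum>j<m. (cmod (X $$ (i,j)))\<^sup>2) = Re (\<Sum>e\<leftarrow>es. e)"
    by (metis Re_complex_of_real)
  also have "\<dots> = (\<Sum>e\<leftarrow>es. Re e)" by (induction es) auto
  finally show ?thesis
    using sqrt_sum_list_le[of "map Re es"] nn
    unfolding trace_norm_def spec_sum_eq_sum_list[OF es] by (auto simp: o_def)
qed

lemma trace_norm_nonneg: "0 \<le> trace_norm X"
proof -
  have "0 \<le> sqrt (\<Sum>i<dim_row X. \<Sum>j<dim_col X. (cmod (X $$ (i,j)))\<^sup>2)"
    by (auto intro!: sum_nonneg)
  also have "\<dots> \<le> trace_norm X"
    by (rule frobenius_le_trace_norm) simp
  finally show ?thesis .
qed

section \<open>Coherence classes of a density matrix\<close>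

text \<open>Vectors are functions on \<open>nat\<close>, the form in which \<open>density\<close>
  states positivity.\<close>

definition sesq :: "nat \<Rightarrow> complex mat \<Rightarrow> (nat \<Rightarrow> complex) \<Rightarrow> (nat \<Rightarrow> complex) \<Rightarrow> complex" where
  "sesq d \<rho> v w = (\<Sum>i<d. \<Sum>j<d. cnj (v i) * \<rho> $$ (i,j) * w j)"

abbreviation unit_fn :: "nat \<Rightarrow> nat \<Rightarrow> complex" where
  "unit_fn i \<equiv> (\<lambda>k. if k = i then 1 else 0)"

lemma sesq_add_right: "sesq d \<rho> v (\<lambda>k. w k + w' k) = sesq d \<rho> v w + sesq d \<rho> v w'"
  by (simp add: sesq_def distrib_left sum.distrib)

lemma sesq_add_left: "sesq d \<rho> (\<lambda>k. v k + v' k) w = sesq d \<rho> v w + sesq d \<rho> v' w"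
  by (simp add: sesq_def distrib_right sum.distrib)

lemma sesq_scale_right: "sesq d \<rho> v (\<lambda>k. c * w k) = c * sesq d \<rho> v w"
  by (simp add: sesq_def sum_distrib_left mult_ac)

lemma sesq_scale_left: "sesq d \<rho> (\<lambda>k. c * v k) w = cnj c * sesq d \<rho> v w"
  by (simp add: sesq_def sum_distrib_left mult_ac)

lemmas sesq_linear = sesq_add_right sesq_add_left sesq_scale_right sesq_scale_left

lemma sesq_unit_fn:
  assumes "i < d" "j < d"
  shows "sesq d \<rho> (unit_fn i) (unit_fn j) = \<rho> $$ (i,j)"
proof -
  have "sesq d \<rho> (unit_fn i) (unit_fn j)
      = (\<Sum>a<d. if a = i then (\<Sum>b<d. if b = j then \<rho> $$ (i,j) else 0) else 0)"
    unfolding sesq_def by (intro sum.cong refl) (auto intro!: sum.cong simp flip: sum.delta)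
  then show ?thesis using assms by simp
qed

context
  fixes d :: nat and \<rho> :: "complex mat"
  assumes dens: "density d \<rho>"
begin

lemma density_carrier: "\<rho> \<in> carrier_mat d d"
  using dens by (simp add: density_def)

lemma density_cnj: "i < d \<Longrightarrow> j < d \<Longrightarrow> cnj (\<rho> $$ (i,j)) = \<rho> $$ (j,i)"
  using dens adj_index[of j \<rho> i] density_carrier by (simp add: density_def)

lemma sesq_cnj: "cnj (sesq d \<rho> v w) = sesq d \<rho> w v"
proof -
  have "cnj (sesq d \<rho> v w) = (\<Sum>i<d. \<Sum>j<d. cnj (w j) * \<rho> $$ (j,i) * v i)"
    by (simp add: sesq_def cnj_sum density_cnj mult_ac)
  then show ?thesis by (subst (asm) sum.swap) (simp add: sesq_def)
qed

lemma sesq_nonneg: "0 \<le> Re (sesq d \<rho> v v)"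
  using dens by (simp add: density_def sesq_def)

lemma sesq_self_real: "sesq d \<rho> v v = of_real (Re (sesq d \<rho> v v))"
  using sesq_cnj[of v v] by (metis Reals_cnj_iff complex_is_Real_iff of_real_Re)

text \<open>The discriminant argument. The form is only semidefinite, so \<open>v\<close> may be a
  null vector and the case \<open>a = 0\<close> is separate.\<close>

lemma sesq_cauchy_schwarz:
  "(cmod (sesq d \<rho> v w))\<^sup>2 \<le> Re (sesq d \<rho> v v) * Re (sesq d \<rho> w w)"
proof -
  define a b z where "a = Re (sesq d \<rho> v v)" and "b = Re (sesq d \<rho> w w)" and "z = sesq d \<rho> v w"
  have a: "sesq d \<rho> v v = of_real a" and b: "sesq d \<rho> w w = of_real b"
    unfolding a_def b_def by (rule sesq_self_real)+
  have wv: "sesq d \<rho> w v = cnj z" unfolding z_def by (simp add: sesq_cnj)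
  have nn: "a \<ge> 0" "b \<ge> 0" unfolding a_def b_def by (rule sesq_nonneg)+
  \<comment> \<open>The coefficient of \<open>v\<close> carries the factor \<open>z\<close>, which
    makes the cross terms real and leaves a quadratic polynomial in the real number
    \<open>s\<close>.\<close>
  have ineq: "0 \<le> s\<^sup>2 * (cmod z)\<^sup>2 * a + b + 2 * s * (cmod z)\<^sup>2" for s :: real
  proof -
    let ?x = "\<lambda>k. (of_real s * z) * v k + w k"
    define r where "r = (cmod z)\<^sup>2"
    have r: "z * cnj z = of_real r" by (simp add: r_def complex_norm_square del: of_real_power)
    have "sesq d \<rho> ?x ?x = of_real s * of_real s * (z * cnj z) * of_real a + of_real b
        + 2 * of_real s * (z * cnj z)"
      by (simp only: sesq_linear a b wv z_def[symmetric]) (simp add: algebra_simps)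
    also have "\<dots> = of_real (s\<^sup>2 * r * a + b + 2 * s * r)"
      unfolding r by (simp add: power2_eq_square)
    finally have "0 \<le> s\<^sup>2 * r * a + b + 2 * s * r"
      using sesq_nonneg[of ?x] by simp
    then show ?thesis by (simp add: r_def)
  qed
  have "(cmod z)\<^sup>2 \<le> a * b"
  proof (cases "a = 0")
    case True
    show ?thesis
    proof (rule ccontr)
      assume "\<not> ?thesis"
      then have zp: "(cmod z)\<^sup>2 > 0" using True by simp
      \<comment> \<open>With \<open>a = 0\<close> the polynomial is linear in \<open>s\<close>, and
        at this \<open>s\<close> it equals \<open>- b - 2\<close>, which is negative.\<close>
      have "2 * (- (b + 1) / (cmod z)\<^sup>2) * (cmod z)\<^sup>2 = - 2 * (b + 1)" using zp by simp
      then show False using ineq[of "- (b + 1) / (cmod z)\<^sup>2"] True nn by simp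
    qed
  next
    case False
    then have ap: "a > 0" using nn by simp
    \<comment> \<open>\<open>- 1 / a\<close> minimises the quadratic polynomial.\<close>
    have "0 \<le> (- 1 / a)\<^sup>2 * (cmod z)\<^sup>2 * a + b + 2 * (- 1 / a) * (cmod z)\<^sup>2" by (rule ineq)
    also have "\<dots> = b - (cmod z)\<^sup>2 / a" using ap by (simp add: field_simps power2_eq_square)
    finally show ?thesis using ap by (simp add: field_simps)
  qed
  then show ?thesis by (simp add: a_def b_def z_def)
qed

lemma density_diag: "i < d \<Longrightarrow> \<rho> $$ (i,i) = of_real (Re (\<rho> $$ (i,i)))"
  using density_cnj[of i i] by (metis Reals_cnj_iff complex_is_Real_iff of_real_Re)

lemma density_diag_nonneg: "i < d \<Longrightarrow> 0 \<le> Re (\<rho> $$ (i,i))"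
  using sesq_nonneg[of "unit_fn i"] by (simp add: sesq_unit_fn)

lemma density_entry_le:
  assumes "i < d" "j < d"
  shows "cmod (\<rho> $$ (i,j)) \<le> sqrt (Re (\<rho> $$ (i,i)) * Re (\<rho> $$ (j,j)))"
  using sesq_cauchy_schwarz[of "unit_fn i" "unit_fn j"] assms
  by (simp add: sesq_unit_fn real_le_rsqrt)

text \<open>Equality in Cauchy--Schwarz puts a combination of the basis vectors \<open>i\<close> and \<open>j\<close> into the
  kernel of \<open>\<rho>\<close>, so columns \<open>i\<close> and \<open>j\<close> are proportional.\<close>

lemma density_extremal_columns:
  assumes ij: "i < d" "j < d" and k: "k < d"
    and pos: "0 < Re (\<rho> $$ (i,i))" "0 < Re (\<rho> $$ (j,j))"
    and eq: "cmod (\<rho> $$ (i,j)) = sqrt (Re (\<rho> $$ (i,i)) * Re (\<rho> $$ (j,j)))"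
  shows "\<rho> $$ (k,j) * Re (\<rho> $$ (i,i)) = \<rho> $$ (i,j) * \<rho> $$ (k,i)"
proof -
  define pi pj z where "pi = Re (\<rho> $$ (i,i))" and "pj = Re (\<rho> $$ (j,j))" and "z = \<rho> $$ (i,j)"
  \<comment> \<open>These coefficients make row \<open>i\<close> of \<rho> annihilate the vector;
    extremality makes row \<open>j\<close> do so too, hence the form vanishes on it.\<close>
  let ?x = "\<lambda>m. z * unit_fn i m + (- of_real pi) * unit_fn j m"
  have z2: "cnj z * z = of_real (pi * pj)"
  proof -
    have "(cmod z)\<^sup>2 = pi * pj" using eq pos by (simp add: pi_def pj_def z_def)
    then show ?thesis by (metis complex_norm_square mult.commute)
  qed
  have ji: "\<rho> $$ (j,i) = cnj z" using density_cnj[OF ij] by (simp add: z_def)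
  have diag: "\<rho> $$ (i,i) = of_real pi" "\<rho> $$ (j,j) = of_real pj"
    unfolding pi_def pj_def by (rule density_diag[OF ij(1)], rule density_diag[OF ij(2)])
  have "sesq d \<rho> ?x ?x = cnj z * z * of_real pi + cnj z * (- of_real pi) * z
      + (- of_real pi) * z * cnj z + of_real pi * of_real pi * of_real pj"
    by (simp only: sesq_linear sesq_unit_fn ij ji z_def[symmetric]
diag)
      (simp add: algebra_simps)
  also have "\<dots> = 0"
    using z2 by (simp add: algebra_simps)
  finally have "sesq d \<rho> ?x ?x = 0" .
  then have "(cmod (sesq d \<rho> (unit_fn k) ?x))\<^sup>2 \<le> 0"
    using sesq_cauchy_schwarz[of "unit_fn k" ?x] by simp
  then have "sesq d \<rho> (unit_fn k) ?x = 0" by simp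
  then have "z * \<rho> $$ (k,i) - of_real pi * \<rho> $$ (k,j) = 0"
    by (simp only: sesq_linear sesq_unit_fn ij k) simp
  then show ?thesis by (simp add: pi_def z_def mult.commute)
qed

end

text \<open>These facts are all that the asymptotic analysis needs of the state, and they pass to
  tensor powers digit by digit. Within a label the state is a rank-one block with phases
  \<open>u\<close>; across labels \<mu> is one uniform contraction constant.\<close>

locale labelled_state =
  fixes d :: nat and \<rho> :: "complex mat" and p :: "nat \<Rightarrow> real" and l :: "nat \<Rightarrow> nat"
    and u :: "nat \<Rightarrow> complex" and \<mu> :: real
  assumes carrier: "\<rho> \<in> carrier_mat d d"
    and p_nonneg: "\<And>i. i < d \<Longrightarrow> 0 \<le> p i"
    and p_sum: "(\<Sum>i<d. p i) = 1"
    and cmod_u: "\<And>i. i < d \<Longrightarrow> cmod (u i) = 1"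
    and same_class: "\<And>i j. i < d \<Longrightarrow> j < d \<Longrightarrow> l i = l j \<Longrightarrow>
      \<rho> $$ (i,j) = of_real (sqrt (p i) * sqrt (p j)) * (u i * cnj (u j))"
    and other_class: "\<And>i j. i < d \<Longrightarrow> j < d \<Longrightarrow> l i \<noteq> l j \<Longrightarrow>
      cmod (\<rho> $$ (i,j)) \<le> \<mu> * (sqrt (p i) * sqrt (p j))"
    and mu: "0 \<le> \<mu>" "\<mu> < 1"

text \<open>The normalised entries \<open>g\<close> satisfy the multiplicative rule
  \<open>g_trans\<close> along extremal pairs, which yields both the transitivity of
  \<open>E\<close> and phases relative to a representative of each class.\<close>

lemma density_imp_labelled_state:
  assumes dens: "density d \<rho>"
  obtains p l u \<mu> where "labelled_state d \<rho> p l u \<mu>"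
proof -
  define p where "p i = Re (\<rho> $$ (i,i))" for i
  define g where "g i j = \<rho> $$ (i,j) / of_real (sqrt (p i) * sqrt (p j))" for i j
  define E where "E i j \<longleftrightarrow> i < d \<and> j < d \<and> 0 < p i \<and> 0 < p j \<and> cmod (g i j) = 1" for i j
  \<comment> \<open>The least equivalent index represents the class. An index of probability zero is
    its own label; its row and column of \<rho> vanish, so both entry conditions hold trivially for
    it.\<close>
  define l where "l i = (if 0 < p i then LEAST j. E i j else i)" for i
  define u where "u i = (if 0 < p i then g i (l i) else 1)" for i
  have pnn: "0 \<le> p i" if "i < d" for i
    using density_diag_nonneg[OF dens that] by (simp add: p_def)
  have le: "cmod (\<rho> $$ (i,j)) \<le> sqrt (p i) * sqrt (p j)" if "i < d" "j < d" for i j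
    using density_entry_le[OF dens that] by (simp add: p_def real_sqrt_mult)
  have zero: "\<rho> $$ (i,j) = 0" if "i < d" "j < d" "p i = 0 \<or> p j = 0" for i j
    using le[OF that(1,2)] that(3) by auto
  have g_cnj: "cnj (g i j) = g j i" if "i < d" "j < d" for i j
    using density_cnj[OF dens that] by (simp add: g_def mult.commute)
  have rho_g: "\<rho> $$ (i,j) = of_real (sqrt (p i) * sqrt (p j)) * g i j"
    if "i < d" "j < d" for i j
    using zero[OF that] by (auto simp: g_def)
  have g_trans: "g k j = g i j * g k i" if "E i j" "k < d" "0 < p k" for i j k
  proof -
    have ij: "i < d" "j < d" "0 < p i" "0 < p j" "cmod (g i j) = 1"
      using that by (auto simp: E_def)
    have "cmod (\<rho> $$ (i,j)) = sqrt (p i) * sqrt (p j)"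
      using rho_g[OF ij(1,2)] ij by (simp add: norm_mult)
    then have "\<rho> $$ (k,j) * p i = \<rho> $$ (i,j) * \<rho> $$ (k,i)"
      using density_extremal_columns[OF dens ij(1,2) that(2)] ij
      by (simp add: p_def real_sqrt_mult)
    then have eq: "of_real (sqrt (p k) * sqrt (p j)) * g k j * of_real (p i)
       = of_real (sqrt (p i) * sqrt (p j)) * g i j * (of_real (sqrt (p k) * sqrt (p i)) * g k i)"
      using ij rho_g that(2) by simp
    define c where "c = complex_of_real (sqrt (p k) * sqrt (p j) * p i)"
    have sq: "complex_of_real (sqrt (p i)) * of_real (sqrt (p i)) = of_real (p i)"
      using ij by (simp flip: of_real_mult)
    have "of_real (sqrt (p i) * sqrt (p j)) * g i j * (of_real (sqrt (p k) * sqrt (p i)) * g k i)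
       = (of_real (sqrt (p i)) * of_real (sqrt (p i))) *
         (of_real (sqrt (p k) * sqrt (p j)) * (g i j * g k i))"
      by simp
    also have "\<dots> = c * (g i j * g k i)"
      unfolding sq by (simp add: c_def)
    finally have "of_real (sqrt (p i) * sqrt (p j)) * g i j * (of_real (sqrt (p k) * sqrt (p i)) * g k i)
       = c * (g i j * g k i)" .
    moreover have "of_real (sqrt (p k) * sqrt (p j)) * g k j * of_real (p i) = c * g k j"
      by (simp add: c_def)
    ultimately have "c * g k j = c * (g i j * g k i)" using eq by (simp only:)
    moreover have "c \<noteq> 0" using ij that(3) by (simp add: c_def)
    ultimately show ?thesis by simp
  qed
  have E_refl: "E i i" if "i < d" "0 < p i" for i
  proof -
    have "g i i = of_real (p i) / of_real (sqrt (p i) * sqrt (p i))"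
      using density_diag[OF dens that(1)] by (simp add: g_def p_def)
    also have "\<dots> = 1" using that by (simp del: of_real_mult)
    finally show ?thesis using that by (simp add: E_def)
  qed
  have E_sym: "E j i" if "E i j" for i j
    using that g_cnj[of i j] by (auto simp: E_def) (metis complex_mod_cnj)
  have E_trans: "E i k" if "E i j" "E j k" for i j k
    using g_trans[OF that(2), of i] that by (auto simp: E_def norm_mult)
  have E_l: "E i (l i)" if "i < d" "0 < p i" for i
    using E_refl[OF that] that by (auto simp: l_def intro: LeastI)
  have l_eq: "l i = l j" if "E i j" for i j
  proof -
    have "E i k \<longleftrightarrow> E j k" for k
      using E_trans[OF E_sym[OF that]] E_trans[OF that] by (rule iffI)
    then have "E i = E j" by (rule ext)
    moreover have "0 < p i" "0 < p j" using that by (auto simp: E_def)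
    ultimately show ?thesis by (simp add: l_def)
  qed
  let ?R = "{cmod (g i j) | i j. i < d \<and> j < d \<and> 0 < p i \<and> 0 < p j \<and> cmod (g i j) \<noteq> 1}"
  have "?R \<subseteq> (\<lambda>(i,j). cmod (g i j)) ` ({..<d} \<times> {..<d})" by auto
  then have finR: "finite ?R" by (rule finite_subset) simp
  have g_le: "cmod (g i j) \<le> 1" if "i < d" "j < d" "0 < p i" "0 < p j" for i j
    using le[OF that(1,2)] that by (simp add: g_def norm_divide norm_mult)
  \<comment> \<open>There are finitely many non-extremal moduli, each below 1, so their maximum is
    below 1 too; the inserted 0 covers the case that there are none.\<close>
  define \<mu> where "\<mu> = Max (insert 0 ?R)"
  have "labelled_state d \<rho> p l u \<mu>"
  proof
    show "\<rho> \<in> carrier_mat d d" by (rule density_carrier[OF dens])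
    have "of_real (\<Sum>i<d. p i) = mtrace \<rho>"
      using density_carrier[OF dens] density_diag[OF dens] by (simp add: mtrace_def p_def)
    also have "\<dots> = 1" using dens by (simp add: density_def)
    finally show "(\<Sum>i<d. p i) = 1" using of_real_eq_1_iff by blast
    show "cmod (u i) = 1" if "i < d" for i
      using E_l[OF that] by (auto simp: u_def E_def)
    show "0 \<le> p i" if "i < d" for i by (rule pnn[OF that])
    show "0 \<le> \<mu>" unfolding \<mu>_def using finR by simp
    have "r < 1" if "r \<in> insert 0 ?R" for r
      using that g_le by (auto intro!: order.not_eq_order_implies_strict)
    then show "\<mu> < 1" unfolding \<mu>_def using finR by (subst Max_less_iff) auto
    show "\<rho> $$ (i,j) = of_real (sqrt (p i) * sqrt (p j)) * (u i * cnj (u j))"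
      if ij: "i < d" "j < d" "l i = l j" for i j
    proof (cases "p i = 0 \<or> p j = 0")
      case True
      then show ?thesis using zero[OF ij(1,2)] by auto
    next
      case False
      then have pos: "0 < p i" "0 < p j" using pnn ij by (simp_all add: less_le)
      \<comment> \<open>The entry factors through the common representative: one factor is the phase
        of \<open>i\<close>, the other the conjugate phase of \<open>j\<close>.\<close>
      have "g i j = g (l i) j * g i (l i)"
        using g_trans[OF E_sym[OF E_l[OF ij(2) pos(2)]] ij(1) pos(1)] ij by simp
      moreover have "g (l i) j = cnj (u j)"
        using E_l[OF ij(2) pos(2)] ij pos g_cnj[of j "l j"] by (simp add: u_def E_def)
      ultimately show ?thesis using rho_g[OF ij(1,2)] pos by (simp add: u_def mult_ac)
    qed
    show "cmod (\<rho> $$ (i,j)) \<le> \<mu> * (sqrt (p i) * sqrt (p j))"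
      if ij: "i < d" "j < d" "l i \<noteq> l j" for i j
    proof (cases "p i = 0 \<or> p j = 0")
      case True
      then show ?thesis using zero[OF ij(1,2)] by auto
    next
      case False
      then have pos: "0 < p i" "0 < p j" using pnn ij by (simp_all add: less_le)
      then have "cmod (g i j) \<noteq> 1" using l_eq ij by (auto simp: E_def)
      then have "cmod (g i j) \<le> \<mu>"
        unfolding \<mu>_def using finR ij pos by (intro Max_ge) auto
      then show ?thesis using rho_g[OF ij(1,2)] pos by (simp add: norm_mult mult.commute)
    qed
  qed
  then show thesis by (rule that)
qed

section \<open>Entropies, and Q as a mean conditional surprisal\<close>

lemma xlogx_eq: "xlogx x = x * log 2 x"
  by (simp add: xlogx_def)

context labelled_state
begin

text \<open>Attached to an index rather than to a label, so that products along a sequence can be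
  formed directly.\<close>

definition class_weight :: "nat \<Rightarrow> real" where
  "class_weight i = (\<Sum>j<d. if l j = l i then p j else 0)"

text \<open>The default 0 at \<open>p i = 0\<close> enters means only with weight zero.\<close>

definition surprisal :: "nat \<Rightarrow> real" where
  "surprisal i = (if p i = 0 then 0 else log 2 (class_weight i) - log 2 (p i))"

lemma diag_eq: "i < d \<Longrightarrow> \<rho> $$ (i,i) = of_real (p i)"
  using same_class[of i i] cmod_u[of i] p_nonneg[of i]
  by (simp add: complex_norm_square[symmetric] flip: of_real_mult)

lemma p_le_class_weight: "i < d \<Longrightarrow> p i \<le> class_weight i"
proof -
  assume i: "i < d"
  have "(\<Sum>j\<in>{i}. if l j = l i then p j else 0) \<le> class_weight i"
    unfolding class_weight_def by (rule sum_mono2) (use i p_nonneg in auto)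
  then show ?thesis by simp
qed

lemma rhobar_carrier: "rhobar \<rho> \<in> carrier_mat d d"
  using carrier by (simp add: rhobar_def)

text \<open>Since \<mu> is below 1, an entry between classes can pass the equality test of
  \<open>rhobar\<close> only when both sides of the test vanish. So \<open>rhobar\<close> is block
  diagonal with rank-one blocks.\<close>

lemma rhobar_eq:
  assumes "i < d" "j < d"
  shows "rhobar \<rho> $$ (i,j) =
    (if l i = l j then of_real (sqrt (p i) * sqrt (p j)) * (u i * cnj (u j)) else 0)"
proof (cases "l i = l j")
  case True
  then have "cmod (\<rho> $$ (i,j)) = sqrt (p i) * sqrt (p j)"
    using same_class[OF assms] cmod_u assms p_nonneg by (simp add: norm_mult)
  then show ?thesis
    using True assms carrier same_class[OF assms] by (simp add: rhobar_def diag_eq real_sqrt_mult)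
next
  case False
  have "\<rho> $$ (i,j) = 0" if "cmod (\<rho> $$ (i,j)) = sqrt (p i) * sqrt (p j)"
  proof -
    define s where "s = sqrt (p i) * sqrt (p j)"
    have "s \<le> \<mu> * s" using other_class[OF assms False] that by (simp add: s_def)
    then have "(1 - \<mu>) * s \<le> 0" by (simp add: left_diff_distrib)
    moreover have "0 \<le> s" using p_nonneg assms by (simp add: s_def)
    ultimately have "s = 0" using mu by (simp add: mult_le_0_iff)
    then show ?thesis using that by (auto simp: s_def)
  qed
  then show ?thesis
    using False assms carrier by (simp add: rhobar_def diag_eq real_sqrt_mult)
qed

text \<open>A rank-one block is multiplied by its trace, the weight of the class, with every further
  factor. Exponents start at 1 because the zeroth power is the identity on the whole space.\<close>

lemma rhobar_pow:
  assumes "i < d" "j < d"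
  shows "(rhobar \<rho> ^\<^sub>m Suc k) $$ (i,j) =
    (if l i = l j then of_real (sqrt (p i) * sqrt (p j) * class_weight i ^ k) * (u i * cnj (u j)) else 0)"
  using assms
proof (induction k arbitrary: j)
  case 0
  then show ?case using rhobar_carrier rhobar_eq by simp
next
  case (Suc k)
  have c: "rhobar \<rho> ^\<^sub>m Suc k \<in> carrier_mat d d" by (rule pow_carrier_mat[OF rhobar_carrier])
  let ?W = "class_weight i ^ k"
  have "(rhobar \<rho> ^\<^sub>m Suc (Suc k)) $$ (i,j)
      = (\<Sum>m<d. (rhobar \<rho> ^\<^sub>m Suc k) $$ (i,m) * rhobar \<rho> $$ (m,j))"
    using c rhobar_carrier Suc by (simp add: scalar_prod_def atLeast0LessThan del: pow_mat.simps(2) add: pow_mat.simps(2)[of _ "Suc k"])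
  also have "\<dots> = (\<Sum>m<d. if l i = l j then (if l m = l i then of_real (p m) else 0) *
      (of_real (sqrt (p i) * sqrt (p j) * ?W) * (u i * cnj (u j))) else 0)"
  proof (rule sum.cong)
    fix m assume "m \<in> {..<d}"
    then have m: "m < d" by simp
    have um: "cnj (u m) * u m = 1"
      using cmod_u[OF m] by (metis complex_norm_square mult.commute of_real_1 one_power2)
    have pm: "complex_of_real (sqrt (p m)) * of_real (sqrt (p m)) = of_real (p m)"
      using p_nonneg[OF m] by (simp flip: of_real_mult)
    have "of_real (sqrt (p i) * sqrt (p m) * ?W) * (u i * cnj (u m)) *
        (of_real (sqrt (p m) * sqrt (p j)) * (u m * cnj (u j)))
      = (of_real (sqrt (p m)) * of_real (sqrt (p m))) * (cnj (u m) * u m) *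
        (of_real (sqrt (p i) * sqrt (p j) * ?W) * (u i * cnj (u j)))"
      by simp
    then have "of_real (sqrt (p i) * sqrt (p m) * ?W) * (u i * cnj (u m)) *
        (of_real (sqrt (p m) * sqrt (p j)) * (u m * cnj (u j)))
      = of_real (p m) * (of_real (sqrt (p i) * sqrt (p j) * ?W) * (u i * cnj (u j)))"
      unfolding um pm by simp
    then show "(rhobar \<rho> ^\<^sub>m Suc k) $$ (i,m) * rhobar \<rho> $$ (m,j) =
      (if l i = l j then (if l m = l i then of_real (p m) else 0) *
      (of_real (sqrt (p i) * sqrt (p j) * ?W) * (u i * cnj (u j))) else 0)"
      using Suc.IH[OF Suc.prems(1) m] rhobar_eq[OF m Suc.prems(2)]
      by (auto simp del: pow_mat.simps)
  qed simp
  also have "\<dots> = (if l i = l j then of_real (\<Sum>m<d. if l m = l i then p m else 0) *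
      (of_real (sqrt (p i) * sqrt (p j) * ?W) * (u i * cnj (u j))) else 0)"
    by (simp add: sum_distrib_right if_distrib[of of_real] cong: if_cong)
  finally show ?case by (simp add: class_weight_def mult_ac del: pow_mat.simps)
qed

text \<open>The indices of a class share one weight. Grouping them turns a mean over indices into a
  sum over classes, the index set for the spectrum of \<open>rhobar\<close>.\<close>

lemma sum_p_class_weight:
  "(\<Sum>i<d. p i * F (class_weight i)) = (\<Sum>c\<in>l ` {..<d}. (\<Sum>j<d. if l j = c then p j else 0) *
     F (\<Sum>j<d. if l j = c then p j else 0))"
proof -
  have "(\<Sum>i<d. p i * F (class_weight i))
      = (\<Sum>c\<in>l ` {..<d}. \<Sum>i\<in>{i \<in> {..<d}. l i = c}. p i * F (class_weight i))"
    by (rule sum.image_gen) simp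
  also have "\<dots> = (\<Sum>c\<in>l ` {..<d}. \<Sum>i\<in>{i \<in> {..<d}. l i = c}.
      p i * F (\<Sum>j<d. if l j = c then p j else 0))"
    by (intro sum.cong refl) (simp add: class_weight_def)
  also have "\<dots> = (\<Sum>c\<in>l ` {..<d}. (\<Sum>i\<in>{i \<in> {..<d}. l i = c}. p i) *
      F (\<Sum>j<d. if l j = c then p j else 0))"
    by (simp only: sum_distrib_right)
  finally show ?thesis
    by (simp only: sum.inter_filter[OF finite_lessThan])
qed

text \<open>The power traces see one eigenvalue per class, its weight; the remaining eigenvalues are
  0 and contribute nothing to the entropy.\<close>

lemma entropy_rhobar: "entropy (rhobar \<rho>) = - (\<Sum>i<d. p i * log 2 (class_weight i))"
proof -
  let ?w = "\<lambda>c. \<Sum>j<d. if l j = c then p j else 0"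
  have "spec_sum (\<lambda>z. xlogx (Re z)) (rhobar \<rho>)
      = (\<Sum>c\<in>l ` {..<d}. xlogx (Re (complex_of_real (?w c))))"
  proof (rule spec_sum_eqI_power_sums[OF rhobar_carrier])
    fix k :: nat assume "0 < k"
    then obtain k' where k': "k = Suc k'" by (cases k) auto
    have c: "rhobar \<rho> ^\<^sub>m k \<in> carrier_mat d d" by (rule pow_carrier_mat[OF rhobar_carrier])
    have "mtrace (rhobar \<rho> ^\<^sub>m k) = (\<Sum>i<d. (rhobar \<rho> ^\<^sub>m k) $$ (i,i))"
      using carrier_matD[OF c] unfolding mtrace_def by simp
    also have "\<dots> = (\<Sum>i<d. of_real (p i * class_weight i ^ k'))"
    proof (rule sum.cong)
      fix i assume "i \<in> {..<d}"
      then have i: "i < d" by simp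
      have "u i * cnj (u i) = 1" using cmod_u[OF i] by (metis complex_norm_square of_real_1 one_power2)
      then show "(rhobar \<rho> ^\<^sub>m k) $$ (i,i) = of_real (p i * class_weight i ^ k')"
        unfolding k' rhobar_pow[OF i i] using p_nonneg[OF i] by simp
    qed simp
    also have "\<dots> = of_real (\<Sum>i<d. p i * class_weight i ^ k')" by simp
    also have "\<dots> = of_real (\<Sum>c\<in>l ` {..<d}. ?w c * ?w c ^ k')"
      by (subst sum_p_class_weight) simp
    finally show "mtrace (rhobar \<rho> ^\<^sub>m k) = (\<Sum>c\<in>l ` {..<d}. complex_of_real (?w c) ^ k)"
      by (simp add: k')
  qed (simp_all add: xlogx_def)
  also have "\<dots> = (\<Sum>c\<in>l ` {..<d}. ?w c * log 2 (?w c))"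
    by (simp only: xlogx_eq Re_complex_of_real)
  also have "\<dots> = (\<Sum>i<d. p i * log 2 (class_weight i))"
    by (rule sum_p_class_weight[symmetric])
  finally show ?thesis by (simp add: entropy_def)
qed

lemma entropy_dephase: "entropy (dephase \<rho>) = - (\<Sum>i<d. p i * log 2 (p i))"
proof -
  have c: "dephase \<rho> \<in> carrier_mat d d" using carrier by (simp add: dephase_def)
  have ut: "upper_triangular (dephase \<rho>)"
    using carrier by (auto intro!: upper_triangularI simp: dephase_def)
  have "spec_sum (\<lambda>z. xlogx (Re z)) (dephase \<rho>) = (\<Sum>i<d. xlogx (Re (complex_of_real (p i))))"
  proof (rule spec_sum_eqI_power_sums[OF c])
    fix k :: nat
    have ck: "dephase \<rho> ^\<^sub>m k \<in> carrier_mat d d" by (rule pow_carrier_mat[OF c])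
    have "mtrace (dephase \<rho> ^\<^sub>m k) = (\<Sum>i<d. (dephase \<rho> $$ (i,i)) ^ k)"
      using upper_triangular_pow_diag[OF c ut, of k] carrier_matD[OF ck] unfolding mtrace_def by simp
    also have "\<dots> = (\<Sum>i<d. complex_of_real (p i) ^ k)"
      using carrier by (simp add: dephase_def diag_eq)
    finally show "mtrace (dephase \<rho> ^\<^sub>m k) = (\<Sum>i<d. complex_of_real (p i) ^ k)" .
  qed (simp_all add: xlogx_def)
  also have "\<dots> = (\<Sum>i<d. p i * log 2 (p i))" by (intro sum.cong) (simp_all add: xlogx_def)
  finally show ?thesis by (simp add: entropy_def)
qed

lemma Qcoh_eq: "Qcoh \<rho> = (\<Sum>i<d. p i * surprisal i)"
proof -
  have "Qcoh \<rho> = (\<Sum>i<d. p i * log 2 (class_weight i) - p i * log 2 (p i))"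
    unfolding Qcoh_def entropy_rhobar entropy_dephase by (simp add: sum_subtractf)
  also have "\<dots> = (\<Sum>i<d. p i * surprisal i)"
    by (intro sum.cong) (auto simp: surprisal_def right_diff_distrib)
  finally show ?thesis .
qed

end

section \<open>Typical sequences\<close>

text \<open>The index convention of \<open>kron\<close> and \<open>ptrace2\<close>: \<open>x\<close>
  stands for the pair of \<open>x div m\<close> and \<open>x mod m\<close>.\<close>

lemma sum_lessThan_mult_divmod:
  fixes F :: "nat \<Rightarrow> nat \<Rightarrow> 'a::comm_monoid_add"
  assumes "0 < m"
  shows "(\<Sum>x<N * m. F (x div m) (x mod m)) = (\<Sum>a<N. \<Sum>k<m. F a k)"
proof -
  have "(\<Sum>a<N. \<Sum>k<m. F a k) = (\<Sum>(a,k)\<in>{..<N} \<times> {..<m}. F a k)"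
    by (rule sum.cartesian_product)
  also have "\<dots> = (\<Sum>x<N * m. F (x div m) (x mod m))"
  proof (rule sum.reindex_bij_witness[of _ "\<lambda>x. (x div m, x mod m)" "\<lambda>(a,k). a * m + k"])
    fix q assume q: "q \<in> {..<N} \<times> {..<m}"
    obtain a k where [simp]: "q = (a, k)" by (cases q)
    have "Suc a * m \<le> N * m" using q by (intro mult_le_mono1) auto
    then show "(case q of (a, k) \<Rightarrow> a * m + k) \<in> {..<N * m}" using q by simp
  qed (use assms in \<open>auto simp: less_mult_imp_div_less\<close>)
  finally show ?thesis by simp
qed

context labelled_state
begin

text \<open>A word of length \<open>n\<close> is coded by a number below \<open>d ^ n\<close>
  through its base-\<open>d\<close> digits, the lowest digit being the last tensor factor as in
  \<open>tpow\<close>.\<close>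

primrec seq_prob :: "nat \<Rightarrow> nat \<Rightarrow> real" where
  "seq_prob 0 x = 1"
| "seq_prob (Suc n) x = seq_prob n (x div d) * p (x mod d)"

primrec seq_phase :: "nat \<Rightarrow> nat \<Rightarrow> complex" where
  "seq_phase 0 x = 1"
| "seq_phase (Suc n) x = seq_phase n (x div d) * u (x mod d)"

primrec seq_class :: "nat \<Rightarrow> nat \<Rightarrow> nat list" where
  "seq_class 0 x = []"
| "seq_class (Suc n) x = l (x mod d) # seq_class n (x div d)"

primrec seq_weight :: "nat \<Rightarrow> nat \<Rightarrow> real" where
  "seq_weight 0 x = 1"
| "seq_weight (Suc n) x = seq_weight n (x div d) * class_weight (x mod d)"

primrec seq_surprisal :: "nat \<Rightarrow> nat \<Rightarrow> real" where
  "seq_surprisal 0 x = 0"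
| "seq_surprisal (Suc n) x = seq_surprisal n (x div d) + surprisal (x mod d)"

lemma d_pos: "0 < d"
  using p_sum by (cases d) auto

lemma digit_bounds:
  assumes "x < d ^ Suc n"
  shows "x div d < d ^ n" "x mod d < d"
  using assms d_pos by (simp_all add: less_mult_imp_div_less mult.commute)

lemma sum_digits:
  fixes F :: "nat \<Rightarrow> nat \<Rightarrow> 'a::comm_monoid_add"
  shows "(\<Sum>x<d ^ Suc n. F (x div d) (x mod d)) = (\<Sum>a<d ^ n. \<Sum>k<d. F a k)"
  using sum_lessThan_mult_divmod[OF d_pos, of F "d ^ n"] by (simp add: mult.commute)

lemma seq_prob_nonneg: "x < d ^ n \<Longrightarrow> 0 \<le> seq_prob n x"
proof (induction n arbitrary: x)
  case (Suc n)
  then show ?case using digit_bounds[OF Suc.prems] p_nonneg by simp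
qed simp

lemma seq_prob_sum: "(\<Sum>x<d ^ n. seq_prob n x) = 1"
proof (induction n)
  case (Suc n)
  have "(\<Sum>x<d ^ Suc n. seq_prob (Suc n) x) = (\<Sum>a<d ^ n. \<Sum>k<d. seq_prob n a * p k)"
    unfolding seq_prob.simps by (rule sum_digits)
  then show ?case using Suc p_sum by (simp add: sum_distrib_left[symmetric])
qed simp

lemma cmod_seq_phase: "x < d ^ n \<Longrightarrow> cmod (seq_phase n x) = 1"
proof (induction n arbitrary: x)
  case (Suc n)
  then show ?case using digit_bounds[OF Suc.prems] cmod_u by (simp add: norm_mult)
qed simp

lemma tpow_carrier: "tpow \<rho> n \<in> carrier_mat (d ^ n) (d ^ n)"
proof (induction n)
  case (Suc n)
  then show ?case using carrier by (simp add: kron_def mult.commute)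
qed simp

lemma tpow_Suc_entry:
  assumes "x < d ^ Suc n" "y < d ^ Suc n"
  shows "tpow \<rho> (Suc n) $$ (x,y) = tpow \<rho> n $$ (x div d, y div d) * \<rho> $$ (x mod d, y mod d)"
  using assms tpow_carrier[of n] carrier by (simp add: kron_def mult.commute)

lemma tpow_same_class:
  assumes "x < d ^ n" "y < d ^ n" "seq_class n x = seq_class n y"
  shows "tpow \<rho> n $$ (x,y) =
    of_real (sqrt (seq_prob n x) * sqrt (seq_prob n y)) * (seq_phase n x * cnj (seq_phase n y))"
  using assms
proof (induction n arbitrary: x y)
  case (Suc n)
  note b = digit_bounds[OF Suc.prems(1)] digit_bounds[OF Suc.prems(2)]
  have "\<rho> $$ (x mod d, y mod d) = of_real (sqrt (p (x mod d)) * sqrt (p (y mod d))) *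
      (u (x mod d) * cnj (u (y mod d)))"
    using b Suc.prems by (intro same_class) auto
  then show ?case
    using Suc.IH[OF b(1,3)] Suc.prems
    by (simp add: tpow_Suc_entry real_sqrt_mult mult_ac del: tpow.simps power_Suc)
qed simp

lemma state_entry_le:
  assumes "i < d" "j < d"
  shows "cmod (\<rho> $$ (i,j)) \<le> sqrt (p i) * sqrt (p j)"
proof (cases "l i = l j")
  case True
  then show ?thesis using same_class[OF assms] cmod_u assms p_nonneg by (simp add: norm_mult)
next
  case False
  have "\<mu> * (sqrt (p i) * sqrt (p j)) \<le> 1 * (sqrt (p i) * sqrt (p j))"
    using mu p_nonneg assms by (intro mult_right_mono) auto
  then show ?thesis using other_class[OF assms False] by simp
qed

lemma tpow_entry_le:
  assumes "x < d ^ n" "y < d ^ n"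
  shows "cmod (tpow \<rho> n $$ (x,y)) \<le> sqrt (seq_prob n x) * sqrt (seq_prob n y)"
  using assms
proof (induction n arbitrary: x y)
  case (Suc n)
  note b = digit_bounds[OF Suc.prems(1)] digit_bounds[OF Suc.prems(2)]
  have "cmod (tpow \<rho> n $$ (x div d, y div d)) * cmod (\<rho> $$ (x mod d, y mod d))
     \<le> (sqrt (seq_prob n (x div d)) * sqrt (seq_prob n (y div d))) *
       (sqrt (p (x mod d)) * sqrt (p (y mod d)))"
    using Suc.IH[OF b(1,3)] state_entry_le[OF b(2,4)] seq_prob_nonneg[OF b(1)] seq_prob_nonneg[OF b(3)]
    by (intro mult_mono) auto
  then show ?case
    unfolding tpow_Suc_entry[OF Suc.prems(1,2)] norm_mult seq_prob.simps real_sqrt_mult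
    by (simp only: mult_ac)
qed simp

text \<open>One site with different classes supplies the factor \<mu>; the remaining sites are
  bounded by Cauchy-Schwarz alone.\<close>

lemma tpow_other_class:
  assumes "x < d ^ n" "y < d ^ n" "seq_class n x \<noteq> seq_class n y"
  shows "cmod (tpow \<rho> n $$ (x,y)) \<le> \<mu> * (sqrt (seq_prob n x) * sqrt (seq_prob n y))"
  using assms
proof (induction n arbitrary: x y)
  case (Suc n)
  note b = digit_bounds[OF Suc.prems(1)] digit_bounds[OF Suc.prems(2)]
  let ?s = "sqrt (seq_prob n (x div d)) * sqrt (seq_prob n (y div d))"
  let ?t = "sqrt (p (x mod d)) * sqrt (p (y mod d))"
  have nn: "0 \<le> ?s" "0 \<le> ?t"
    using seq_prob_nonneg[OF b(1)] seq_prob_nonneg[OF b(3)] p_nonneg[OF b(2)] p_nonneg[OF b(4)]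
    by simp_all
  have "cmod (tpow \<rho> n $$ (x div d, y div d)) * cmod (\<rho> $$ (x mod d, y mod d)) \<le> \<mu> * (?s * ?t)"
  proof (cases "l (x mod d) = l (y mod d)")
    case True
    then have "seq_class n (x div d) \<noteq> seq_class n (y div d)"
      using Suc.prems(3) unfolding seq_class.simps list.inject by blast
    then have "cmod (tpow \<rho> n $$ (x div d, y div d)) \<le> \<mu> * ?s"
      by (rule Suc.IH[OF b(1,3)])
    then have "cmod (tpow \<rho> n $$ (x div d, y div d)) * cmod (\<rho> $$ (x mod d, y mod d))
       \<le> (\<mu> * ?s) * ?t"
      using state_entry_le[OF b(2,4)] nn mu by (intro mult_mono) auto
    then show ?thesis by (simp add: mult.assoc)
  next
    case False
    have "cmod (tpow \<rho> n $$ (x div d, y div d)) * cmod (\<rho> $$ (x mod d, y mod d)) \<le> ?s * (\<mu> * ?t)"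
      using other_class[OF b(2,4) False] tpow_entry_le[OF b(1,3)] nn by (intro mult_mono) auto
    then show ?thesis by (simp add: mult_ac)
  qed
  then show ?case
    unfolding tpow_Suc_entry[OF Suc.prems(1,2)] norm_mult seq_prob.simps real_sqrt_mult
    by (simp only: mult_ac)
qed simp

text \<open>Words with prescribed classes form a product set, so their total probability factorises
  digit by digit.\<close>

lemma seq_weight_eq:
  assumes "x < d ^ n"
  shows "(\<Sum>y<d ^ n. if seq_class n y = seq_class n x then seq_prob n y else 0) = seq_weight n x"
  using assms
proof (induction n arbitrary: x)
  case (Suc n)
  note b = digit_bounds[OF Suc.prems]
  have "(\<Sum>y<d ^ Suc n. if seq_class (Suc n) y = seq_class (Suc n) x then seq_prob (Suc n) y else 0)
    = (\<Sum>a<d ^ n. \<Sum>k<d. if l k # seq_class n a = seq_class (Suc n) x then seq_prob n a * p k else 0)"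
    unfolding seq_prob.simps seq_class.simps
    by (rule sum_digits[where F = "\<lambda>a k. if l k # seq_class n a = l (x mod d) # seq_class n (x div d)
       then seq_prob n a * p k else 0"])
  also have "\<dots> = (\<Sum>a<d ^ n. \<Sum>k<d. (if seq_class n a = seq_class n (x div d) then seq_prob n a else 0) *
      (if l k = l (x mod d) then p k else 0))"
    unfolding seq_class.simps list.inject by (intro sum.cong) auto
  also have "\<dots> = (\<Sum>a<d ^ n. if seq_class n a = seq_class n (x div d) then seq_prob n a else 0) *
      class_weight (x mod d)"
    by (simp only: class_weight_def sum_product)
  finally show ?case using Suc.IH[OF b(1)] by simp
qed simp

lemma seq_weight_nonneg: "x < d ^ n \<Longrightarrow> 0 \<le> seq_weight n x"
  by (subst seq_weight_eq[symmetric]) (auto intro!: sum_nonneg simp: seq_prob_nonneg)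

lemma p_eq_surprisal:
  assumes "i < d" "p i \<noteq> 0"
  shows "p i = class_weight i * 2 powr (- surprisal i)"
proof -
  have "0 < p i" using assms p_nonneg by (simp add: less_le)
  moreover from this have "0 < class_weight i" using p_le_class_weight[OF assms(1)] by linarith
  ultimately show ?thesis
    by (simp add: surprisal_def powr_diff powr_minus)
qed

lemma seq_prob_eq_surprisal:
  assumes "x < d ^ n" "seq_prob n x \<noteq> 0"
  shows "seq_prob n x = seq_weight n x * 2 powr (- seq_surprisal n x)"
  using assms
proof (induction n arbitrary: x)
  case (Suc n)
  note b = digit_bounds[OF Suc.prems(1)]
  have "seq_prob n (x div d) = seq_weight n (x div d) * 2 powr (- seq_surprisal n (x div d))"
    using Suc.IH[OF b(1)] Suc.prems by simp
  moreover have "p (x mod d) = class_weight (x mod d) * 2 powr (- surprisal (x mod d))"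
    using p_eq_surprisal[OF b(2)] Suc.prems by simp
  moreover have "2 powr (- seq_surprisal (Suc n) x)
      = 2 powr (- seq_surprisal n (x div d)) * 2 powr (- surprisal (x mod d))"
    by (simp flip: powr_add)
  ultimately show ?case by (simp only: seq_prob.simps seq_weight.simps mult_ac)
qed simp

section \<open>Concentration of the surprisal, and counting of typical words\<close>

definition surprisal_variance :: real where
  "surprisal_variance = (\<Sum>i<d. p i * (surprisal i - Qcoh \<rho>)\<^sup>2)"

text \<open>Under \<open>seq_prob\<close> the digits are independent and the surprisal is additive,
  so variances add. The cross term vanishes because the surprisal of one digit has mean
  \<open>Qcoh \<rho>\<close>.\<close>

lemma seq_surprisal_moments:
  "(\<Sum>x<d ^ n. seq_prob n x * (seq_surprisal n x - n * Qcoh \<rho>)) = 0"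
  "(\<Sum>x<d ^ n. seq_prob n x * (seq_surprisal n x - n * Qcoh \<rho>)\<^sup>2) = n * surprisal_variance"
proof (induction n)
  case (Suc n)
  define A where "A a = seq_surprisal n a - n * Qcoh \<rho>" for a
  define B where "B k = surprisal k - Qcoh \<rho>" for k
  have shift: "seq_surprisal (Suc n) x - Suc n * Qcoh \<rho> = A (x div d) + B (x mod d)" for x
    by (simp add: A_def B_def algebra_simps)
  have B1: "(\<Sum>k<d. p k * B k) = 0"
    using p_sum by (simp add: B_def right_diff_distrib sum_subtractf Qcoh_eq flip: sum_distrib_right)
  have B2: "(\<Sum>k<d. p k * (B k)\<^sup>2) = surprisal_variance"
    by (simp add: surprisal_variance_def B_def)
  have A: "(\<Sum>a<d ^ n. seq_prob n a * A a) = 0"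
    "(\<Sum>a<d ^ n. seq_prob n a * (A a)\<^sup>2) = n * surprisal_variance"
    using Suc by (simp_all add: A_def)
  have "(\<Sum>x<d ^ Suc n. seq_prob (Suc n) x * (seq_surprisal (Suc n) x - Suc n * Qcoh \<rho>))
      = (\<Sum>a<d ^ n. \<Sum>k<d. (seq_prob n a * p k) * (A a + B k))"
    unfolding shift seq_prob.simps by (rule sum_digits)
  also have "\<dots> = (\<Sum>a<d ^ n. \<Sum>k<d. (seq_prob n a * A a) * p k + seq_prob n a * (p k * B k))"
    by (simp add: algebra_simps)
  also have "\<dots> = 0"
    using A B1 p_sum by (simp add: sum.distrib flip: sum_product sum_distrib_left)
  finally show "(\<Sum>x<d ^ Suc n. seq_prob (Suc n) x * (seq_surprisal (Suc n) x - Suc n * Qcoh \<rho>)) = 0" .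
  have "(\<Sum>x<d ^ Suc n. seq_prob (Suc n) x * (seq_surprisal (Suc n) x - Suc n * Qcoh \<rho>)\<^sup>2)
      = (\<Sum>a<d ^ n. \<Sum>k<d. (seq_prob n a * p k) * (A a + B k)\<^sup>2)"
    unfolding shift seq_prob.simps by (rule sum_digits)
  also have "\<dots> = (\<Sum>a<d ^ n. \<Sum>k<d. (seq_prob n a * (A a)\<^sup>2) * p k
      + (2 * (seq_prob n a * A a)) * (p k * B k) + seq_prob n a * (p k * (B k)\<^sup>2))"
    by (simp add: algebra_simps power2_eq_square)
  also have "\<dots> = (\<Sum>a<d ^ n. seq_prob n a * (A a)\<^sup>2 + seq_prob n a * surprisal_variance)"
    using B1 B2 p_sum by (simp add: sum.distrib flip: sum_distrib_left)
  also have "\<dots> = Suc n * surprisal_variance"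
    using A(2) seq_prob_sum[of n] by (simp add: sum.distrib algebra_simps flip: sum_distrib_right)
  finally show "(\<Sum>x<d ^ Suc n. seq_prob (Suc n) x * (seq_surprisal (Suc n) x - Suc n * Qcoh \<rho>)\<^sup>2)
      = Suc n * surprisal_variance" .
qed simp_all

text \<open>Words of probability zero are excluded because the default value of
  \<open>surprisal\<close> says nothing about them; they add nothing to
  \<open>atypical_prob\<close>.\<close>

definition typical :: "nat \<Rightarrow> real \<Rightarrow> nat \<Rightarrow> bool" where
  "typical n \<epsilon> x \<longleftrightarrow> 0 < seq_prob n x \<and> \<bar>seq_surprisal n x - n * Qcoh \<rho>\<bar> \<le> n * \<epsilon>"

definition atypical_prob :: "nat \<Rightarrow> real \<Rightarrow> real" where
  "atypical_prob n \<epsilon> = (\<Sum>x<d ^ n. if typical n \<epsilon> x then 0 else seq_prob n x)"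

lemma atypical_prob_nonneg: "0 \<le> atypical_prob n \<epsilon>"
  unfolding atypical_prob_def by (auto intro!: sum_nonneg simp: seq_prob_nonneg)

text \<open>Chebyshev's inequality, with the second moment from
  \<open>seq_surprisal_moments\<close>.\<close>

lemma atypical_prob_le:
  assumes "0 < \<epsilon>" "0 < n"
  shows "atypical_prob n \<epsilon> \<le> surprisal_variance / \<epsilon>\<^sup>2 / n"
proof -
  let ?A = "\<lambda>x. seq_surprisal n x - n * Qcoh \<rho>"
  have ne: "0 < n * \<epsilon>" using assms by simp
  have "(n * \<epsilon>)\<^sup>2 * atypical_prob n \<epsilon> \<le> (\<Sum>x<d ^ n. seq_prob n x * (?A x)\<^sup>2)"
    unfolding atypical_prob_def sum_distrib_left
  proof (rule sum_mono)
    fix x assume "x \<in> {..<d ^ n}"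
    then have nn: "0 \<le> seq_prob n x" by (simp add: seq_prob_nonneg)
    show "(n * \<epsilon>)\<^sup>2 * (if typical n \<epsilon> x then 0 else seq_prob n x) \<le> seq_prob n x * (?A x)\<^sup>2"
    proof (cases "typical n \<epsilon> x \<or> seq_prob n x = 0")
      case False
      then have "n * \<epsilon> \<le> \<bar>?A x\<bar>" using nn by (auto simp: typical_def less_le)
      then have "(n * \<epsilon>)\<^sup>2 \<le> (?A x)\<^sup>2" using ne by (metis abs_le_square_iff abs_of_pos)
      then show ?thesis using False nn by (simp add: mult.commute mult_left_mono)
    qed (use nn in auto)
  qed
  also have "\<dots> = n * surprisal_variance" by (rule seq_surprisal_moments(2))
  finally show ?thesis using assms by (simp add: field_simps power2_eq_square)
qed

lemma atypical_prob_tendsto_0: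
  assumes "0 < \<epsilon>"
  shows "(\<lambda>n. atypical_prob n \<epsilon>) \<longlonglongrightarrow> 0"
proof (rule tendsto_sandwich[where f = "\<lambda>_. 0" and h = "\<lambda>n. surprisal_variance / \<epsilon>\<^sup>2 / real n"])
  show "\<forall>\<^sub>F n in sequentially. atypical_prob n \<epsilon> \<le> surprisal_variance / \<epsilon>\<^sup>2 / n"
    using eventually_gt_at_top[of 0] by eventually_elim (rule atypical_prob_le[OF assms])
  show "(\<lambda>n. surprisal_variance / \<epsilon>\<^sup>2 / real n) \<longlonglongrightarrow> 0" by (rule lim_const_over_n)
qed (auto simp: atypical_prob_nonneg)

lemma typical_bounds:
  assumes "x < d ^ n" "typical n \<epsilon> x"
  shows "seq_prob n x \<le> seq_weight n x * 2 powr (- (n * (Qcoh \<rho> - \<epsilon>)))"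
    and "seq_weight n x * 2 powr (- (n * (Qcoh \<rho> + \<epsilon>))) \<le> seq_prob n x"
proof -
  have eq: "seq_prob n x = seq_weight n x * 2 powr (- seq_surprisal n x)"
    using assms by (intro seq_prob_eq_surprisal) (auto simp: typical_def)
  have s: "n * (Qcoh \<rho> - \<epsilon>) \<le> seq_surprisal n x" "seq_surprisal n x \<le> n * (Qcoh \<rho> + \<epsilon>)"
    using assms(2) by (auto simp: typical_def algebra_simps)
  show "seq_prob n x \<le> seq_weight n x * 2 powr (- (n * (Qcoh \<rho> - \<epsilon>)))"
    unfolding eq using s seq_weight_nonneg[OF assms(1)] by (intro mult_left_mono) auto
  show "seq_weight n x * 2 powr (- (n * (Qcoh \<rho> + \<epsilon>))) \<le> seq_prob n x"
    unfolding eq using s seq_weight_nonneg[OF assms(1)] by (intro mult_left_mono) auto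
qed

lemma seq_weight_class_sum:
  "(\<Sum>L\<in>seq_class n ` {..<d ^ n}. \<Sum>y<d ^ n. if seq_class n y = L then seq_prob n y else 0) = 1"
proof -
  have "(\<Sum>L\<in>seq_class n ` {..<d ^ n}. \<Sum>y\<in>{y \<in> {..<d ^ n}. seq_class n y = L}. seq_prob n y) = 1"
    using sum.image_gen[of "{..<d ^ n}" "seq_prob n" "seq_class n"] seq_prob_sum by simp
  then show ?thesis by (simp only: sum.inter_filter[OF finite_lessThan])
qed

text \<open>Every typical member of the class has at least the fraction
  \<open>2 powr (- (n * (Qcoh \<rho> + \<epsilon>)))\<close> of the total weight of that class. This
  weight is positive as soon as there is one typical member, and then it cancels.\<close>

lemma card_typical_class_le:
  "card {x \<in> {..<d ^ n}. typical n \<epsilon> x \<and> seq_class n x = L} \<le> 2 powr (n * (Qcoh \<rho> + \<epsilon>))"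
    (is "real (card ?T) \<le> ?b")
proof (cases "?T = {}")
  case False
  then obtain x where x: "x < d ^ n" "typical n \<epsilon> x" "seq_class n x = L" by auto
  let ?w = "seq_weight n x"
  have "0 < seq_prob n x" using x by (simp add: typical_def)
  also have "seq_prob n x \<le> ?w * 2 powr (- (n * (Qcoh \<rho> - \<epsilon>)))" using typical_bounds(1) x by simp
  finally have w: "0 < ?w" by (simp add: zero_less_mult_iff)
  have weq: "seq_weight n y = ?w" if "y \<in> ?T" for y
    using that x seq_weight_eq[of y n] seq_weight_eq[of x n] by simp
  have "card ?T * (?w * 2 powr (- (n * (Qcoh \<rho> + \<epsilon>)))) = (\<Sum>y\<in>?T. ?w * 2 powr (- (n * (Qcoh \<rho> + \<epsilon>))))"
    by simp
  also have "\<dots> \<le> (\<Sum>y\<in>?T. seq_prob n y)"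
    using typical_bounds(2) weq by (intro sum_mono) fastforce
  also have "\<dots> = (\<Sum>y<d ^ n. if typical n \<epsilon> y \<and> seq_class n y = L then seq_prob n y else 0)"
    by (rule sum.inter_filter) simp
  also have "\<dots> \<le> (\<Sum>y<d ^ n. if seq_class n y = seq_class n x then seq_prob n y else 0)"
    using x seq_prob_nonneg by (intro sum_mono) auto
  also have "\<dots> = ?w" by (rule seq_weight_eq[OF x(1)])
  finally have "card ?T * 2 powr (- (n * (Qcoh \<rho> + \<epsilon>))) \<le> 1" using w by simp
  then have "card ?T * 2 powr (- (n * (Qcoh \<rho> + \<epsilon>))) * 2 powr (n * (Qcoh \<rho> + \<epsilon>)) \<le> 1 * ?b"
    by (intro mult_right_mono) auto
  then show ?thesis by (simp add: mult.assoc flip: powr_add)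
next
  case True
  then show ?thesis unfolding True by simp
qed

text \<open>The probability of a word depends only on how often each letter occurs; \<open>t\<close>
  records these counts, each between 0 and \<open>n\<close>.\<close>

lemma card_seq_prob_values: "card (seq_prob n ` {..<d ^ n}) \<le> (n + 1) ^ d"
proof -
  let ?F = "{..<d} \<rightarrow>\<^sub>E {..n}"
  have "\<exists>t\<in>{..<d} \<rightarrow>\<^sub>E {..n}. seq_prob n x = (\<Prod>k<d. p k ^ t k)" if "x < d ^ n" for x
    using that
  proof (induction n arbitrary: x)
    case 0
    show ?case by (rule bexI[of _ "\<lambda>k. if k < d then 0 else undefined"]) auto
  next
    case (Suc n)
    note b = digit_bounds[OF Suc.prems]
    let ?k = "x mod d"
    obtain t where t: "t \<in> {..<d} \<rightarrow>\<^sub>E {..n}" "seq_prob n (x div d) = (\<Prod>k<d. p k ^ t k)"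
      using Suc.IH[OF b(1)] by blast
    have "t ?k \<le> n" using t b by auto
    then have "t(?k := Suc (t ?k)) \<in> {..<d} \<rightarrow>\<^sub>E {..Suc n}"
      using t(1) b by (auto simp: PiE_iff extensional_def intro: le_SucI)
    moreover have "(\<Prod>k<d. p k ^ (t(?k := Suc (t ?k))) k) = (\<Prod>k<d. p k ^ t k * (if k = ?k then p ?k else 1))"
      by (intro prod.cong) auto
    then have "(\<Prod>k<d. p k ^ (t(?k := Suc (t ?k))) k) = seq_prob (Suc n) x"
      using b t(2) by (simp add: prod.distrib)
    ultimately show ?case by metis
  qed
  then have "seq_prob n ` {..<d ^ n} \<subseteq> (\<lambda>t. \<Prod>k<d. p k ^ t k) ` ?F" by auto
  then have "card (seq_prob n ` {..<d ^ n}) \<le> card ?F"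
    by (intro surj_card_le finite_PiE) auto
  then show ?thesis by (simp add: card_PiE)
qed

end

section \<open>Cutting cells into blocks\<close>

text \<open>Ranks number each cell consecutively from 0, so that quotient and remainder modulo the
  block length give the block and the position inside it.\<close>

definition cell_rank :: "(nat \<Rightarrow> 'c) \<Rightarrow> nat \<Rightarrow> nat" where
  "cell_rank c x = card {y. y < x \<and> c y = c x}"

lemma cell_rank_strict_mono:
  assumes "x < y" "c x = c y"
  shows "cell_rank c x < cell_rank c y"
proof -
  have "{z. z < x \<and> c z = c x} \<subseteq> {z. z < y \<and> c z = c y}" using assms by auto
  moreover have "x \<in> {z. z < y \<and> c z = c y}" "x \<notin> {z. z < x \<and> c z = c x}" using assms by simp_all
  ultimately have "{z. z < x \<and> c z = c x} \<subset> {z. z < y \<and> c z = c y}" by blast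
  then show ?thesis unfolding cell_rank_def by (intro psubset_card_mono) simp_all
qed

lemma cell_rank_bij:
  "bij_betw (cell_rank c) {y. y < a \<and> c y = C} {..<card {y. y < a \<and> c y = C}}"
proof -
  let ?S = "{y. y < a \<and> c y = C}"
  have fin: "finite ?S" by simp
  have inj: "inj_on (cell_rank c) ?S"
  proof (rule inj_onI)
    fix x y assume "x \<in> ?S" "y \<in> ?S" and eq: "cell_rank c x = cell_rank c y"
    then have c: "c x = c y" by simp
    show "x = y"
      using cell_rank_strict_mono[of x y c] cell_rank_strict_mono[of y x c] eq c
      by (cases x y rule: linorder_cases) auto
  qed
  have "cell_rank c x < card ?S" if "x \<in> ?S" for x
    unfolding cell_rank_def by (rule psubset_card_mono[OF fin]) (use that in auto)
  then have "cell_rank c ` ?S \<subseteq> {..<card ?S}" by auto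
  moreover have "card (cell_rank c ` ?S) = card {..<card ?S}" by (simp add: card_image inj)
  ultimately have "cell_rank c ` ?S = {..<card ?S}" by (intro card_subset_eq) auto
  then show ?thesis using inj by (simp add: bij_betw_def)
qed

text \<open>Every cell \<open>c -` {C}\<close> is cut into blocks of exactly \<open>M\<close> elements, except for fewer than
  \<open>M\<close> leftover elements outside \<open>G\<close>, which form singleton blocks.\<close>

lemma block_partition_exists:
  fixes c :: "nat \<Rightarrow> 'c" and a M :: nat
  assumes M: "0 < M"
  obtains \<beta> :: "nat \<Rightarrow> nat" and B :: nat and pos :: "nat \<Rightarrow> nat" and G :: "nat set"
  where "\<And>x. x < a \<Longrightarrow> \<beta> x < B" "\<And>x. x < a \<Longrightarrow> pos x < M"
    and "\<And>x. x < a \<Longrightarrow> x \<notin> G \<Longrightarrow> pos x = 0"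
    and "\<And>x y. x < a \<Longrightarrow> y < a \<Longrightarrow> x \<notin> G \<Longrightarrow> \<beta> y = \<beta> x \<Longrightarrow> y = x"
    and "\<And>x i. x < a \<Longrightarrow> x \<in> G \<Longrightarrow> i < M \<Longrightarrow> \<exists>!y. y < a \<and> \<beta> y = \<beta> x \<and> pos y = i"
    and "\<And>x y. x < a \<Longrightarrow> y < a \<Longrightarrow> \<beta> x = \<beta> y \<Longrightarrow> c x = c y"
    and "\<And>C. card {x. x < a \<and> x \<notin> G \<and> c x = C} \<le> M"
proof -
  define S where "S C = card {y. y < a \<and> c y = C}" for C
  define r where "r = cell_rank c"
  \<comment> \<open>A block is complete when the end of its window of ranks does not exceed the size
    of the cell.\<close>
  define G where "G = {x. (r x div M + 1) * M \<le> S (c x)}"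
  \<comment> \<open>The two tags keep the full blocks apart from the singletons; the finitely many
    labels are renumbered by natural numbers below.\<close>
  define \<beta>' where "\<beta>' x = (if x \<in> G then Inl (c x, r x div M) else Inr x)" for x
  define pos where "pos x = (if x \<in> G then r x mod M else 0)" for x
  have bij: "bij_betw r {y. y < a \<and> c y = C} {..<S C}" for C
    unfolding r_def S_def by (rule cell_rank_bij)
  have r_inj: "x = y" if "x < a" "y < a" "c x = c y" "r x = r y" for x y
    using bij_betw_imp_inj_on[OF bij[of "c y"]] that by (auto simp: inj_on_def)
  have r_lt: "r x < S (c x)" if "x < a" for x
    using bij_betw_apply[OF bij[of "c x"]] that by auto
  have "finite (\<beta>' ` {..<a})" by simp
  then obtain f :: "_ \<Rightarrow> nat" and B where f: "f ` (\<beta>' ` {..<a}) = {i. i < B}" "inj_on f (\<beta>' ` {..<a})"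
    by (rule finite_imp_inj_to_nat_seg[THEN exE]) auto
  define \<beta> where "\<beta> x = f (\<beta>' x)" for x
  have \<beta>_eq: "\<beta> x = \<beta> y \<longleftrightarrow> \<beta>' x = \<beta>' y" if "x < a" "y < a" for x y
    using f(2) that by (auto simp: \<beta>_def inj_on_def)
  show thesis
  proof (rule that[of \<beta> B pos G])
    show "\<beta> x < B" if "x < a" for x using f(1) that by (auto simp: \<beta>_def)
    show "pos x < M" for x using M by (simp add: pos_def)
    show "pos x = 0" if "x \<notin> G" for x using that by (simp add: pos_def)
    show "y = x" if "x < a" "y < a" "x \<notin> G" "\<beta> y = \<beta> x" for x y
      using that \<beta>_eq by (auto simp: \<beta>'_def split: if_splits)
    show "c x = c y" if "x < a" "y < a" "\<beta> x = \<beta> y" for x y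
      using that \<beta>_eq by (auto simp: \<beta>'_def split: if_splits)
    show "\<exists>!y. y < a \<and> \<beta> y = \<beta> x \<and> pos y = i" if x: "x < a" "x \<in> G" and i: "i < M" for x i
    proof -
      let ?k = "r x div M * M + i"
      have "?k < (r x div M + 1) * M" using i by simp
      also have "\<dots> \<le> S (c x)" using x by (simp add: G_def)
      finally have "?k \<in> {..<S (c x)}" by simp
      then have "?k \<in> r ` {y. y < a \<and> c y = c x}"
        unfolding bij_betw_imp_surj_on[OF bij[of "c x"]] .
      then obtain y where "?k = r y" "y \<in> {y. y < a \<and> c y = c x}" by (rule imageE)
      then have y: "y < a" "c y = c x" "r y = ?k" by simp_all
      have div: "r y div M = r x div M" "r y mod M = i" using y i by simp_all
      then have "y \<in> G" using x y by (simp add: G_def)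
      then have "y < a \<and> \<beta> y = \<beta> x \<and> pos y = i"
        using y div x \<beta>_eq by (simp add: \<beta>'_def pos_def)
      moreover have "z = y" if z: "z < a" "\<beta> z = \<beta> x" "pos z = i" for z
      proof -
        have b: "\<beta>' z = \<beta>' x" using z x \<beta>_eq by simp
        then have zG: "z \<in> G" "c z = c x" "r z div M = r x div M"
          using x by (auto simp: \<beta>'_def split: if_splits)
        then have "r z = ?k" using z(3) by (metis pos_def div_mult_mod_eq)
        then show ?thesis using r_inj[of z y] y z zG by simp
      qed
      ultimately show ?thesis by blast
    qed
    show "card {x. x < a \<and> x \<notin> G \<and> c x = C} \<le> M" for C
    proof -
      let ?T = "{x. x < a \<and> x \<notin> G \<and> c x = C}"
      \<comment> \<open>Only the last, incomplete window of ranks is left over, and ranks are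
        injective on the cell.\<close>
      have "r x \<in> {S C div M * M..<S C div M * M + M}" if "x \<in> ?T" for x
      proof -
        have "S C < (r x div M + 1) * M" using that by (auto simp: G_def)
        then have "S C div M < r x div M + 1" by (simp add: less_mult_imp_div_less)
        then have "S C div M * M \<le> r x div M * M" by (intro mult_le_mono1) simp
        also have "\<dots> \<le> r x" by simp
        finally have "S C div M * M \<le> r x" .
        moreover have "r x < S C" using r_lt that by auto
        moreover have "S C < S C div M * M + M"
          using M by (metis add_strict_left_mono div_mult_mod_eq mod_less_divisor)
        ultimately show ?thesis by simp
      qed
      then have "r ` ?T \<subseteq> {S C div M * M..<S C div M * M + M}" by blast
      moreover have "inj_on r ?T" using r_inj by (auto simp: inj_on_def)
      ultimately have "card ?T \<le> card {S C div M * M..<S C div M * M + M}"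
        by (intro card_inj_on_le) auto
      then show ?thesis by simp
    qed
  qed
qed

context labelled_state
begin

text \<open>A class word has at most \<open>(n + 1) ^ d\<close> cells with at most \<open>M\<close>
  leftovers each, and a typical leftover has at most the fraction
  \<open>2 powr (- (n * (Qcoh \<rho> - \<epsilon>)))\<close> of the weight of its class word. These
  weights sum to 1, so the exponential number of class words does not enter.\<close>

lemma leftover_prob_le:
  assumes G: "\<And>C. card {x. x < d ^ n \<and> x \<notin> G \<and> (seq_class n x, seq_prob n x) = C} \<le> M"
  shows "(\<Sum>x<d ^ n. if x \<in> G then 0 else seq_prob n x)
    \<le> atypical_prob n \<epsilon> + (real n + 1) ^ d * real M * 2 powr (- (n * (Qcoh \<rho> - \<epsilon>)))"
proof -
  let ?c = "\<lambda>x. (seq_class n x, seq_prob n x)"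
  let ?e = "2 powr (- (n * (Qcoh \<rho> - \<epsilon>)))"
  let ?LS = "seq_class n ` {..<d ^ n}" and ?QS = "seq_prob n ` {..<d ^ n}"
  let ?w = "\<lambda>L. \<Sum>y<d ^ n. if seq_class n y = L then seq_prob n y else 0"
  let ?T = "{x \<in> {..<d ^ n}. x \<notin> G \<and> typical n \<epsilon> x}"
  have wnn: "0 \<le> ?w L" for L by (auto intro!: sum_nonneg simp: seq_prob_nonneg)
  have cell: "(\<Sum>x\<in>{x \<in> ?T. ?c x = C}. seq_prob n x) \<le> M * (?w (fst C) * ?e)" for C
  proof -
    have "(\<Sum>x\<in>{x \<in> ?T. ?c x = C}. seq_prob n x) \<le> (\<Sum>x\<in>{x \<in> ?T. ?c x = C}. ?w (fst C) * ?e)"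
    proof (rule sum_mono)
      fix x assume x: "x \<in> {x \<in> ?T. ?c x = C}"
      then have "?w (fst C) = seq_weight n x" using seq_weight_eq[of x n] by auto
      then show "seq_prob n x \<le> ?w (fst C) * ?e" using typical_bounds(1)[of x n \<epsilon>] x by simp
    qed
    also have "\<dots> = card {x \<in> ?T. ?c x = C} * (?w (fst C) * ?e)" by simp
    also have "\<dots> \<le> M * (?w (fst C) * ?e)"
    proof (rule mult_right_mono)
      have "card {x \<in> ?T. ?c x = C} \<le> card {x. x < d ^ n \<and> x \<notin> G \<and> ?c x = C}"
        by (rule card_mono) auto
      then show "real (card {x \<in> ?T. ?c x = C}) \<le> real M" using G[of C] by linarith
    qed (simp add: wnn)
    finally show ?thesis .
  qed
  have "(\<Sum>x\<in>?T. seq_prob n x) = (\<Sum>C\<in>?LS \<times> ?QS. \<Sum>x\<in>{x \<in> ?T. ?c x = C}. seq_prob n x)"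
    by (rule sum.group[symmetric]) auto
  also have "\<dots> \<le> (\<Sum>C\<in>?LS \<times> ?QS. M * (?w (fst C) * ?e))"
    by (rule sum_mono) (rule cell)
  also have "\<dots> = (\<Sum>L\<in>?LS. \<Sum>q\<in>?QS. M * (?w L * ?e))"
    by (subst sum.cartesian_product) (simp add: case_prod_beta)
  also have "\<dots> = real (card ?QS) * real M * ?e * (\<Sum>L\<in>?LS. ?w L)"
    by (simp add: sum_distrib_left mult_ac)
  also have "\<dots> = real (card ?QS) * real M * ?e" by (simp add: seq_weight_class_sum)
  also have "\<dots> \<le> (real n + 1) ^ d * real M * ?e"
  proof (intro mult_right_mono)
    show "real (card ?QS) \<le> (real n + 1) ^ d"
      using of_nat_mono[OF card_seq_prob_values[of n], where 'a = real] by (simp add: add.commute)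
  qed auto
  finally have T: "(\<Sum>x\<in>?T. seq_prob n x) \<le> (real n + 1) ^ d * real M * ?e" .
  have "(\<Sum>x<d ^ n. if x \<in> G then 0 else seq_prob n x)
      \<le> (\<Sum>x<d ^ n. (if typical n \<epsilon> x then 0 else seq_prob n x) +
           (if x \<notin> G \<and> typical n \<epsilon> x then seq_prob n x else 0))"
    by (intro sum_mono) (auto simp: seq_prob_nonneg)
  also have "\<dots> = atypical_prob n \<epsilon> + (\<Sum>x\<in>?T. seq_prob n x)"
    by (simp only: sum.distrib atypical_prob_def sum.inter_filter[OF finite_lessThan])
  finally show ?thesis using T by simp
qed

text \<open>On a block the state is rank one with constant diagonal, so undoing the phases and
  reading off the position inside the block produces a maximally coherent state.\<close>

lemma block_output:
  fixes \<beta> pos :: "nat \<Rightarrow> nat"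
  assumes M: "0 < M"
    and pos: "\<And>x. x < d ^ n \<Longrightarrow> pos x < M" "\<And>x. x < d ^ n \<Longrightarrow> x \<notin> G \<Longrightarrow> pos x = 0"
    and single: "\<And>x y. x < d ^ n \<Longrightarrow> y < d ^ n \<Longrightarrow> x \<notin> G \<Longrightarrow> \<beta> y = \<beta> x \<Longrightarrow> y = x"
    and full: "\<And>x i. x < d ^ n \<Longrightarrow> x \<in> G \<Longrightarrow> i < M \<Longrightarrow> \<exists>!y. y < d ^ n \<and> \<beta> y = \<beta> x \<and> pos y = i"
    and cell: "\<And>x y. x < d ^ n \<Longrightarrow> y < d ^ n \<Longrightarrow> \<beta> x = \<beta> y \<Longrightarrow>
      seq_class n x = seq_class n y \<and> seq_prob n x = seq_prob n y"
    and ij: "i < M" "j < M"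
  defines "g \<equiv> \<Sum>x<d ^ n. if x \<in> G then 0 else seq_prob n x"
  shows "(\<Sum>x<d ^ n. \<Sum>y<d ^ n. if \<beta> x = \<beta> y \<and> pos x = i \<and> pos y = j
      then cnj (seq_phase n x) * seq_phase n y * tpow \<rho> n $$ (x,y) else 0)
    = of_real ((1 - g) / M + (if i = 0 \<and> j = 0 then g else 0))"
proof -
  \<comment> \<open>Probability carried by position \<open>i\<close> of the full blocks; it turns
    out not to depend on \<open>i\<close>.\<close>
  define h where "h i = (\<Sum>x<d ^ n. if x \<in> G \<and> pos x = i then seq_prob n x else 0)" for i
  \<comment> \<open>In a full block \<open>x\<close> has exactly one partner at position
    \<open>j\<close>. A leftover is its own only partner and sits at position 0, so leftovers show
    only in the corner entry.\<close>
  have block_sum: "(\<Sum>y<d ^ n. if \<beta> x = \<beta> y \<and> pos x = i \<and> pos y = j then seq_prob n x else 0)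
     = (if x \<in> G \<and> pos x = i then seq_prob n x else 0) +
       (if i = 0 \<and> j = 0 then if x \<in> G then 0 else seq_prob n x else 0)"
    if x: "x < d ^ n" and ij: "i < M" "j < M" for x i j
  proof (cases "x \<in> G")
    case True
    obtain z where z: "z < d ^ n \<and> \<beta> z = \<beta> x \<and> pos z = j"
      and uz: "\<And>y. y < d ^ n \<and> \<beta> y = \<beta> x \<and> pos y = j \<Longrightarrow> y = z"
      using full[OF x True ij(2)] by blast
    have "\<beta> x = \<beta> y \<and> pos x = i \<and> pos y = j \<longleftrightarrow> y = z \<and> pos x = i" if "y < d ^ n" for y
      using z uz[of y] that by metis
    then have "(\<Sum>y<d ^ n. if \<beta> x = \<beta> y \<and> pos x = i \<and> pos y = j then seq_prob n x else 0)
       = (\<Sum>y<d ^ n. if y = z then if pos x = i then seq_prob n x else 0 else 0)"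
      by (intro sum.cong) simp_all
    then show ?thesis using True z by simp
  next
    case False
    have "\<beta> x = \<beta> y \<longleftrightarrow> y = x" if "y < d ^ n" for y
      using single[OF x that False] by metis
    then have "(\<Sum>y<d ^ n. if \<beta> x = \<beta> y \<and> pos x = i \<and> pos y = j then seq_prob n x else 0)
       = (\<Sum>y<d ^ n. if y = x then if pos x = i \<and> pos x = j then seq_prob n x else 0 else 0)"
      by (intro sum.cong) simp_all
    then show ?thesis using False x pos(2)[OF x False] by auto
  qed
  \<comment> \<open>Pairs at positions \<open>i\<close> and \<open>j\<close> of a common full block
    have equal probabilities; counting them by either member gives both weights.\<close>
  have h_eq: "h i = h j" if ij: "i < M" "j < M" for i j
  proof -
    have half: "(\<Sum>x<d ^ n. \<Sum>y<d ^ n. if x \<in> G \<and> \<beta> x = \<beta> y \<and> pos x = i \<and> pos y = j then seq_prob n x else 0) = h i"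
      if "i < M" "j < M" for i j
    proof -
      have "(\<Sum>y<d ^ n. if x \<in> G \<and> \<beta> x = \<beta> y \<and> pos x = i \<and> pos y = j then seq_prob n x else 0)
         = (if x \<in> G \<and> pos x = i then seq_prob n x else 0)" if x: "x < d ^ n" for x
        using block_sum[OF x \<open>i < M\<close> \<open>j < M\<close>] by (cases "x \<in> G") simp_all
      then show ?thesis unfolding h_def by (intro sum.cong) auto
    qed
    have "(if x \<in> G \<and> \<beta> x = \<beta> y \<and> pos x = i \<and> pos y = j then seq_prob n x else 0)
        = (if y \<in> G \<and> \<beta> y = \<beta> x \<and> pos y = j \<and> pos x = i then seq_prob n y else 0)"
      if "x < d ^ n" "y < d ^ n" for x y
    proof (cases "\<beta> x = \<beta> y")
      case True
      have "y \<in> G \<longleftrightarrow> x \<in> G"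
        using single[OF that _ True[symmetric]] single[OF that(2,1) _ True] by metis
      moreover have "seq_prob n x = seq_prob n y" using cell[OF that True] by simp
      ultimately show ?thesis using True by simp
    qed simp
    then have "h i = (\<Sum>x<d ^ n. \<Sum>y<d ^ n. if y \<in> G \<and> \<beta> y = \<beta> x \<and> pos y = j \<and> pos x = i then seq_prob n y else 0)"
      unfolding half[OF ij, symmetric] by (intro sum.cong refl) simp
    also have "\<dots> = h j" by (subst sum.swap) (rule half[OF ij(2,1)])
    finally show ?thesis .
  qed
  have "(\<Sum>i<M. h i) = (\<Sum>x<d ^ n. \<Sum>i<M. if x \<in> G \<and> pos x = i then seq_prob n x else 0)"
    unfolding h_def by (rule sum.swap)
  also have "\<dots> = (\<Sum>x<d ^ n. seq_prob n x - (if x \<in> G then 0 else seq_prob n x))"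
  proof (rule sum.cong)
    fix x assume "x \<in> {..<d ^ n}"
    then have "pos x < M" using pos by simp
    then have "(\<Sum>i<M. if i = pos x then if x \<in> G then seq_prob n x else 0 else 0)
       = (if x \<in> G then seq_prob n x else 0)" by simp
    moreover have "(\<Sum>i<M. if x \<in> G \<and> pos x = i then seq_prob n x else 0)
       = (\<Sum>i<M. if i = pos x then if x \<in> G then seq_prob n x else 0 else 0)"
      by (intro sum.cong) auto
    ultimately show "(\<Sum>i<M. if x \<in> G \<and> pos x = i then seq_prob n x else 0)
       = seq_prob n x - (if x \<in> G then 0 else seq_prob n x)" by simp
  qed simp
  also have "\<dots> = 1 - g" by (simp add: sum_subtractf g_def seq_prob_sum)
  finally have "M * h i = 1 - g"
    using h_eq[OF _ ij(1)] by simp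
  then have h: "h i = (1 - g) / M" using M by (simp add: field_simps)
  have "(\<Sum>x<d ^ n. \<Sum>y<d ^ n. if \<beta> x = \<beta> y \<and> pos x = i \<and> pos y = j
      then cnj (seq_phase n x) * seq_phase n y * tpow \<rho> n $$ (x,y) else 0)
    = of_real (\<Sum>x<d ^ n. \<Sum>y<d ^ n. if \<beta> x = \<beta> y \<and> pos x = i \<and> pos y = j then seq_prob n x else 0)"
    unfolding of_real_sum
  proof (intro sum.cong refl)
    fix x y assume "x \<in> {..<d ^ n}" "y \<in> {..<d ^ n}"
    then have xy: "x < d ^ n" "y < d ^ n" by auto
    have "cnj (seq_phase n x) * seq_phase n y * tpow \<rho> n $$ (x,y) = of_real (seq_prob n x)"
      if "\<beta> x = \<beta> y"
    proof -
      have one: "cnj (seq_phase n z) * seq_phase n z = 1" if "z < d ^ n" for z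
        using cmod_seq_phase[OF that] by (metis complex_norm_square mult.commute of_real_1 one_power2)
      have "tpow \<rho> n $$ (x,y) = of_real (sqrt (seq_prob n x) * sqrt (seq_prob n x)) *
          (seq_phase n x * cnj (seq_phase n y))"
        using tpow_same_class[OF xy] cell[OF xy that] by simp
      also have "sqrt (seq_prob n x) * sqrt (seq_prob n x) = seq_prob n x"
        using seq_prob_nonneg[OF xy(1)] by simp
      finally have "cnj (seq_phase n x) * seq_phase n y * tpow \<rho> n $$ (x,y) =
          of_real (seq_prob n x) * (cnj (seq_phase n x) * seq_phase n x) * (cnj (seq_phase n y) * seq_phase n y)"
        by (simp only: mult_ac)
      then show ?thesis by (simp only: one xy) simp
    qed
    then show "(if \<beta> x = \<beta> y \<and> pos x = i \<and> pos y = j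
        then cnj (seq_phase n x) * seq_phase n y * tpow \<rho> n $$ (x,y) else 0)
      = of_real (if \<beta> x = \<beta> y \<and> pos x = i \<and> pos y = j then seq_prob n x else 0)" by simp
  qed
  also have "(\<Sum>x<d ^ n. \<Sum>y<d ^ n. if \<beta> x = \<beta> y \<and> pos x = i \<and> pos y = j then seq_prob n x else 0)
     = (\<Sum>x<d ^ n. (if x \<in> G \<and> pos x = i then seq_prob n x else 0) +
       (if i = 0 \<and> j = 0 then if x \<in> G then 0 else seq_prob n x else 0))"
    using block_sum[OF _ ij] by (intro sum.cong) auto
  also have "\<dots> = h i + (if i = 0 \<and> j = 0 then g else 0)"
    by (simp add: sum.distrib h_def g_def)
  finally show ?thesis unfolding h .
qed

end

section \<open>Kraus operators\<close>

lemma index_mult_mat_sum: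
  fixes A B :: "'a::semiring_0 mat"
  assumes "A \<in> carrier_mat n m" "B \<in> carrier_mat m q" "i < n" "j < q"
  shows "(A * B) $$ (i,j) = (\<Sum>k<m. A $$ (i,k) * B $$ (k,j))"
  using assms by (simp add: scalar_prod_def atLeast0LessThan)

lemma adj_mult:
  assumes "A \<in> carrier_mat n m" "B \<in> carrier_mat m q"
  shows "adj (A * B) = adj B * adj A"
proof (rule eq_matI)
  fix i j assume "i < dim_row (adj B * adj A)" "j < dim_col (adj B * adj A)"
  then have ij: "i < q" "j < n" using assms by auto
  have "adj (A * B) $$ (i,j) = cnj (\<Sum>k<m. A $$ (j,k) * B $$ (k,i))"
    using assms ij index_mult_mat_sum[OF assms ij(2,1)] by simp
  also have "\<dots> = (\<Sum>k<m. adj B $$ (i,k) * adj A $$ (k,j))"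
    using assms ij by (auto simp: cnj_sum intro!: sum.cong)
  also have "\<dots> = (adj B * adj A) $$ (i,j)"
    by (rule index_mult_mat_sum[symmetric, OF adj_carrier[OF assms(2)] adj_carrier[OF assms(1)] ij])
  finally show "adj (A * B) $$ (i,j) = (adj B * adj A) $$ (i,j)" .
qed (use assms in auto)

lemma conj_mat_entry:
  assumes W: "W \<in> carrier_mat n a" and X: "X \<in> carrier_mat a a" and ij: "i < n" "j < n"
  shows "(W * X * adj W) $$ (i,j) = (\<Sum>x<a. \<Sum>y<a. W $$ (i,x) * X $$ (x,y) * cnj (W $$ (j,y)))"
proof -
  have WX: "W * X \<in> carrier_mat n a" using W X by simp
  have "(W * X * adj W) $$ (i,j) = (\<Sum>y<a. (W * X) $$ (i,y) * adj W $$ (y,j))"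
    by (rule index_mult_mat_sum[OF WX adj_carrier[OF W] ij])
  also have "\<dots> = (\<Sum>y<a. \<Sum>x<a. W $$ (i,x) * X $$ (x,y) * cnj (W $$ (j,y)))"
    using W ij index_mult_mat_sum[OF W X ij(1)] by (simp add: sum_distrib_right del: index_mult_mat)
  finally show ?thesis by (subst (asm) sum.swap)
qed

lemma conj_conj_mat:
  assumes K: "K \<in> carrier_mat m n" and V: "V \<in> carrier_mat n a" and X: "X \<in> carrier_mat a a"
  shows "K * (V * X * adj V) * adj K = (K * V) * X * adj (K * V)"
proof -
  note K' = adj_carrier[OF K] and V' = adj_carrier[OF V]
  have VX: "V * X \<in> carrier_mat n a" using V X by (rule mult_carrier_mat)
  have "K * V * X * (adj V * adj K) = K * (V * X) * (adj V * adj K)"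
    by (simp only: assoc_mult_mat[OF K V X])
  also have "\<dots> = K * (V * X * (adj V * adj K))"
    by (rule assoc_mult_mat[OF K VX mult_carrier_mat[OF V' K']])
  also have "V * X * (adj V * adj K) = V * X * adj V * adj K"
    by (rule assoc_mult_mat[OF VX V' K', symmetric])
  also have "K * (V * X * adj V * adj K) = K * (V * X * adj V) * adj K"
    by (rule assoc_mult_mat[OF K mult_carrier_mat[OF VX V'] K', symmetric])
  finally show ?thesis by (simp only: adj_mult[OF K V])
qed

lemma incoh_proj_carrier [simp]: "incoh_proj D I \<in> carrier_mat D D"
  by (simp add: incoh_proj_def)

lemma adj_incoh_proj [simp]: "adj (incoh_proj D I) = incoh_proj D I"
  by (rule eq_matI) (auto simp: incoh_proj_def)

lemma incoh_unitary_carrier: "incoh_unitary D U \<Longrightarrow> U \<in> carrier_mat D D"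
  by (auto simp: incoh_unitary_def perm_mat_def diag_phase_def)

lemma perm_diag_proj_entry:
  assumes "\<sigma> permutes {..<D}" "r < D" "s < D"
  shows "(perm_mat D \<sigma> * diag_phase D ph * incoh_proj D I) $$ (r,s)
    = (if r = \<sigma> s \<and> s \<in> I then ph s else 0)"
proof -
  have c: "perm_mat D \<sigma> \<in> carrier_mat D D" "diag_phase D ph \<in> carrier_mat D D"
    "perm_mat D \<sigma> * diag_phase D ph \<in> carrier_mat D D"
    by (auto simp: perm_mat_def diag_phase_def)
  have U: "(perm_mat D \<sigma> * diag_phase D ph) $$ (r,k) = (if r = \<sigma> k then ph k else 0)" if "k < D" for k
  proof -
    have "(perm_mat D \<sigma> * diag_phase D ph) $$ (r,k) = (\<Sum>m<D. if m = k then if r = \<sigma> k then ph k else 0 else 0)"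
      unfolding index_mult_mat_sum[OF c(1,2) assms(2) that]
      using assms that by (intro sum.cong) (auto simp: perm_mat_def diag_phase_def)
    then show ?thesis using that by simp
  qed
  have "(perm_mat D \<sigma> * diag_phase D ph * incoh_proj D I) $$ (r,s)
      = (\<Sum>k<D. if k = s then if r = \<sigma> s \<and> s \<in> I then ph s else 0 else 0)"
    unfolding index_mult_mat_sum[OF c(3) incoh_proj_carrier assms(2,3)]
    using assms U by (intro sum.cong) (auto simp: incoh_proj_def)
  then show ?thesis using assms by simp
qed

text \<open>An incoherent unitary permutes the whole basis, while the protocol prescribes images
  only on a block. The complements of the block and of its image have equal cardinality.\<close>

lemma inj_extends_to_permutation:
  assumes "finite S" "I \<subseteq> S" "inj_on f I" "f ` I \<subseteq> S"
  obtains \<sigma> where "\<sigma> permutes S" "\<And>x. x \<in> I \<Longrightarrow> \<sigma> x = f x"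
proof -
  have finI: "finite I" using assms finite_subset by auto
  have "card (S - I) = card (S - f ` I)"
    using assms finI by (simp add: card_Diff_subset card_image)
  then obtain g where g: "bij_betw g (S - I) (S - f ` I)"
    using finite_same_card_bij[of "S - I" "S - f ` I"] assms by auto
  define \<sigma> where "\<sigma> x = (if x \<in> I then f x else if x \<in> S then g x else x)" for x
  have "bij_betw \<sigma> I (f ` I)"
    using assms by (auto simp: bij_betw_def \<sigma>_def inj_on_def)
  moreover have "bij_betw \<sigma> (S - I) (S - f ` I)"
    using g by (rule bij_betw_cong[THEN iffD1, rotated]) (simp add: \<sigma>_def)
  ultimately have "bij_betw \<sigma> (I \<union> (S - I)) (f ` I \<union> (S - f ` I))"
    by (rule bij_betw_combine) auto
  moreover have "I \<union> (S - I) = S" "f ` I \<union> (S - f ` I) = S" using assms by auto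
  ultimately have "bij_betw \<sigma> S S" by simp
  then have "\<sigma> permutes S"
    by (rule bij_imp_permutes) (use assms in \<open>auto simp: \<sigma>_def\<close>)
  then show thesis by (rule that) (simp add: \<sigma>_def)
qed

lemma msum_entry: "i < n \<Longrightarrow> j < m \<Longrightarrow> msum n m f I $$ (i,j) = (\<Sum>x\<in>I. f x $$ (i,j))"
  by (simp add: msum_def)

lemma msum_dim [simp]: "dim_row (msum n m f I) = n" "dim_col (msum n m f I) = m"
  by (simp_all add: msum_def)

text \<open>Brings the five-factor product in \<open>PIO_sq\<close> into Kraus form.\<close>

lemma proj_conj_eq:
  assumes "U \<in> carrier_mat D D" "Y \<in> carrier_mat D D"
  shows "U * incoh_proj D I * Y * incoh_proj D I * adj U
    = (U * incoh_proj D I) * Y * adj (U * incoh_proj D I)"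
proof -
  have c: "U * incoh_proj D I * Y \<in> carrier_mat D D"
    by (rule mult_carrier_mat[OF mult_carrier_mat[OF assms(1) incoh_proj_carrier] assms(2)])
  show ?thesis
    unfolding adj_mult[OF assms(1) incoh_proj_carrier] adj_incoh_proj
    by (rule assoc_mult_mat[OF c incoh_proj_carrier adj_carrier[OF assms(1)]])
qed

text \<open>A block is measured, and its element at position \<open>i\<close> is sent to the basis vector
  \<open>|i>|0>\<close> of \<open>C^b (x) C^a\<close>, whose index is \<open>i * a\<close>.\<close>

lemma block_channel_exists:
  fixes \<beta> pos :: "nat \<Rightarrow> nat" and ph :: "nat \<Rightarrow> complex"
  assumes a: "0 < a" and b: "0 < b"
    and \<beta>: "\<And>x. x < a \<Longrightarrow> \<beta> x < B" and pos: "\<And>x. x < a \<Longrightarrow> pos x < b"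
    and inj: "\<And>x y. x < a \<Longrightarrow> y < a \<Longrightarrow> \<beta> x = \<beta> y \<Longrightarrow> pos x = pos y \<Longrightarrow> x = y"
    and ph: "\<And>x. x < a \<Longrightarrow> cmod (ph x) = 1"
  obtains \<Lambda> where "lifted PIO_sq a b \<Lambda>"
    "\<And>X. X \<in> carrier_mat a a \<Longrightarrow> \<Lambda> X = mat b b (\<lambda>(i,j). \<Sum>x<a. \<Sum>y<a.
       if \<beta> x = \<beta> y \<and> pos x = i \<and> pos y = j then ph x * cnj (ph y) * X $$ (x,y) else 0)"
proof -
  define D where "D = b * a"
  have aD: "a \<le> D" using b by (simp add: D_def)
  \<comment> \<open>The extra outcome \<open>B\<close> collects the padding vectors of the enlarged
    space, so that the projectors sum to the identity.\<close>
  define I where "I k = (if k < B then {x. x < a \<and> \<beta> x = k} else {a..<D})" for k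
  have posD: "pos x * a < D" if "x < a" for x
    using pos[OF that] a by (simp add: D_def)
  have "\<exists>\<sigma>. \<sigma> permutes {..<D} \<and> (k < B \<longrightarrow> (\<forall>x\<in>I k. \<sigma> x = pos x * a))" for k
  proof (cases "k < B")
    case True
    have 1: "inj_on (\<lambda>x. pos x * a) (I k)" using a inj True by (auto simp: inj_on_def I_def)
    have 2: "(\<lambda>x. pos x * a) ` I k \<subseteq> {..<D}" using posD True by (auto simp: I_def)
    have 3: "I k \<subseteq> {..<D}" using aD True by (auto simp: I_def)
    obtain \<sigma> where "\<sigma> permutes {..<D}" "\<And>x. x \<in> I k \<Longrightarrow> \<sigma> x = pos x * a"
      by (rule inj_extends_to_permutation[OF finite_lessThan 3 1 2]) blast
    then show ?thesis by blast
  next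
    case False
    then show ?thesis using permutes_id by blast
  qed
  then obtain \<sigma> where \<sigma>: "\<And>k. \<sigma> k permutes {..<D}"
    and \<sigma>_pos: "\<And>k x. k < B \<Longrightarrow> x \<in> I k \<Longrightarrow> \<sigma> k x = pos x * a"
    by metis
  \<comment> \<open>The phases must have modulus 1 on the padding vectors as well.\<close>
  define q where "q x = (if x < a then ph x else 1)" for x
  define U where "U k = perm_mat D (\<sigma> k) * diag_phase D q" for k
  have Uinc: "incoh_unitary D (U k)" for k
    unfolding incoh_unitary_def U_def using \<sigma>[of k] ph
    by (intro exI[of _ "\<sigma> k"] exI[of _ q]) (simp add: q_def)
  have Uc: "U k \<in> carrier_mat D D" for k by (rule incoh_unitary_carrier[OF Uinc])
  define V :: "complex mat" where "V = mat D a (\<lambda>(r,x). if r = x then 1 else 0)"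
  have Vc: "V \<in> carrier_mat D a" by (simp add: V_def)
  define \<Phi> where "\<Phi> X = msum D D (\<lambda>m. complex_of_real 1 \<cdot>\<^sub>m
      msum D D (\<lambda>k. U k * incoh_proj D (I k) * X * incoh_proj D (I k) * adj (U k)) {..<B + 1}) {..<1::nat}" for X
  define \<Lambda> where "\<Lambda> X = ptrace2 b a (\<Phi> (V * X * adj V))" for X
  have Vinc: "incoherent V"
    unfolding incoherent_def
  proof (intro allI impI)
    fix j assume "j < dim_col V"
    then show "\<exists>i<dim_row V. \<forall>i'<dim_row V. i' \<noteq> i \<longrightarrow> V $$ (i',j) = 0"
      using aD by (intro exI[of _ j]) (auto simp: V_def)
  qed
  have VV: "adj V * V = 1\<^sub>m a"
  proof (rule eq_matI)
    fix i j assume "i < dim_row (1\<^sub>m a :: complex mat)" "j < dim_col (1\<^sub>m a :: complex mat)"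
    then have ij: "i < a" "j < a" by auto
    have "(adj V * V) $$ (i,j) = (\<Sum>k<D. if k = i then if i = j then 1 else 0 else 0)"
      unfolding index_mult_mat_sum[OF adj_carrier[OF Vc] Vc ij]
      using Vc ij aD by (intro sum.cong) (auto simp: V_def)
    then show "(adj V * V) $$ (i,j) = 1\<^sub>m a $$ (i,j)" using ij aD by simp
  qed (use Vc in auto)
  have PIO: "PIO_sq D \<Phi>"
    unfolding PIO_sq_def
  proof (rule exI[of _ 1], rule exI[of _ "\<lambda>_. 1"], rule exI[of _ "\<lambda>_. B + 1"],
      rule exI[of _ "\<lambda>_. U"], rule exI[of _ "\<lambda>_. I"], intro conjI allI impI ballI)
    show "msum D D (\<lambda>k. incoh_proj D (I k)) {..<B + 1} = 1\<^sub>m D"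
    proof (rule eq_matI)
      fix i j assume "i < dim_row (1\<^sub>m D :: complex mat)" "j < dim_col (1\<^sub>m D :: complex mat)"
      then have ij: "i < D" "j < D" by auto
      let ?k = "if i < a then \<beta> i else B"
      have "?k < B + 1" using \<beta>[of i] by auto
      have "i \<in> I k \<longleftrightarrow> k = ?k" if "k < B + 1" for k
        using that \<beta>[of i] ij(1) by (cases "i < a"; cases "k < B") (simp_all add: I_def eq_commute)
      then have "(\<Sum>k<B + 1. incoh_proj D (I k) $$ (i,j))
          = (\<Sum>k<B + 1. if k = ?k then if i = j then 1 else 0 else 0)"
        using ij by (intro sum.cong) (simp_all add: incoh_proj_def del: sum.lessThan_Suc)
      then show "msum D D (\<lambda>k. incoh_proj D (I k)) {..<B + 1} $$ (i,j) = 1\<^sub>m D $$ (i,j)"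
        using ij \<open>?k < B + 1\<close> by (simp add: msum_entry del: sum.lessThan_Suc)
    qed (simp_all add: msum_def)
    show "I k \<subseteq> {..<D}" for k using aD by (auto simp: I_def)
  qed (simp_all add: Uinc \<Phi>_def)
  have lift: "lifted PIO_sq a b \<Lambda>"
    unfolding lifted_def
    by (rule exI[of _ a], rule exI[of _ V], rule exI[of _ \<Phi>])
      (use Vc Vinc VV PIO in \<open>simp add: D_def \<Lambda>_def\<close>)
  define W where "W k = U k * incoh_proj D (I k) * V" for k
  have UPc: "U k * incoh_proj D (I k) \<in> carrier_mat D D" for k
    by (rule mult_carrier_mat[OF Uc incoh_proj_carrier])
  have Wc: "W k \<in> carrier_mat D a" for k
    unfolding W_def using UPc Vc by (rule mult_carrier_mat)
  have W: "W k $$ (r,x) = (if k < B \<and> \<beta> x = k \<and> r = pos x * a then ph x else 0)"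
    if "r < D" "x < a" for k r x
  proof -
    have xD: "x < D" using that aD by simp
    have "W k $$ (r,x) = (\<Sum>s<D. if s = x then (U k * incoh_proj D (I k)) $$ (r,x) else 0)"
      unfolding W_def index_mult_mat_sum[OF UPc Vc that]
      using that by (intro sum.cong) (auto simp: V_def)
    also have "\<dots> = (if r = \<sigma> k x \<and> x \<in> I k then q x else 0)"
      using xD unfolding U_def perm_diag_proj_entry[OF \<sigma> that(1) xD] by simp
    also have "\<dots> = (if k < B \<and> \<beta> x = k \<and> r = pos x * a then ph x else 0)"
      using \<sigma>_pos[of k x] that by (auto simp: I_def q_def)
    finally show ?thesis .
  qed
  have "\<Lambda> X = mat b b (\<lambda>(i,j). \<Sum>x<a. \<Sum>y<a.
       if \<beta> x = \<beta> y \<and> pos x = i \<and> pos y = j then ph x * cnj (ph y) * X $$ (x,y) else 0)"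
    (is "_ = ?R") if X: "X \<in> carrier_mat a a" for X
  proof (rule eq_matI)
    fix i j assume "i < dim_row ?R" "j < dim_col ?R"
    then have ij: "i < b" "j < b" by auto
    have idx: "i * a + k < D" if "i < b" "k < a" for i k
    proof -
      have "i * a + k < (i + 1) * a" using that by simp
      also have "\<dots> \<le> D" unfolding D_def using that by (intro mult_le_mono1) simp
      finally show ?thesis .
    qed
    \<comment> \<open>Every block element lands on a multiple of \<open>a\<close>, so only the index
      0 of the discarded system survives in the partial trace.\<close>
    have idx_eq: "i * a + k = m * a \<longleftrightarrow> k = 0 \<and> i = m" if "k < a" for i k m
    proof
      assume e: "i * a + k = m * a"
      have "(i * a + k) mod a = 0" unfolding e by simp
      then have "k = 0" using that by simp
      then show "k = 0 \<and> i = m" using e a by simp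
    qed simp
    have VXV: "V * X * adj V \<in> carrier_mat D D"
      by (rule mult_carrier_mat[OF mult_carrier_mat[OF Vc X] adj_carrier[OF Vc]])
    have conj: "U k * incoh_proj D (I k) * (V * X * adj V) * incoh_proj D (I k) * adj (U k)
        = W k * X * adj (W k)" for k
      unfolding proj_conj_eq[OF Uc VXV] W_def by (rule conj_conj_mat[OF UPc Vc X])
    let ?t = "\<lambda>\<kappa> x y. if \<beta> x = \<kappa> \<and> \<beta> y = \<kappa> \<and> pos x = i \<and> pos y = j then ph x * cnj (ph y) * X $$ (x,y) else 0"
    have "\<Lambda> X $$ (i,j) = (\<Sum>k<a. \<Sum>\<kappa><B + 1. (W \<kappa> * X * adj (W \<kappa>)) $$ (i * a + k, j * a + k))"
      unfolding \<Lambda>_def ptrace2_def using ij idx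
      by (simp add: \<Phi>_def msum_entry conj del: sum.lessThan_Suc)
    also have "\<dots> = (\<Sum>k<a. \<Sum>\<kappa><B + 1. if k = 0 then if \<kappa> < B then \<Sum>x<a. \<Sum>y<a. ?t \<kappa> x y else 0 else 0)"
    proof (intro sum.cong refl)
      fix k \<kappa> assume "k \<in> {..<a}" "\<kappa> \<in> {..<B + 1}"
      then have k: "k < a" by simp
      have "(W \<kappa> * X * adj (W \<kappa>)) $$ (i * a + k, j * a + k)
          = (\<Sum>x<a. \<Sum>y<a. if k = 0 \<and> \<kappa> < B then ?t \<kappa> x y else 0)"
        unfolding conj_mat_entry[OF Wc X idx[OF ij(1) k] idx[OF ij(2) k]]
      proof (intro sum.cong refl)
        fix x y assume "x \<in> {..<a}" "y \<in> {..<a}"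
        then have xy: "x < a" "y < a" by auto
        show "W \<kappa> $$ (i * a + k, x) * X $$ (x, y) * cnj (W \<kappa> $$ (j * a + k, y))
            = (if k = 0 \<and> \<kappa> < B then ?t \<kappa> x y else 0)"
          unfolding W[OF idx[OF ij(1) k] xy(1)] W[OF idx[OF ij(2) k] xy(2)] idx_eq[OF k] by auto
      qed
      then show "(W \<kappa> * X * adj (W \<kappa>)) $$ (i * a + k, j * a + k)
          = (if k = 0 then if \<kappa> < B then \<Sum>x<a. \<Sum>y<a. ?t \<kappa> x y else 0 else 0)"
        by (cases "k = 0"; cases "\<kappa> < B") simp_all
    qed
    also have "\<dots> = (\<Sum>k<a. if k = 0 then \<Sum>\<kappa><B + 1. if \<kappa> < B then \<Sum>x<a. \<Sum>y<a. ?t \<kappa> x y else 0 else 0)"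
      by (intro sum.cong) auto
    also have "\<dots> = (\<Sum>\<kappa><B. \<Sum>x<a. \<Sum>y<a. ?t \<kappa> x y)"
      using a by simp
    also have "\<dots> = (\<Sum>x<a. \<Sum>y<a. \<Sum>\<kappa><B. ?t \<kappa> x y)"
      by (subst sum.swap) (intro sum.cong refl sum.swap)
    also have "\<dots> = (\<Sum>x<a. \<Sum>y<a.
       if \<beta> x = \<beta> y \<and> pos x = i \<and> pos y = j then ph x * cnj (ph y) * X $$ (x,y) else 0)"
    proof (intro sum.cong refl)
      fix x y assume xy: "x \<in> {..<a}" "y \<in> {..<a}"
      have "(\<Sum>\<kappa><B. ?t \<kappa> x y) = (\<Sum>\<kappa><B. if \<kappa> = \<beta> x then
          if \<beta> x = \<beta> y \<and> pos x = i \<and> pos y = j then ph x * cnj (ph y) * X $$ (x,y) else 0 else 0)"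
        by (intro sum.cong) auto
      then show "(\<Sum>\<kappa><B. ?t \<kappa> x y) =
         (if \<beta> x = \<beta> y \<and> pos x = i \<and> pos y = j then ph x * cnj (ph y) * X $$ (x,y) else 0)"
        using \<beta>[of x] xy by simp
    qed
    finally show "\<Lambda> X $$ (i,j) = ?R $$ (i,j)" using ij by simp
  qed (simp_all add: \<Lambda>_def ptrace2_def)
  then show thesis using that lift by blast
qed

text \<open>Kraus operators are indexed by a finite set of pairs, the form in which they arise from
  \<open>PIO_sq\<close>; \<open>strict_kraus_imp_SIO_sq\<close> shows that this class is no larger
  than \<open>SIO_sq\<close>.\<close>

definition strict_kraus :: "nat \<Rightarrow> (complex mat \<Rightarrow> complex mat) \<Rightarrow> bool" where
  "strict_kraus D \<Phi> \<longleftrightarrow> (\<exists>(S :: (nat \<times> nat) set) K. finite S \<and>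
     (\<forall>a\<in>S. K a \<in> carrier_mat D D \<and> incoherent (K a) \<and> incoherent (adj (K a))) \<and>
     msum D D (\<lambda>a. adj (K a) * K a) S = 1\<^sub>m D \<and>
     (\<forall>X \<in> carrier_mat D D. \<Phi> X = msum D D (\<lambda>a. K a * X * adj (K a)) S))"

lemma SIO_sq_imp_strict_kraus:
  assumes "SIO_sq D \<Phi>"
  shows "strict_kraus D \<Phi>"
proof -
  obtain N :: nat and K where K:
    "\<And>a. a < N \<Longrightarrow> K a \<in> carrier_mat D D \<and> incoherent (K a) \<and> incoherent (adj (K a))"
    "msum D D (\<lambda>a. adj (K a) * K a) {..<N} = 1\<^sub>m D"
    "\<And>X. X \<in> carrier_mat D D \<Longrightarrow> \<Phi> X = msum D D (\<lambda>a. K a * X * adj (K a)) {..<N}"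
    using assms unfolding SIO_sq_def by auto
  have reindex: "msum D D (\<lambda>a. F (fst a)) ({..<N} \<times> {0::nat}) = msum D D F {..<N}" for F
    unfolding msum_def by (intro cong_mat refl) (auto simp: sum.cartesian_product' )
  show ?thesis
    unfolding strict_kraus_def
    by (rule exI[of _ "{..<N} \<times> {0}"], rule exI[of _ "\<lambda>a. K (fst a)"])
      (auto simp: K reindex[of "\<lambda>a. adj (K a) * K a"] reindex[of "\<lambda>a. K a * X * adj (K a)" for X])
qed

text \<open>The Kraus operators are the truncated incoherent unitaries, weighted by the root of
  their probability. A permutation with phases has one nonzero entry in every row and column and a
  projector only deletes entries, which gives both incoherence conditions.\<close>

lemma PIO_sq_imp_strict_kraus:
  assumes "PIO_sq D \<Phi>"
  shows "strict_kraus D \<Phi>"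
proof -
  obtain A :: nat and p :: "nat \<Rightarrow> real" and B :: "nat \<Rightarrow> nat" and U I where
    raw: "(\<forall>a<A. 0 \<le> p a) \<and> (\<Sum>a<A. p a) = 1 \<and>
     (\<forall>a<A. \<forall>b<B a. incoh_unitary D (U a b) \<and> I a b \<subseteq> {..<D}) \<and>
     (\<forall>a<A. msum D D (\<lambda>b. incoh_proj D (I a b)) {..<B a} = 1\<^sub>m D) \<and>
     (\<forall>X \<in> carrier_mat D D. \<Phi> X =
        msum D D (\<lambda>a. complex_of_real (p a) \<cdot>\<^sub>m
          msum D D (\<lambda>b. U a b * incoh_proj D (I a b) * X * incoh_proj D (I a b) * adj (U a b))
            {..<B a}) {..<A})"
    using assms unfolding PIO_sq_def by (elim exE) (rule that)
  have p: "\<And>a. a < A \<Longrightarrow> 0 \<le> p a" "(\<Sum>a<A. p a) = 1"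
    and U: "\<And>a b. a < A \<Longrightarrow> b < B a \<Longrightarrow> incoh_unitary D (U a b)"
    and I: "\<And>a. a < A \<Longrightarrow> msum D D (\<lambda>b. incoh_proj D (I a b)) {..<B a} = 1\<^sub>m D"
    using raw by auto
  have \<Phi>: "\<Phi> X = msum D D (\<lambda>a. complex_of_real (p a) \<cdot>\<^sub>m
      msum D D (\<lambda>b. U a b * incoh_proj D (I a b) * X * incoh_proj D (I a b) * adj (U a b))
        {..<B a}) {..<A}" if "X \<in> carrier_mat D D" for X
    using raw that by blast
  define S where "S = Sigma {..<A} (\<lambda>a. {..<B a})"
  define G where "G a b = U a b * incoh_proj D (I a b)" for a b
  define K where "K c = complex_of_real (sqrt (p (fst c))) \<cdot>\<^sub>m G (fst c) (snd c)" for c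
  have Gc: "G a b \<in> carrier_mat D D" if "a < A" "b < B a" for a b
    unfolding G_def by (rule mult_carrier_mat[OF incoh_unitary_carrier[OF U[OF that]] incoh_proj_carrier])
  \<comment> \<open>Permutation and phases are bundled in one pair so that a single choice fixes
    both compatibly.\<close>
  define Q where "Q a b q \<longleftrightarrow> fst q permutes {..<D} \<and> (\<forall>s<D. cmod (snd q s) = 1) \<and>
      (\<forall>r<D. \<forall>s<D. G a b $$ (r,s) = (if r = fst q s \<and> s \<in> I a b then snd q s else 0))"
    for a b and q :: "(nat \<Rightarrow> nat) \<times> (nat \<Rightarrow> complex)"
  define \<sigma> where "\<sigma> a b = fst (SOME q. Q a b q)" for a b
  define ph where "ph a b = snd (SOME q. Q a b q)" for a b
  have Q: "Q a b (SOME q. Q a b q)" if ab: "a < A" "b < B a" for a b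
  proof (rule someI_ex)
    obtain \<sigma> ph where "\<sigma> permutes {..<D}" "\<forall>s<D. cmod (ph s) = 1" "U a b = perm_mat D \<sigma> * diag_phase D ph"
      using U[OF ab] unfolding incoh_unitary_def by blast
    then have "Q a b (\<sigma>, ph)"
      unfolding Q_def G_def by (simp add: perm_diag_proj_entry)
    then show "\<exists>q. Q a b q" by blast
  qed
  have QD: "fst q permutes {..<D}" "s < D \<Longrightarrow> cmod (snd q s) = 1"
    "r < D \<Longrightarrow> s < D \<Longrightarrow> G a b $$ (r,s) = (if r = fst q s \<and> s \<in> I a b then snd q s else 0)"
    if "Q a b q" for a b q r s
    using that unfolding Q_def by blast+
  have perm: "\<sigma> a b permutes {..<D}" if "a < A" "b < B a" for a b
    unfolding \<sigma>_def by (rule QD(1)[OF Q[OF that]])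
  have ph: "cmod (ph a b s) = 1" if "a < A" "b < B a" "s < D" for a b s
    unfolding ph_def by (rule QD(2)[OF Q[OF that(1,2)] that(3)])
  have G: "G a b $$ (r,s) = (if r = \<sigma> a b s \<and> s \<in> I a b then ph a b s else 0)"
    if "a < A" "b < B a" "r < D" "s < D" for a b r s
    unfolding ph_def \<sigma>_def by (rule QD(3)[OF Q[OF that(1,2)] that(3,4)])
  have Kc: "K c \<in> carrier_mat D D" if "c \<in> S" for c
    using Gc that by (auto simp: K_def S_def)
  have Ke: "K (a,b) $$ (r,s) = (if r = \<sigma> a b s \<and> s \<in> I a b then of_real (sqrt (p a)) * ph a b s else 0)"
    if "a < A" "b < B a" "r < D" "s < D" for a b r s
    using G[OF that] Gc[OF that(1,2)] that by (simp add: K_def)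
  have inc: "incoherent (K c) \<and> incoherent (adj (K c))" if c: "c \<in> S" for c
  proof -
    obtain a b where ab: "c = (a,b)" "a < A" "b < B a" using c by (auto simp: S_def)
    note pm = perm[OF ab(2,3)]
    have dims: "dim_row (K c) = D" "dim_col (K c) = D" using Kc[OF c] by auto
    have "incoherent (K c)"
      unfolding incoherent_def dims
    proof (intro allI impI)
      fix j assume j: "j < D"
      then have "\<sigma> a b j < D" using permutes_in_image[OF pm, of j] by simp
      then show "\<exists>i<D. \<forall>i'<D. i' \<noteq> i \<longrightarrow> K c $$ (i', j) = 0"
        using Ke[OF ab(2,3) _ j] ab(1) by auto
    qed
    moreover have "incoherent (adj (K c))"
      unfolding incoherent_def adj_dim dims
    proof (intro allI impI)
      fix j assume j: "j < D"
      obtain i where i: "i < D" "\<sigma> a b i = j"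
        using permutes_image[OF pm] j by (metis imageE lessThan_iff)
      have "adj (K c) $$ (i', j) = 0" if "i' < D" "i' \<noteq> i" for i'
      proof -
        have "j \<noteq> \<sigma> a b i'" using permutes_inj[OF pm] i that by (metis injD)
        then show ?thesis using Ke[OF ab(2,3) j that(1)] dims j that ab(1) by simp
      qed
      then show "\<exists>i<D. \<forall>i'<D. i' \<noteq> i \<longrightarrow> adj (K c) $$ (i', j) = 0" using i by blast
    qed
    ultimately show ?thesis by blast
  qed
  have S_sum: "(\<Sum>c\<in>S. F c) = (\<Sum>a<A. \<Sum>b<B a. F (a,b))" for F :: "nat \<times> nat \<Rightarrow> complex"
    unfolding S_def by (subst sum.Sigma) (auto simp: case_prod_beta)
  have KK: "msum D D (\<lambda>c. adj (K c) * K c) S = 1\<^sub>m D"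
  proof (rule eq_matI)
    fix i j assume "i < dim_row (1\<^sub>m D :: complex mat)" "j < dim_col (1\<^sub>m D :: complex mat)"
    then have ij: "i < D" "j < D" by auto
    have "(adj (K (a,b)) * K (a,b)) $$ (i,j) = of_real (p a) * incoh_proj D (I a b) $$ (i,j)"
      if ab: "a < A" "b < B a" for a b
    proof -
      have c: "K (a,b) \<in> carrier_mat D D" using Kc ab by (simp add: S_def)
      note pm = perm[OF ab]
      have sg: "\<sigma> a b i < D" using permutes_in_image[OF pm, of i] ij by simp
      have inj: "\<sigma> a b i = \<sigma> a b j \<longleftrightarrow> i = j" using permutes_inj[OF pm] by (metis injD)
      have one: "cnj (ph a b i) * ph a b i = 1"
        using ph[OF ab ij(1)] by (metis complex_norm_square mult.commute of_real_1 one_power2)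
      have sq: "complex_of_real (sqrt (p a)) * of_real (sqrt (p a)) = of_real (p a)"
        using p(1)[OF ab(1)] by (simp flip: of_real_mult)
      have "(adj (K (a,b)) * K (a,b)) $$ (i,j) = (\<Sum>r<D. cnj (K (a,b) $$ (r,i)) * K (a,b) $$ (r,j))"
        unfolding index_mult_mat_sum[OF adj_carrier[OF c] c ij] using c ij by (intro sum.cong) auto
      also have "\<dots> = (\<Sum>r<D. if r = \<sigma> a b i then if i = j \<and> i \<in> I a b then
          (of_real (sqrt (p a)) * of_real (sqrt (p a))) * (cnj (ph a b i) * ph a b i) else 0 else 0)"
      proof (intro sum.cong refl)
        fix r assume "r \<in> {..<D}"
        then have r: "r < D" by simp
        show "cnj (K (a,b) $$ (r,i)) * K (a,b) $$ (r,j) = (if r = \<sigma> a b i then if i = j \<and> i \<in> I a b then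
          (of_real (sqrt (p a)) * of_real (sqrt (p a))) * (cnj (ph a b i) * ph a b i) else 0 else 0)"
          unfolding Ke[OF ab r ij(1)] Ke[OF ab r ij(2)] using inj by auto
      qed
      also have "\<dots> = of_real (p a) * incoh_proj D (I a b) $$ (i,j)"
        unfolding one sq using sg ij by (auto simp: incoh_proj_def)
      finally show ?thesis .
    qed
    then have "msum D D (\<lambda>c. adj (K c) * K c) S $$ (i,j)
        = (\<Sum>a<A. of_real (p a) * (\<Sum>b<B a. incoh_proj D (I a b) $$ (i,j)))"
      using ij by (simp add: msum_entry S_sum sum_distrib_left)
    also have "\<dots> = (\<Sum>a<A. of_real (p a) * 1\<^sub>m D $$ (i,j))"
    proof (intro sum.cong refl)
      fix a assume "a \<in> {..<A}"
      then have "(\<Sum>b<B a. incoh_proj D (I a b) $$ (i,j)) = 1\<^sub>m D $$ (i,j)"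
        using I[of a] msum_entry[OF ij, of "\<lambda>b. incoh_proj D (I a b)" "{..<B a}"] by simp
      then show "of_real (p a) * (\<Sum>b<B a. incoh_proj D (I a b) $$ (i,j)) = of_real (p a) * 1\<^sub>m D $$ (i,j)"
        by simp
    qed
    also have "\<dots> = of_real (\<Sum>a<A. p a) * 1\<^sub>m D $$ (i,j)"
      by (simp only: of_real_sum sum_distrib_right)
    finally show "msum D D (\<lambda>c. adj (K c) * K c) S $$ (i,j) = 1\<^sub>m D $$ (i,j)" by (simp add: p)
  qed simp_all
  have "\<Phi> X = msum D D (\<lambda>c. K c * X * adj (K c)) S" if X: "X \<in> carrier_mat D D" for X
  proof (rule eq_matI)
    fix i j assume "i < dim_row (msum D D (\<lambda>c. K c * X * adj (K c)) S)"
      "j < dim_col (msum D D (\<lambda>c. K c * X * adj (K c)) S)"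
    then have ij: "i < D" "j < D" by auto
    have "(K (a,b) * X * adj (K (a,b))) $$ (i,j) = of_real (p a) * (G a b * X * adj (G a b)) $$ (i,j)"
      if ab: "a < A" "b < B a" for a b
    proof -
      have c: "K (a,b) \<in> carrier_mat D D" using Kc ab by (simp add: S_def)
      have sq: "complex_of_real (sqrt (p a)) * of_real (sqrt (p a)) = of_real (p a)"
        using p(1)[OF ab(1)] by (simp flip: of_real_mult)
      have Kent: "K (a,b) $$ (i,j) = of_real (sqrt (p a)) * G a b $$ (i,j)" if "i < D" "j < D" for i j
        using that Gc[OF ab] by (simp add: K_def)
      have "(K (a,b) * X * adj (K (a,b))) $$ (i,j) = (\<Sum>x<D. \<Sum>y<D.
          (of_real (sqrt (p a)) * of_real (sqrt (p a))) * (G a b $$ (i,x) * X $$ (x,y) * cnj (G a b $$ (j,y))))"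
        unfolding conj_mat_entry[OF c X ij] using ij by (intro sum.cong refl) (simp add: Kent)
      then show ?thesis
        unfolding conj_mat_entry[OF Gc[OF ab] X ij] sq by (simp add: sum_distrib_left)
    qed
    then have "msum D D (\<lambda>c. K c * X * adj (K c)) S $$ (i,j)
        = (\<Sum>a<A. \<Sum>b<B a. of_real (p a) * (G a b * X * adj (G a b)) $$ (i,j))"
      using ij by (simp add: msum_entry S_sum)
    also have "\<dots> = \<Phi> X $$ (i,j)"
      unfolding \<Phi>[OF X] msum_entry[OF ij]
    proof (intro sum.cong refl)
      fix a assume "a \<in> {..<A}"
      then have a: "a < A" by simp
      have "(U a b * incoh_proj D (I a b) * X * incoh_proj D (I a b) * adj (U a b)) $$ (i,j)
          = (G a b * X * adj (G a b)) $$ (i,j)" if "b < B a" for b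
        unfolding proj_conj_eq[OF incoh_unitary_carrier[OF U[OF a that]] X] G_def ..
      then show "(\<Sum>b<B a. of_real (p a) * (G a b * X * adj (G a b)) $$ (i,j)) =
        (complex_of_real (p a) \<cdot>\<^sub>m msum D D (\<lambda>b. U a b * incoh_proj D (I a b) * X *
          incoh_proj D (I a b) * adj (U a b)) {..<B a}) $$ (i,j)"
        using ij by (simp add: msum_entry sum_distrib_left)
    qed
    finally show "\<Phi> X $$ (i,j) = msum D D (\<lambda>c. K c * X * adj (K c)) S $$ (i,j)" by simp
  qed (simp_all add: \<Phi>[OF X])
  moreover have "finite S" by (simp add: S_def)
  ultimately show ?thesis
    unfolding strict_kraus_def using Kc inc KK by blast
qed

text \<open>Column \<open>x\<close> lives on the single row \<open>v x\<close>, so orthonormality of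
  the columns is read off there: the entry is a phase, and no two columns share a row.\<close>

lemma incoherent_isometry_positions:
  assumes V: "V \<in> carrier_mat D a" "incoherent V" "adj V * V = 1\<^sub>m a"
  obtains v where "\<And>x. x < a \<Longrightarrow> v x < D" "inj_on v {..<a}"
    "\<And>x r. x < a \<Longrightarrow> r < D \<Longrightarrow> r \<noteq> v x \<Longrightarrow> V $$ (r,x) = 0"
    "\<And>x. x < a \<Longrightarrow> cmod (V $$ (v x, x)) = 1"
proof -
  have "\<forall>x<a. \<exists>i<D. \<forall>i'<D. i' \<noteq> i \<longrightarrow> V $$ (i',x) = 0"
    using V(1,2) unfolding incoherent_def by auto
  then obtain v where v: "\<And>x. x < a \<Longrightarrow> v x < D"
    "\<And>x r. x < a \<Longrightarrow> r < D \<Longrightarrow> r \<noteq> v x \<Longrightarrow> V $$ (r,x) = 0"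
    by metis
  have gram: "cnj (V $$ (v x, x)) * V $$ (v x, y) = (if x = y then 1 else 0)"
    if xy: "x < a" "y < a" for x y
  proof -
    have "(adj V * V) $$ (x,y) = (\<Sum>r<D. if r = v x then cnj (V $$ (v x, x)) * V $$ (v x, y) else 0)"
      unfolding index_mult_mat_sum[OF adj_carrier[OF V(1)] V(1) xy]
      using V(1) v(2)[OF xy(1)] xy by (intro sum.cong) auto
    then show ?thesis using V(3) v(1)[OF xy(1)] xy by simp
  qed
  have norm: "cmod (V $$ (v x, x)) = 1" if "x < a" for x
  proof -
    have "complex_of_real ((cmod (V $$ (v x, x)))\<^sup>2) = 1"
      using gram[OF that that] by (simp add: complex_norm_square mult.commute del: of_real_power)
    then have "(cmod (V $$ (v x, x)))\<^sup>2 = 1" using of_real_eq_1_iff by blast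
    then show ?thesis by (simp add: abs_square_eq_1)
  qed
  have "inj_on v {..<a}"
  proof (rule inj_onI)
    fix x y assume xy: "x \<in> {..<a}" "y \<in> {..<a}" and eq: "v x = v y"
    then have lt: "x < a" "y < a" by auto
    have "V $$ (v x, x) \<noteq> 0" "V $$ (v x, y) \<noteq> 0"
      using norm[OF lt(1)] norm[OF lt(2)] eq by auto
    then show "x = y" using gram[OF lt] by (auto split: if_splits)
  qed
  then show thesis using that v norm by blast
qed

text \<open>At most one summand is nonzero, so there are no cross terms. If \<open>i0\<close> lies
  outside the range, both sides are 0.\<close>

lemma cmod_sum_single_square:
  fixes f :: "nat \<Rightarrow> complex"
  assumes "\<And>i. i < b \<Longrightarrow> i \<noteq> i0 \<Longrightarrow> f i = 0"
  shows "(cmod (\<Sum>i<b. f i))\<^sup>2 = (\<Sum>i<b. (cmod (f i))\<^sup>2)"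
proof -
  have "(\<Sum>i<b. f i) = (\<Sum>i<b. if i = i0 then f i0 else 0)"
    using assms by (intro sum.cong) auto
  moreover have "(\<Sum>i<b. (cmod (f i))\<^sup>2) = (\<Sum>i<b. if i = i0 then (cmod (f i0))\<^sup>2 else 0)"
    using assms by (intro sum.cong) auto
  ultimately show ?thesis by simp
qed

lemma sum_swap_pair:
  "(\<Sum>i\<in>A. \<Sum>j\<in>B. \<Sum>z\<in>Z. T i j z) = (\<Sum>z\<in>Z. \<Sum>i\<in>A. \<Sum>j\<in>B. T i j z)"
proof -
  have "(\<Sum>i\<in>A. \<Sum>j\<in>B. \<Sum>z\<in>Z. T i j z) = (\<Sum>i\<in>A. \<Sum>z\<in>Z. \<Sum>j\<in>B. T i j z)"
    by (intro sum.cong refl sum.swap)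
  also have "\<dots> = (\<Sum>z\<in>Z. \<Sum>i\<in>A. \<Sum>j\<in>B. T i j z)" by (rule sum.swap)
  finally show ?thesis .
qed

text \<open>The functionals \<open>X \<mapsto> c X c\<^sup>*\<close> arise from the overlap of the output with the maximally
  coherent state, one for every Kraus operator and every basis vector of the discarded system.
  Strict incoherence bounds the support of each of them by the output dimension.\<close>

lemma strict_kraus_overlap:
  assumes lift: "lifted Cls a b \<Lambda>" and Cls: "\<And>D \<Phi>. Cls D \<Phi> \<Longrightarrow> strict_kraus D \<Phi>"
    and X: "X \<in> carrier_mat a a"
  obtains J :: "((nat \<times> nat) \<times> nat) set" and c :: "(nat \<times> nat) \<times> nat \<Rightarrow> nat \<Rightarrow> complex"
  where "finite J" "\<And>\<alpha>. \<alpha> \<in> J \<Longrightarrow> card {x. x < a \<and> c \<alpha> x \<noteq> 0} \<le> b"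
    "\<And>x. x < a \<Longrightarrow> (\<Sum>\<alpha>\<in>J. (cmod (c \<alpha> x))\<^sup>2) = 1"
    "\<Lambda> X \<in> carrier_mat b b"
    "(\<Sum>i<b. \<Sum>j<b. \<Lambda> X $$ (i,j)) = (\<Sum>\<alpha>\<in>J. \<Sum>x<a. \<Sum>y<a. c \<alpha> x * X $$ (x,y) * cnj (c \<alpha> y))"
proof -
  obtain e V \<Phi> where V: "V \<in> carrier_mat (b * e) a" "incoherent V" "adj V * V = 1\<^sub>m a"
    and Cl: "Cls (b * e) \<Phi>" and \<Lambda>: "\<Lambda> X = ptrace2 b e (\<Phi> (V * X * adj V))"
    using lift X unfolding lifted_def by blast
  define D where "D = b * e"
  note V = V[folded D_def]
  obtain S :: "(nat \<times> nat) set" and K where S: "finite S"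
    and K: "\<And>\<alpha>. \<alpha> \<in> S \<Longrightarrow> K \<alpha> \<in> carrier_mat D D" "\<And>\<alpha>. \<alpha> \<in> S \<Longrightarrow> incoherent (K \<alpha>)"
      "\<And>\<alpha>. \<alpha> \<in> S \<Longrightarrow> incoherent (adj (K \<alpha>))"
    and KK: "msum D D (\<lambda>\<alpha>. adj (K \<alpha>) * K \<alpha>) S = 1\<^sub>m D"
    and \<Phi>: "\<And>X. X \<in> carrier_mat D D \<Longrightarrow> \<Phi> X = msum D D (\<lambda>\<alpha>. K \<alpha> * X * adj (K \<alpha>)) S"
    using Cls[OF Cl] unfolding strict_kraus_def D_def by blast
  obtain v where v: "\<And>x. x < a \<Longrightarrow> v x < D" "inj_on v {..<a}"
    "\<And>x r. x < a \<Longrightarrow> r < D \<Longrightarrow> r \<noteq> v x \<Longrightarrow> V $$ (r,x) = 0"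
    "\<And>x. x < a \<Longrightarrow> cmod (V $$ (v x, x)) = 1"
    using incoherent_isometry_positions[OF V] by blast
  have "\<exists>t. \<forall>s<D. \<forall>r<D. r \<noteq> t s \<longrightarrow> K \<alpha> $$ (r,s) = 0" if "\<alpha> \<in> S" for \<alpha>
    using K(1,2)[OF that] unfolding incoherent_def by (metis carrier_matD)
  then obtain t where t: "\<And>\<alpha> s r. \<alpha> \<in> S \<Longrightarrow> s < D \<Longrightarrow> r < D \<Longrightarrow> r \<noteq> t \<alpha> s \<Longrightarrow> K \<alpha> $$ (r,s) = 0"
    by metis
  \<comment> \<open>\<open>t\<close> locates the nonzero entry of a column and will give the
    normalisation; \<open>m\<close>, from incoherence of the adjoint, locates that of a row and will
    bound the support.\<close>
  have "\<exists>m. \<forall>r<D. \<forall>s<D. s \<noteq> m r \<longrightarrow> K \<alpha> $$ (r,s) = 0" if "\<alpha> \<in> S" for \<alpha>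
  proof -
    have "\<forall>r<D. \<exists>s<D. \<forall>s'<D. s' \<noteq> s \<longrightarrow> cnj (K \<alpha> $$ (r,s')) = 0"
      using K(1,3)[OF that] unfolding incoherent_def by auto
    then show ?thesis by (metis complex_cnj_zero_iff)
  qed
  then obtain m where m: "\<And>\<alpha> r s. \<alpha> \<in> S \<Longrightarrow> r < D \<Longrightarrow> s < D \<Longrightarrow> s \<noteq> m \<alpha> r \<Longrightarrow> K \<alpha> $$ (r,s) = 0"
    by metis
  define W where "W \<alpha> = K \<alpha> * V" for \<alpha>
  have Wc: "W \<alpha> \<in> carrier_mat D a" if "\<alpha> \<in> S" for \<alpha>
    unfolding W_def by (rule mult_carrier_mat[OF K(1)[OF that] V(1)])
  have W: "W \<alpha> $$ (r,x) = K \<alpha> $$ (r, v x) * V $$ (v x, x)" if "\<alpha> \<in> S" "r < D" "x < a" for \<alpha> r x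
  proof -
    have "W \<alpha> $$ (r,x) = (\<Sum>s<D. if s = v x then K \<alpha> $$ (r, v x) * V $$ (v x, x) else 0)"
      unfolding W_def index_mult_mat_sum[OF K(1)[OF that(1)] V(1) that(2,3)]
      using v(3)[OF that(3)] by (intro sum.cong) auto
    then show ?thesis using v(1)[OF that(3)] by simp
  qed
  \<comment> \<open>Pairing of the output, at index \<open>k\<close> of the discarded system, with
    the all-ones vector; the normalisation \<open>1 / b\<close> of the maximally coherent state is
    postponed.\<close>
  define c where "c \<alpha>k x = (\<Sum>i<b. W (fst \<alpha>k) $$ (i * e + snd \<alpha>k, x))" for \<alpha>k x
  have idx: "i * e + k < D" if "i < b" "k < e" for i k
  proof -
    have "i * e + k < (i + 1) * e" using that by simp
    also have "\<dots> \<le> D" unfolding D_def using that by (intro mult_le_mono1) simp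
    finally show ?thesis .
  qed
  show thesis
  proof (rule that[of "S \<times> {..<e}" c])
    show "finite (S \<times> {..<e})" using S by simp
    show "\<Lambda> X \<in> carrier_mat b b" by (simp add: \<Lambda> ptrace2_def)
    show "card {x. x < a \<and> c \<alpha>k x \<noteq> 0} \<le> b" if "\<alpha>k \<in> S \<times> {..<e}" for \<alpha>k
    proof -
      obtain \<alpha> k where \<alpha>k: "\<alpha>k = (\<alpha>, k)" "\<alpha> \<in> S" "k < e" using \<open>\<alpha>k \<in> _\<close> by auto
      \<comment> \<open>For fixed \<open>k\<close> the functional reads \<open>b\<close> rows of the
        Kraus operator, and each row meets at most one input vector.\<close>
      have "v x \<in> (\<lambda>i. m \<alpha> (i * e + k)) ` {..<b}" if x: "x < a" "c \<alpha>k x \<noteq> 0" for x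
      proof -
        obtain i where i: "i < b" "W \<alpha> $$ (i * e + k, x) \<noteq> 0"
          using x(2) unfolding c_def \<alpha>k by (auto elim: sum.not_neutral_contains_not_neutral)
        then have "K \<alpha> $$ (i * e + k, v x) \<noteq> 0"
          using W[OF \<alpha>k(2) idx[OF i(1) \<alpha>k(3)] x(1)] by auto
        then have "v x = m \<alpha> (i * e + k)"
          using m[OF \<alpha>k(2) idx[OF i(1) \<alpha>k(3)] v(1)[OF x(1)]] by blast
        then show ?thesis using i by blast
      qed
      then have "v ` {x. x < a \<and> c \<alpha>k x \<noteq> 0} \<subseteq> (\<lambda>i. m \<alpha> (i * e + k)) ` {..<b}" by blast
      moreover have "inj_on v {x. x < a \<and> c \<alpha>k x \<noteq> 0}"
        using v(2) by (rule inj_on_subset) auto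
      ultimately have "card {x. x < a \<and> c \<alpha>k x \<noteq> 0} \<le> card ((\<lambda>i. m \<alpha> (i * e + k)) ` {..<b})"
        by (intro card_inj_on_le) auto
      also have "\<dots> \<le> b" using card_image_le[of "{..<b}" "\<lambda>i. m \<alpha> (i * e + k)"] by simp
      finally show ?thesis .
    qed
    show "(\<Sum>\<alpha>k\<in>S \<times> {..<e}. (cmod (c \<alpha>k x))\<^sup>2) = 1" if x: "x < a" for x
    proof -
      have inner: "(\<Sum>k<e. (cmod (c (\<alpha>, k) x))\<^sup>2) = (\<Sum>r<D. (cmod (K \<alpha> $$ (r, v x)))\<^sup>2)"
        if \<alpha>: "\<alpha> \<in> S" for \<alpha>
      proof (cases "e = 0")
        case True
        then show ?thesis by (simp add: D_def)
      next
        case False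
        \<comment> \<open>A column has at most one nonzero entry, so the coherent sum over
          \<open>i\<close> loses nothing, and summing over \<open>k\<close> recovers the full column
          norm.\<close>
        have "(cmod (c (\<alpha>, k) x))\<^sup>2 = (\<Sum>i<b. (cmod (W \<alpha> $$ (i * e + k, x)))\<^sup>2)" if k: "k < e" for k
          unfolding c_def fst_conv snd_conv
        proof (rule cmod_sum_single_square[of b "t \<alpha> (v x) div e"])
          fix i assume i: "i < b" "i \<noteq> t \<alpha> (v x) div e"
          have "i * e + k \<noteq> t \<alpha> (v x)"
          proof
            assume "i * e + k = t \<alpha> (v x)"
            then have "t \<alpha> (v x) div e = (i * e + k) div e" by simp
            also have "\<dots> = i" using k by simp
            finally show False using i by simp
          qed
          then have "K \<alpha> $$ (i * e + k, v x) = 0"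
            using t[OF \<alpha> v(1)[OF x] idx[OF i(1) k]] by simp
          then show "W \<alpha> $$ (i * e + k, x) = 0" using W[OF \<alpha> idx[OF i(1) k] x] by simp
        qed
        then have "(\<Sum>k<e. (cmod (c (\<alpha>, k) x))\<^sup>2) = (\<Sum>k<e. \<Sum>i<b. (cmod (W \<alpha> $$ (i * e + k, x)))\<^sup>2)"
          by (intro sum.cong) auto
        also have "\<dots> = (\<Sum>i<b. \<Sum>k<e. (cmod (W \<alpha> $$ (i * e + k, x)))\<^sup>2)" by (rule sum.swap)
        also have "\<dots> = (\<Sum>r<D. (cmod (W \<alpha> $$ (r div e * e + r mod e, x)))\<^sup>2)"
          unfolding D_def using False by (intro sum_lessThan_mult_divmod[symmetric]) simp
        also have "\<dots> = (\<Sum>r<D. (cmod (K \<alpha> $$ (r, v x)))\<^sup>2)"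
          using W[OF \<alpha> _ x] v(4)[OF x] by (intro sum.cong) (auto simp: norm_mult)
        finally show ?thesis .
      qed
      have "complex_of_real (\<Sum>\<alpha>\<in>S. \<Sum>r<D. (cmod (K \<alpha> $$ (r, v x)))\<^sup>2)
         = (\<Sum>\<alpha>\<in>S. (adj (K \<alpha>) * K \<alpha>) $$ (v x, v x))"
        unfolding of_real_sum
      proof (intro sum.cong refl)
        fix \<alpha> assume \<alpha>: "\<alpha> \<in> S"
        show "(\<Sum>r<D. complex_of_real ((cmod (K \<alpha> $$ (r, v x)))\<^sup>2)) = (adj (K \<alpha>) * K \<alpha>) $$ (v x, v x)"
          unfolding index_mult_mat_sum[OF adj_carrier[OF K(1)[OF \<alpha>]] K(1)[OF \<alpha>] v(1)[OF x] v(1)[OF x]]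
          using K(1)[OF \<alpha>] v(1)[OF x]
          by (intro sum.cong) (auto simp: complex_norm_square mult.commute simp del: of_real_power)
      qed
      also have "\<dots> = 1"
        using KK msum_entry[OF v(1)[OF x] v(1)[OF x], of "\<lambda>\<alpha>. adj (K \<alpha>) * K \<alpha>" S] v(1)[OF x] by simp
      finally have "(\<Sum>\<alpha>\<in>S. \<Sum>r<D. (cmod (K \<alpha> $$ (r, v x)))\<^sup>2) = 1"
        using of_real_eq_1_iff by blast
      then show ?thesis
        using inner by (simp add: sum.cartesian_product' cong: sum.cong)
    qed
    have VXV: "V * X * adj V \<in> carrier_mat D D"
      by (rule mult_carrier_mat[OF mult_carrier_mat[OF V(1) X] adj_carrier[OF V(1)]])
    have out: "\<Lambda> X $$ (i,j) = (\<Sum>k<e. \<Sum>\<alpha>\<in>S. \<Sum>x<a. \<Sum>y<a.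
        W \<alpha> $$ (i * e + k, x) * X $$ (x,y) * cnj (W \<alpha> $$ (j * e + k, y)))" if ij: "i < b" "j < b" for i j
    proof -
      have "\<Lambda> X $$ (i,j) = (\<Sum>k<e. \<Sum>\<alpha>\<in>S. (K \<alpha> * (V * X * adj V) * adj (K \<alpha>)) $$ (i * e + k, j * e + k))"
        unfolding \<Lambda> ptrace2_def \<Phi>[OF VXV] using ij idx by (simp add: msum_entry)
      also have "\<dots> = (\<Sum>k<e. \<Sum>\<alpha>\<in>S. \<Sum>x<a. \<Sum>y<a.
        W \<alpha> $$ (i * e + k, x) * X $$ (x,y) * cnj (W \<alpha> $$ (j * e + k, y)))"
      proof (intro sum.cong refl)
        fix k \<alpha> assume "k \<in> {..<e}" and \<alpha>: "\<alpha> \<in> S"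
        then have k: "k < e" by simp
        show "(K \<alpha> * (V * X * adj V) * adj (K \<alpha>)) $$ (i * e + k, j * e + k) = (\<Sum>x<a. \<Sum>y<a.
            W \<alpha> $$ (i * e + k, x) * X $$ (x,y) * cnj (W \<alpha> $$ (j * e + k, y)))"
          unfolding conj_conj_mat[OF K(1)[OF \<alpha>] V(1) X] W_def[symmetric]
          by (rule conj_mat_entry[OF Wc[OF \<alpha>] X idx[OF ij(1) k] idx[OF ij(2) k]])
      qed
      finally show ?thesis .
    qed
    have "(\<Sum>i<b. \<Sum>j<b. \<Lambda> X $$ (i,j)) = (\<Sum>i<b. \<Sum>j<b. \<Sum>k<e. \<Sum>\<alpha>\<in>S. \<Sum>x<a. \<Sum>y<a.
        W \<alpha> $$ (i * e + k, x) * X $$ (x,y) * cnj (W \<alpha> $$ (j * e + k, y)))"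
      using out by (intro sum.cong) auto
    also have "\<dots> = (\<Sum>k<e. \<Sum>\<alpha>\<in>S. \<Sum>x<a. \<Sum>y<a. \<Sum>i<b. \<Sum>j<b.
        W \<alpha> $$ (i * e + k, x) * X $$ (x,y) * cnj (W \<alpha> $$ (j * e + k, y)))"
      by (subst sum_swap_pair, rule sum.cong[OF refl], subst sum_swap_pair, rule sum.cong[OF refl],
          subst sum_swap_pair, rule sum.cong[OF refl], rule sum_swap_pair)
    also have "\<dots> = (\<Sum>k<e. \<Sum>\<alpha>\<in>S. \<Sum>x<a. \<Sum>y<a. c (\<alpha>,k) x * X $$ (x,y) * cnj (c (\<alpha>,k) y))"
    proof (intro sum.cong refl)
      fix k \<alpha> x y
      show "(\<Sum>i<b. \<Sum>j<b. W \<alpha> $$ (i * e + k, x) * X $$ (x,y) * cnj (W \<alpha> $$ (j * e + k, y)))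
          = c (\<alpha>,k) x * X $$ (x,y) * cnj (c (\<alpha>,k) y)"
        unfolding c_def fst_conv snd_conv cnj_sum
        by (subst sum_distrib_right) (rule sum_product[symmetric])
    qed
    also have "\<dots> = (\<Sum>\<alpha>\<in>S. \<Sum>k<e. \<Sum>x<a. \<Sum>y<a. c (\<alpha>,k) x * X $$ (x,y) * cnj (c (\<alpha>,k) y))"
      by (rule sum.swap)
    also have "\<dots> = (\<Sum>\<alpha>k\<in>S \<times> {..<e}. \<Sum>x<a. \<Sum>y<a. c \<alpha>k x * X $$ (x,y) * cnj (c \<alpha>k y))"
      by (rule sum.cartesian_product'[symmetric])
    finally show "(\<Sum>i<b. \<Sum>j<b. \<Lambda> X $$ (i,j)) = (\<Sum>\<alpha>k\<in>S \<times> {..<e}. \<Sum>x<a. \<Sum>y<a.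
        c \<alpha>k x * X $$ (x,y) * cnj (c \<alpha>k y))" .
  qed
qed

lemma strict_kraus_imp_SIO_sq:
  assumes "strict_kraus D \<Phi>"
  shows "SIO_sq D \<Phi>"
proof -
  obtain S :: "(nat \<times> nat) set" and K where S: "finite S"
    and K: "\<And>c. c \<in> S \<Longrightarrow> K c \<in> carrier_mat D D \<and> incoherent (K c) \<and> incoherent (adj (K c))"
    and KK: "msum D D (\<lambda>c. adj (K c) * K c) S = 1\<^sub>m D"
    and \<Phi>: "\<And>X. X \<in> carrier_mat D D \<Longrightarrow> \<Phi> X = msum D D (\<lambda>c. K c * X * adj (K c)) S"
    using assms unfolding strict_kraus_def by blast
  obtain h where h: "bij_betw h {..<card S} S"
    using ex_bij_betw_nat_finite[OF S] by (auto simp: atLeast0LessThan)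
  have reindex: "msum D D (\<lambda>a. F (h a)) {..<card S} = msum D D F S" for F
    unfolding msum_def using sum.reindex_bij_betw[OF h] by (intro cong_mat refl) auto
  have hS: "h a \<in> S" if "a < card S" for a using bij_betw_apply[OF h] that by simp
  show ?thesis
    unfolding SIO_sq_def
    by (rule exI[of _ "card S"], rule exI[of _ "\<lambda>a. K (h a)"])
      (simp add: K hS \<Phi> KK reindex[of "\<lambda>c. adj (K c) * K c"] reindex[of "\<lambda>c. K c * X * adj (K c)" for X])
qed

section \<open>Trace norm estimates\<close>

text \<open>Up to \<open>g\<close> this is the difference of the projectors on |0> and on the
  uniform vector. Its Gram matrix \<open>A\<close> satisfies \<open>A * A = s A\<close> and has
  trace \<open>2 s\<close>, so all power traces are those of \<open>s\<close> taken twice.\<close>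

lemma trace_norm_ground_minus_uniform:
  fixes g :: real and X :: "complex mat"
  assumes b: "0 < b" and g: "0 \<le> g" and X: "X \<in> carrier_mat b b"
    and Xe: "\<And>i j. i < b \<Longrightarrow> j < b \<Longrightarrow>
      X $$ (i,j) = of_real (g * ((if i = 0 \<and> j = 0 then 1 else 0) - 1 / b))"
  shows "trace_norm X = 2 * g * sqrt (1 - 1 / b)"
proof -
  define \<delta> :: "nat \<Rightarrow> real" where "\<delta> i = (if i = 0 then 1 else 0)" for i
  define w where "w = 1 / real b"
  define s where "s = g\<^sup>2 * (1 - w)"
  define A where "A = adj X * X"
  \<comment> \<open>Entries of the squared difference of the two projectors, with the scale
    \<open>g\<^sup>2\<close> split off.\<close>
  define \<tau> where "\<tau> i j = \<delta> i * \<delta> j - \<delta> i * w - \<delta> j * w + w" for i j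
  define t where "t i j = g\<^sup>2 * \<tau> i j" for i j
  have dz: "\<delta> 0 = 1" and dn: "\<And>k. k \<noteq> 0 \<Longrightarrow> \<delta> k = 0" by (simp_all add: \<delta>_def)
  have bw: "real b * w = 1" using b by (simp add: w_def)
  have Xe': "X $$ (i,j) = of_real (g * (\<delta> i * \<delta> j - w))" if "i < b" "j < b" for i j
    using Xe[OF that] by (simp add: \<delta>_def w_def)
  have Ac: "A \<in> carrier_mat b b"
    unfolding A_def by (rule mult_carrier_mat[OF adj_carrier[OF X] X])
  have lin: "(\<Sum>k<b. \<alpha> + \<beta> * \<delta> k) = b * \<alpha> + \<beta>" for \<alpha> \<beta> :: real
  proof -
    have "(\<Sum>k<b. \<beta> * \<delta> k) = (\<Sum>k<b. if k = 0 then \<beta> else 0)"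
      by (intro sum.cong) (auto simp: \<delta>_def)
    then show ?thesis using b by (simp add: sum.distrib)
  qed
  have Ae: "A $$ (i,j) = of_real (t i j)" if ij: "i < b" "j < b" for i j
  proof -
    have "A $$ (i,j) = of_real (\<Sum>k<b. (g * (\<delta> k * \<delta> i - w)) * (g * (\<delta> k * \<delta> j - w)))"
      unfolding A_def index_mult_mat_sum[OF adj_carrier[OF X] X ij] of_real_sum
      using X ij by (intro sum.cong refl) (simp add: Xe')
    also have "(\<Sum>k<b. (g * (\<delta> k * \<delta> i - w)) * (g * (\<delta> k * \<delta> j - w)))
       = (\<Sum>k<b. g\<^sup>2 * (w * w) + (g\<^sup>2 * (\<delta> i * \<delta> j - \<delta> i * w - \<delta> j * w)) * \<delta> k)"
    proof (intro sum.cong refl)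
      fix k
      show "(g * (\<delta> k * \<delta> i - w)) * (g * (\<delta> k * \<delta> j - w))
        = g\<^sup>2 * (w * w) + (g\<^sup>2 * (\<delta> i * \<delta> j - \<delta> i * w - \<delta> j * w)) * \<delta> k"
        by (cases "k = 0") (simp_all add: dz dn power2_eq_square algebra_simps)
    qed
    also have "\<dots> = g\<^sup>2 * ((b * w) * w) + g\<^sup>2 * (\<delta> i * \<delta> j - \<delta> i * w - \<delta> j * w)"
      unfolding lin by simp
    also have "\<dots> = t i j"
      unfolding bw by (simp add: t_def \<tau>_def algebra_simps)
    finally show ?thesis .
  qed
  have tt: "(\<Sum>k<b. t i k * t k j) = s * t i j" for i j
  proof -
    let ?\<alpha> = "(w - \<delta> i * w) * (w - \<delta> j * w)"
    let ?\<beta> = "(w - \<delta> i * w) * (\<delta> j - w) + (\<delta> i - w) * (w - \<delta> j * w) + (\<delta> i - w) * (\<delta> j - w)"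
    have "\<tau> i k * \<tau> k j = ?\<alpha> + ?\<beta> * \<delta> k" for k
      by (cases "k = 0") (simp_all add: \<tau>_def dz dn algebra_simps)
    then have "(\<Sum>k<b. \<tau> i k * \<tau> k j) = b * ?\<alpha> + ?\<beta>" by (simp only: lin)
    also have "b * ?\<alpha> = (b * w) * w * (1 - \<delta> i) * (1 - \<delta> j)" by (simp add: algebra_simps)
    also have "(b * w) * w * (1 - \<delta> i) * (1 - \<delta> j) + ?\<beta> = (1 - w) * \<tau> i j"
      unfolding bw \<tau>_def
      by (cases "i = 0"; cases "j = 0") (simp_all add: dz dn algebra_simps)
    finally have "g\<^sup>2 * g\<^sup>2 * (\<Sum>k<b. \<tau> i k * \<tau> k j) = s * t i j"
      by (simp add: s_def t_def)
    then show ?thesis by (simp add: t_def sum_distrib_left mult_ac)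
  qed
  have pow: "(A ^\<^sub>m Suc k) $$ (i,j) = of_real (s ^ k * t i j)" if ij: "i < b" "j < b" for i j k
    using ij
  proof (induction k arbitrary: j)
    case 0
    then show ?case using Ac Ae by simp
  next
    case (Suc k)
    have c: "A ^\<^sub>m Suc k \<in> carrier_mat b b" by (rule pow_carrier_mat[OF Ac])
    have "(A ^\<^sub>m Suc (Suc k)) $$ (i,j) = (\<Sum>m<b. (A ^\<^sub>m Suc k) $$ (i,m) * A $$ (m,j))"
      unfolding pow_mat.simps(2)[of A "Suc k"] by (rule index_mult_mat_sum[OF c Ac Suc.prems])
    also have "\<dots> = (\<Sum>m<b. of_real (s ^ k * (t i m * t m j)))"
      using Suc.IH[OF Suc.prems(1)] Ae[OF _ Suc.prems(2)] by (intro sum.cong) (auto simp: mult.assoc)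
    also have "\<dots> = of_real (s ^ k * (\<Sum>m<b. t i m * t m j))"
      by (simp add: sum_distrib_left)
    finally show ?case unfolding tt by (simp add: mult_ac)
  qed
  have tr: "(\<Sum>i<b. t i i) = 2 * s"
  proof -
    have "t i i = g\<^sup>2 * w + (g\<^sup>2 * (1 - 2 * w)) * \<delta> i" for i
      by (simp add: t_def \<tau>_def \<delta>_def algebra_simps)
    then have "(\<Sum>i<b. t i i) = g\<^sup>2 * (b * w) + g\<^sup>2 * (1 - 2 * w)" by (simp only: lin) simp
    then show ?thesis unfolding bw by (simp add: s_def algebra_simps)
  qed
  have "trace_norm X = (\<Sum>i<2::nat. sqrt (Re (complex_of_real s)))"
    unfolding trace_norm_def A_def[symmetric]
  proof (rule spec_sum_eqI_power_sums[OF Ac])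
    fix k :: nat assume "0 < k"
    then obtain k' where k: "k = Suc k'" by (cases k) auto
    have c: "A ^\<^sub>m k \<in> carrier_mat b b" by (rule pow_carrier_mat[OF Ac])
    have "mtrace (A ^\<^sub>m k) = (\<Sum>i<b. of_real (s ^ k' * t i i))"
      unfolding mtrace_def carrier_matD(1)[OF c] using pow unfolding k by (intro sum.cong) auto
    also have "\<dots> = of_real (s ^ k' * (\<Sum>i<b. t i i))" by (simp add: sum_distrib_left)
    finally show "mtrace (A ^\<^sub>m k) = (\<Sum>i<2::nat. complex_of_real s ^ k)"
      unfolding tr k by simp
  qed simp_all
  then show ?thesis using g by (simp add: s_def w_def real_sqrt_mult)
qed

lemma square_sum_le_card_mult_sum_squares:
  fixes f :: "'i \<Rightarrow> real"
  shows "(\<Sum>i\<in>I. f i)\<^sup>2 \<le> card I * (\<Sum>i\<in>I. (f i)\<^sup>2)"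
proof -
  have "2 * (\<Sum>i\<in>I. f i)\<^sup>2 = (\<Sum>i\<in>I. \<Sum>j\<in>I. 2 * f i * f j)"
    by (simp add: power2_eq_square sum_product sum_distrib_left mult_ac)
  also have "\<dots> \<le> (\<Sum>i\<in>I. \<Sum>j\<in>I. (f i)\<^sup>2 + (f j)\<^sup>2)"
    by (intro sum_mono sum_squares_bound)
  also have "\<dots> = 2 * (card I * (\<Sum>i\<in>I. (f i)\<^sup>2))"
    by (simp add: sum.distrib sum_distrib_left[symmetric])
  finally show ?thesis by simp
qed

text \<open>The sum of all entries divided by \<open>b\<close> is the overlap with the maximally
  coherent state; Cauchy-Schwarz over the \<open>b^2\<close> entries bounds it by the Frobenius
  norm.\<close>

lemma overlap_le_trace_norm:
  assumes b: "0 < b" and X: "X \<in> carrier_mat b b"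
  shows "cmod (\<Sum>i<b. \<Sum>j<b. X $$ (i,j)) / b \<le> trace_norm X"
proof -
  let ?I = "{..<b} \<times> {..<b}"
  have "(\<Sum>q\<in>?I. cmod (X $$ q))\<^sup>2 \<le> card ?I * (\<Sum>q\<in>?I. (cmod (X $$ q))\<^sup>2)"
    by (rule square_sum_le_card_mult_sum_squares)
  then have "\<bar>\<Sum>q\<in>?I. cmod (X $$ q)\<bar> \<le> sqrt (card ?I * (\<Sum>q\<in>?I. (cmod (X $$ q))\<^sup>2))"
    by (intro real_le_rsqrt) simp
  also have "\<dots> = b * sqrt (\<Sum>q\<in>?I. (cmod (X $$ q))\<^sup>2)"
    by (simp add: real_sqrt_mult)
  also have "(\<Sum>q\<in>?I. (cmod (X $$ q))\<^sup>2) = (\<Sum>i<b. \<Sum>j<b. (cmod (X $$ (i,j)))\<^sup>2)"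
    by (rule sum.cartesian_product')
  also have "b * sqrt \<dots> \<le> b * trace_norm X"
    using frobenius_le_trace_norm[OF X] by (intro mult_left_mono) auto
  finally have "\<bar>\<Sum>q\<in>?I. cmod (X $$ q)\<bar> \<le> b * trace_norm X" .
  moreover have "cmod (\<Sum>i<b. \<Sum>j<b. X $$ (i,j)) \<le> (\<Sum>q\<in>?I. cmod (X $$ q))"
    unfolding sum.cartesian_product'[of "\<lambda>q. X $$ q", symmetric] by (rule norm_sum)
  ultimately have "cmod (\<Sum>i<b. \<Sum>j<b. X $$ (i,j)) \<le> b * trace_norm X" by linarith
  then show ?thesis using b by (simp add: field_simps)
qed

lemma Psi_carrier [simp]: "Psi m \<in> carrier_mat (2 ^ m) (2 ^ m)"
  by (simp add: Psi_def)

text \<open>The maximally coherent state has overlap 1 with itself, so a small trace distance forces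
  the overlap of the output close to 1.\<close>

lemma overlap_deficit_le_trace_norm:
  assumes Y: "Y \<in> carrier_mat (2 ^ m) (2 ^ m)"
  shows "1 - cmod (\<Sum>i<2 ^ m. \<Sum>j<2 ^ m. Y $$ (i,j)) / 2 ^ m \<le> trace_norm (Y - Psi m)"
proof -
  let ?b = "2 ^ m :: nat"
  let ?F = "\<Sum>i<?b. \<Sum>j<?b. Y $$ (i,j)"
  have "(\<Sum>i<?b. \<Sum>j<?b. (Y - Psi m) $$ (i,j)) = (\<Sum>i<?b. \<Sum>j<?b. Y $$ (i,j) - 1 / 2 ^ m)"
    using Y by (intro sum.cong refl) (auto simp: Psi_def)
  also have "\<dots> = ?F - 2 ^ m" by (simp add: sum_subtractf)
  finally have eq: "(\<Sum>i<?b. \<Sum>j<?b. (Y - Psi m) $$ (i,j)) = ?F - 2 ^ m" .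
  have "cmod (2 ^ m) \<le> cmod ?F + cmod (?F - 2 ^ m)"
    using norm_triangle_ineq4[of ?F "?F - 2 ^ m"] by simp
  then have "(2 ^ m - cmod ?F) / 2 ^ m \<le> cmod (?F - 2 ^ m) / 2 ^ m"
    by (intro divide_right_mono) (simp_all add: norm_power)
  moreover have "cmod (?F - 2 ^ m) / 2 ^ m \<le> trace_norm (Y - Psi m)"
    using overlap_le_trace_norm[of ?b "Y - Psi m"] minus_carrier_mat[OF Psi_carrier, of Y m]
    unfolding eq by simp
  ultimately show ?thesis by (simp add: diff_divide_distrib)
qed

section \<open>Achievability and converse\<close>

context labelled_state
begin

text \<open>A Schur-type test: each pair is split by the arithmetic-geometric mean inequality into a
  share charged to \<open>x\<close> and one charged to \<open>y\<close>, and the shares of a fixed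
  \<open>x\<close> are then counted. The parameter \<open>s\<close> shifts the cost of a pair with
  an atypical member onto that member, at price \<open>1 / s\<close>, leaving only \<open>s\<close>
  for its partner.\<close>

lemma quadratic_form_le:
  assumes S: "S \<subseteq> {..<d ^ n}" "card S \<le> M" and s: "0 < s"
  shows "cmod (\<Sum>x\<in>S. \<Sum>y\<in>S. c x * tpow \<rho> n $$ (x,y) * cnj (c y))
    \<le> (\<Sum>x\<in>S. (cmod (c x))\<^sup>2 * seq_prob n x *
        ((if typical n \<epsilon> x then 0 else M / s) + M * s + 2 powr (n * (Qcoh \<rho> + \<epsilon>)) + \<mu> * M))"
proof -
  have fin: "finite S" using S(1) finite_subset by blast
  define v where "v x = cmod (c x) * sqrt (seq_prob n x)" for x
  define G where "G x y = (if typical n \<epsilon> x then 0 else 1 / s) + s +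
    (if typical n \<epsilon> x \<and> typical n \<epsilon> y \<and> seq_class n x = seq_class n y then 1 else 0) + \<mu>" for x y
  have vnn: "0 \<le> v x" if "x \<in> S" for x
    using that S seq_prob_nonneg by (auto simp: v_def)
  have v2: "(v x)\<^sup>2 = (cmod (c x))\<^sup>2 * seq_prob n x" if "x \<in> S" for x
    using that S seq_prob_nonneg[of x n] by (auto simp: v_def power_mult_distrib)
  have amgm: "2 * (a * b) \<le> a\<^sup>2 / s + s * b\<^sup>2" for a b :: real
  proof -
    have "0 \<le> (a - s * b)\<^sup>2 / s" using s by simp
    also have "\<dots> = a\<^sup>2 / s + s * b\<^sup>2 - 2 * (a * b)"
      using s by (simp add: power2_eq_square field_simps)
    finally show ?thesis by simp
  qed
  have pair_le: "2 * cmod (c x * tpow \<rho> n $$ (x,y) * cnj (c y)) \<le> (v x)\<^sup>2 * G x y + (v y)\<^sup>2 * G y x"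
    if xy: "x \<in> S" "y \<in> S" for x y
  proof -
    have lt: "x < d ^ n" "y < d ^ n" using xy S by auto
    have nn: "0 \<le> (v x)\<^sup>2 * \<mu>" "0 \<le> (v y)\<^sup>2 * \<mu>" "0 \<le> (v x)\<^sup>2 * s" "0 \<le> (v y)\<^sup>2 * s"
      "0 \<le> (v x)\<^sup>2 / s" "0 \<le> (v y)\<^sup>2 / s"
      using mu s by auto
    have eq: "cmod (c x * tpow \<rho> n $$ (x,y) * cnj (c y)) = cmod (c x) * cmod (c y) * cmod (tpow \<rho> n $$ (x,y))"
      by (simp add: norm_mult)
    have le1: "cmod (c x * tpow \<rho> n $$ (x,y) * cnj (c y)) \<le> v x * v y"
    proof -
      have "cmod (c x) * cmod (c y) * cmod (tpow \<rho> n $$ (x,y))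
         \<le> cmod (c x) * cmod (c y) * (sqrt (seq_prob n x) * sqrt (seq_prob n y))"
        by (intro mult_left_mono tpow_entry_le lt) auto
      then show ?thesis unfolding eq v_def by (simp add: mult_ac)
    qed
    consider (xa) "\<not> typical n \<epsilon> x" | (ya) "\<not> typical n \<epsilon> y"
      | (same) "typical n \<epsilon> x" "typical n \<epsilon> y" "seq_class n x = seq_class n y"
      | (other) "seq_class n x \<noteq> seq_class n y" by blast
    then show ?thesis
    proof cases
      case xa
      then show ?thesis
        using le1 amgm[of "v x" "v y"] nn by (simp add: G_def algebra_simps)
    next
      case ya
      then show ?thesis
        using le1 amgm[of "v y" "v x"] nn by (auto simp: G_def algebra_simps)
    next
      case same
      then show ?thesis
        using le1 sum_squares_bound[of "v x" "v y"] nn by (simp add: G_def algebra_simps)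
    next
      case other
      have "cmod (c x) * cmod (c y) * cmod (tpow \<rho> n $$ (x,y))
         \<le> cmod (c x) * cmod (c y) * (\<mu> * (sqrt (seq_prob n x) * sqrt (seq_prob n y)))"
        by (intro mult_left_mono tpow_other_class lt other) auto
      then have "cmod (c x * tpow \<rho> n $$ (x,y) * cnj (c y)) \<le> \<mu> * (v x * v y)"
        unfolding eq v_def by (simp add: mult_ac)
      moreover have "\<mu> * (2 * v x * v y) \<le> \<mu> * ((v x)\<^sup>2 + (v y)\<^sup>2)"
        using mu sum_squares_bound[of "v x" "v y"] by (intro mult_left_mono) auto
      ultimately show ?thesis using other nn by (simp add: G_def algebra_simps)
    qed
  qed
  let ?R = "\<Sum>x\<in>S. \<Sum>y\<in>S. (v x)\<^sup>2 * G x y"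
  have "2 * cmod (\<Sum>x\<in>S. \<Sum>y\<in>S. c x * tpow \<rho> n $$ (x,y) * cnj (c y))
      \<le> 2 * (\<Sum>x\<in>S. \<Sum>y\<in>S. cmod (c x * tpow \<rho> n $$ (x,y) * cnj (c y)))"
    by (intro mult_left_mono order.trans[OF norm_sum] sum_mono norm_sum) auto
  also have "\<dots> = (\<Sum>x\<in>S. \<Sum>y\<in>S. 2 * cmod (c x * tpow \<rho> n $$ (x,y) * cnj (c y)))"
    by (simp add: sum_distrib_left)
  also have "\<dots> \<le> (\<Sum>x\<in>S. \<Sum>y\<in>S. (v x)\<^sup>2 * G x y + (v y)\<^sup>2 * G y x)"
    by (intro sum_mono pair_le)
  also have "\<dots> = ?R + (\<Sum>x\<in>S. \<Sum>y\<in>S. (v y)\<^sup>2 * G y x)" by (simp add: sum.distrib)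
  also have "(\<Sum>x\<in>S. \<Sum>y\<in>S. (v y)\<^sup>2 * G y x) = ?R" by (rule sum.swap)
  finally have "cmod (\<Sum>x\<in>S. \<Sum>y\<in>S. c x * tpow \<rho> n $$ (x,y) * cnj (c y)) \<le> ?R" by simp
  also have "\<dots> \<le> (\<Sum>x\<in>S. (v x)\<^sup>2 *
      ((if typical n \<epsilon> x then 0 else M / s) + M * s + 2 powr (n * (Qcoh \<rho> + \<epsilon>)) + \<mu> * M))"
  proof (rule sum_mono)
    fix x assume x: "x \<in> S"
    define E where "E = (if typical n \<epsilon> x then 0 else 1 / s)"
    define I where "I y = (if typical n \<epsilon> x \<and> typical n \<epsilon> y \<and> seq_class n x = seq_class n y then 1 else 0 :: real)"
      for y
    \<comment> \<open>This count does not grow with \<open>M\<close>, which is where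
      \<open>Qcoh \<rho>\<close> enters the converse.\<close>
    have "(\<Sum>y\<in>S. I y) \<le> 2 powr (n * (Qcoh \<rho> + \<epsilon>))"
    proof -
      have "(\<Sum>y\<in>S. I y)
        = (\<Sum>y\<in>{y \<in> S. typical n \<epsilon> x \<and> typical n \<epsilon> y \<and> seq_class n x = seq_class n y}. 1)"
        unfolding I_def by (rule sum.inter_filter[OF fin, symmetric])
      also have "\<dots> = card {y \<in> S. typical n \<epsilon> x \<and> typical n \<epsilon> y \<and> seq_class n x = seq_class n y}"
        by simp
      also have "\<dots> \<le> card {y \<in> {..<d ^ n}. typical n \<epsilon> y \<and> seq_class n y = seq_class n x}"
        using S by (intro of_nat_mono card_mono) auto
      also have "\<dots> \<le> 2 powr (n * (Qcoh \<rho> + \<epsilon>))" by (rule card_typical_class_le)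
      finally show ?thesis .
    qed
    moreover have "card S * (E + s + \<mu>) \<le> M * (E + s + \<mu>)"
      using S s mu by (intro mult_right_mono) (auto simp: E_def)
    moreover have "(\<Sum>y\<in>S. G x y) = (\<Sum>y\<in>S. (E + s + \<mu>) + I y)"
      by (intro sum.cong) (simp_all add: G_def E_def I_def)
    then have "(\<Sum>y\<in>S. G x y) = card S * (E + s + \<mu>) + (\<Sum>y\<in>S. I y)"
      by (simp add: sum.distrib)
    moreover have "M * (E + s + \<mu>) = (if typical n \<epsilon> x then 0 else M / s) + M * s + \<mu> * M"
      by (simp add: E_def algebra_simps)
    ultimately have "(\<Sum>y\<in>S. G x y) \<le> (if typical n \<epsilon> x then 0 else M / s) + M * s +
        2 powr (n * (Qcoh \<rho> + \<epsilon>)) + \<mu> * M"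
      by linarith
    then show "(\<Sum>y\<in>S. (v x)\<^sup>2 * G x y) \<le> (v x)\<^sup>2 *
      ((if typical n \<epsilon> x then 0 else M / s) + M * s + 2 powr (n * (Qcoh \<rho> + \<epsilon>)) + \<mu> * M)"
      unfolding sum_distrib_left[symmetric] by (intro mult_left_mono) auto
  qed
  finally show ?thesis by (simp add: v2 cong: sum.cong)
qed

text \<open>At every \<open>x\<close> the squared coefficients sum to 1, so adding the bounds on the
  quadratic forms gives a mean under \<open>seq_prob\<close>, in which the cost of atypical words
  becomes \<open>atypical_prob n \<epsilon>\<close> times \<open>M / s\<close>.\<close>

lemma overlap_le:
  assumes J: "finite J" and supp: "\<And>\<alpha>. \<alpha> \<in> J \<Longrightarrow> card {x. x < d ^ n \<and> c \<alpha> x \<noteq> 0} \<le> M"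
    and norm: "\<And>x. x < d ^ n \<Longrightarrow> (\<Sum>\<alpha>\<in>J. (cmod (c \<alpha> x))\<^sup>2) = 1" and s: "0 < s"
  shows "cmod (\<Sum>\<alpha>\<in>J. \<Sum>x<d ^ n. \<Sum>y<d ^ n. c \<alpha> x * tpow \<rho> n $$ (x,y) * cnj (c \<alpha> y))
    \<le> M * (atypical_prob n \<epsilon> / s + s + \<mu>) + 2 powr (n * (Qcoh \<rho> + \<epsilon>))"
proof -
  let ?B = "2 powr (n * (Qcoh \<rho> + \<epsilon>))"
  define H where "H x = (if typical n \<epsilon> x then 0 else M / s) + M * s + ?B + \<mu> * M" for x
  have Hnn: "0 \<le> H x" for x using s mu by (simp add: H_def)
  have "cmod (\<Sum>x<d ^ n. \<Sum>y<d ^ n. c \<alpha> x * tpow \<rho> n $$ (x,y) * cnj (c \<alpha> y))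
      \<le> (\<Sum>x<d ^ n. (cmod (c \<alpha> x))\<^sup>2 * seq_prob n x * H x)" if \<alpha>: "\<alpha> \<in> J" for \<alpha>
  proof -
    let ?S = "{x. x < d ^ n \<and> c \<alpha> x \<noteq> 0}"
    have "(\<Sum>x<d ^ n. \<Sum>y<d ^ n. c \<alpha> x * tpow \<rho> n $$ (x,y) * cnj (c \<alpha> y))
       = (\<Sum>x\<in>?S. \<Sum>y<d ^ n. c \<alpha> x * tpow \<rho> n $$ (x,y) * cnj (c \<alpha> y))"
      by (rule sum.mono_neutral_right) auto
    also have "\<dots> = (\<Sum>x\<in>?S. \<Sum>y\<in>?S. c \<alpha> x * tpow \<rho> n $$ (x,y) * cnj (c \<alpha> y))"
      by (intro sum.cong refl sum.mono_neutral_right) auto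
    finally have "cmod (\<Sum>x<d ^ n. \<Sum>y<d ^ n. c \<alpha> x * tpow \<rho> n $$ (x,y) * cnj (c \<alpha> y))
       \<le> (\<Sum>x\<in>?S. (cmod (c \<alpha> x))\<^sup>2 * seq_prob n x * H x)"
      unfolding H_def using quadratic_form_le[OF _ supp[OF \<alpha>] s, where c = "c \<alpha>" and \<epsilon> = \<epsilon>] by (simp add: subset_iff)
    also have "\<dots> \<le> (\<Sum>x<d ^ n. (cmod (c \<alpha> x))\<^sup>2 * seq_prob n x * H x)"
      by (rule sum_mono2) (auto intro!: mult_nonneg_nonneg simp: seq_prob_nonneg Hnn)
    finally show ?thesis .
  qed
  then have "cmod (\<Sum>\<alpha>\<in>J. \<Sum>x<d ^ n. \<Sum>y<d ^ n. c \<alpha> x * tpow \<rho> n $$ (x,y) * cnj (c \<alpha> y))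
      \<le> (\<Sum>\<alpha>\<in>J. \<Sum>x<d ^ n. (cmod (c \<alpha> x))\<^sup>2 * seq_prob n x * H x)"
    by (rule order.trans[OF norm_sum sum_mono])
  also have "\<dots> = (\<Sum>x<d ^ n. \<Sum>\<alpha>\<in>J. (cmod (c \<alpha> x))\<^sup>2 * seq_prob n x * H x)"
    by (rule sum.swap)
  also have "\<dots> = (\<Sum>x<d ^ n. seq_prob n x * H x)"
    using norm by (intro sum.cong refl) (simp flip: sum_distrib_right)
  also have "\<dots> = (\<Sum>x<d ^ n. (M / s) * (if typical n \<epsilon> x then 0 else seq_prob n x) +
      seq_prob n x * (M * s + ?B + \<mu> * M))"
    by (intro sum.cong refl) (auto simp: H_def algebra_simps)
  also have "\<dots> = (M / s) * atypical_prob n \<epsilon> + (M * s + ?B + \<mu> * M)"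
    unfolding sum.distrib sum_distrib_left[symmetric] sum_distrib_right[symmetric]
    by (simp add: atypical_prob_def seq_prob_sum)
  also have "\<dots> = M * (atypical_prob n \<epsilon> / s + s + \<mu>) + ?B"
    by (simp add: algebra_simps)
  finally show ?thesis .
qed

text \<open>\<open>s\<close> stays free: for fixed \<open>s\<close> and a rate above
  \<open>Qcoh \<rho> + \<epsilon>\<close> only \<open>1 - \<mu> - s\<close> survives in the
  limit.\<close>

lemma converse_trace_norm:
  assumes lift: "lifted Cls (d ^ n) (2 ^ m) \<Lambda>" and Cls: "\<And>D \<Phi>. Cls D \<Phi> \<Longrightarrow> strict_kraus D \<Phi>"
    and s: "0 < s"
  shows "1 - \<mu> - s - atypical_prob n \<epsilon> / s - 2 powr (n * (Qcoh \<rho> + \<epsilon>)) / 2 ^ m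
    \<le> trace_norm (\<Lambda> (tpow \<rho> n) - Psi m)"
proof -
  obtain J :: "((nat \<times> nat) \<times> nat) set" and c where J: "finite J"
    "\<And>\<alpha>. \<alpha> \<in> J \<Longrightarrow> card {x. x < d ^ n \<and> c \<alpha> x \<noteq> 0} \<le> 2 ^ m"
    "\<And>x. x < d ^ n \<Longrightarrow> (\<Sum>\<alpha>\<in>J. (cmod (c \<alpha> x))\<^sup>2) = 1"
    and out: "\<Lambda> (tpow \<rho> n) \<in> carrier_mat (2 ^ m) (2 ^ m)"
    "(\<Sum>i<2 ^ m. \<Sum>j<2 ^ m. \<Lambda> (tpow \<rho> n) $$ (i,j)) =
      (\<Sum>\<alpha>\<in>J. \<Sum>x<d ^ n. \<Sum>y<d ^ n. c \<alpha> x * tpow \<rho> n $$ (x,y) * cnj (c \<alpha> y))"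
    by (rule strict_kraus_overlap[OF lift Cls tpow_carrier]) blast+
  let ?F = "cmod (\<Sum>i<2 ^ m. \<Sum>j<2 ^ m. \<Lambda> (tpow \<rho> n) $$ (i,j))"
  have "?F \<le> real (2 ^ m) * (atypical_prob n \<epsilon> / s + s + \<mu>) + 2 powr (n * (Qcoh \<rho> + \<epsilon>))"
    unfolding out(2) by (rule overlap_le[OF J s])
  then have "?F / 2 ^ m \<le> (2 ^ m * (atypical_prob n \<epsilon> / s + s + \<mu>) + 2 powr (n * (Qcoh \<rho> + \<epsilon>))) / 2 ^ m"
    by (intro divide_right_mono) auto
  also have "\<dots> = atypical_prob n \<epsilon> / s + s + \<mu> + 2 powr (n * (Qcoh \<rho> + \<epsilon>)) / 2 ^ m"
    by (simp add: add_divide_distrib)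
  finally show ?thesis using overlap_deficit_le_trace_norm[OF out(1)] by linarith
qed

text \<open>The output is exactly a mixture of the maximally coherent state and |0><0| with leftover
  weight \<open>g\<close>, so the error has a closed form. The protocol depends only on
  \<open>n\<close> and \<open>m\<close>; the bound on \<open>g\<close> holds for every \<epsilon>,
  which can be chosen afterwards.\<close>

lemma achievability_trace_norm:
  obtains \<Lambda> g where "lifted PIO_sq (d ^ n) (2 ^ m) \<Lambda>"
    "trace_norm (\<Lambda> (tpow \<rho> n) - Psi m) = 2 * g * sqrt (1 - 1 / 2 ^ m)" "0 \<le> g"
    "\<And>\<epsilon>. g \<le> atypical_prob n \<epsilon> + (real n + 1) ^ d * 2 ^ m * 2 powr (- (n * (Qcoh \<rho> - \<epsilon>)))"
proof -
  let ?M = "2 ^ m :: nat"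
  have M: "0 < ?M" and dn: "0 < d ^ n" using d_pos by simp_all
  obtain \<beta> :: "nat \<Rightarrow> nat" and B :: nat and pos :: "nat \<Rightarrow> nat" and G where
    \<beta>: "\<And>x. x < d ^ n \<Longrightarrow> \<beta> x < B" and pos: "\<And>x. x < d ^ n \<Longrightarrow> pos x < ?M"
    and pos0: "\<And>x. x < d ^ n \<Longrightarrow> x \<notin> G \<Longrightarrow> pos x = 0"
    and single: "\<And>x y. x < d ^ n \<Longrightarrow> y < d ^ n \<Longrightarrow> x \<notin> G \<Longrightarrow> \<beta> y = \<beta> x \<Longrightarrow> y = x"
    and full: "\<And>x i. x < d ^ n \<Longrightarrow> x \<in> G \<Longrightarrow> i < ?M \<Longrightarrow> \<exists>!y. y < d ^ n \<and> \<beta> y = \<beta> x \<and> pos y = i"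
    and cell: "\<And>x y. x < d ^ n \<Longrightarrow> y < d ^ n \<Longrightarrow> \<beta> x = \<beta> y \<Longrightarrow>
      (seq_class n x, seq_prob n x) = (seq_class n y, seq_prob n y)"
    and card: "\<And>C. card {x. x < d ^ n \<and> x \<notin> G \<and> (seq_class n x, seq_prob n x) = C} \<le> ?M"
    apply (rule block_partition_exists[OF M, where a = "d ^ n" and c = "\<lambda>x. (seq_class n x, seq_prob n x)"])
    subgoal premises prems by (rule prems(1)[OF prems(2-)])
    done
  define g where "g = (\<Sum>x<d ^ n. if x \<in> G then 0 else seq_prob n x)"
  have inj: "x = y" if xy: "x < d ^ n" "y < d ^ n" "\<beta> x = \<beta> y" "pos x = pos y" for x y
  proof (cases "x \<in> G")
    case True
    then show ?thesis using full[OF xy(1) True pos[OF xy(1)]] xy by metis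
  next
    case False
    then show ?thesis using single[OF xy(1,2)] xy by simp
  qed
  have ph: "cmod (cnj (seq_phase n x)) = 1" if "x < d ^ n" for x
    using cmod_seq_phase[OF that] by simp
  obtain \<Lambda> where lift: "lifted PIO_sq (d ^ n) ?M \<Lambda>"
    and \<Lambda>: "\<And>X. X \<in> carrier_mat (d ^ n) (d ^ n) \<Longrightarrow> \<Lambda> X = mat ?M ?M (\<lambda>(i,j). \<Sum>x<d ^ n. \<Sum>y<d ^ n.
       if \<beta> x = \<beta> y \<and> pos x = i \<and> pos y = j then cnj (seq_phase n x) * cnj (cnj (seq_phase n y)) * X $$ (x,y) else 0)"
    apply (rule block_channel_exists[OF dn M, where \<beta> = \<beta> and B = B and pos = pos
        and ph = "\<lambda>x. cnj (seq_phase n x)"])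
        apply (erule \<beta>)
       apply (erule pos)
      apply (erule (3) inj)
     apply (erule ph)
    subgoal premises prems by (rule prems(1)[OF prems(2-)])
    done
  have gnn: "0 \<le> g" unfolding g_def by (auto intro!: sum_nonneg simp: seq_prob_nonneg)
  have cell': "seq_class n x = seq_class n y \<and> seq_prob n x = seq_prob n y"
    if "x < d ^ n" "y < d ^ n" "\<beta> x = \<beta> y" for x y
    using cell[OF that] by simp
  have entry: "\<Lambda> (tpow \<rho> n) $$ (i,j) = of_real ((1 - g) / ?M + (if i = 0 \<and> j = 0 then g else 0))"
    if ij: "i < ?M" "j < ?M" for i j
  proof -
    have "\<Lambda> (tpow \<rho> n) $$ (i,j) = (\<Sum>x<d ^ n. \<Sum>y<d ^ n. if \<beta> x = \<beta> y \<and> pos x = i \<and> pos y = j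
        then cnj (seq_phase n x) * seq_phase n y * tpow \<rho> n $$ (x,y) else 0)"
      unfolding \<Lambda>[OF tpow_carrier] index_mat(1)[OF ij] complex_cnj_cnj by simp
    also have "\<dots> = of_real ((1 - g) / ?M + (if i = 0 \<and> j = 0 then g else 0))"
      unfolding g_def by (rule block_output[OF M]) (fact pos pos0 single full cell' ij)+
    finally show ?thesis .
  qed
  have "trace_norm (\<Lambda> (tpow \<rho> n) - Psi m) = 2 * g * sqrt (1 - 1 / real ?M)"
  proof (rule trace_norm_ground_minus_uniform[OF _ gnn])
    show "\<Lambda> (tpow \<rho> n) - Psi m \<in> carrier_mat ?M ?M" by (rule minus_carrier_mat[OF Psi_carrier])
    fix i j assume ij: "i < ?M" "j < ?M"
    have "(\<Lambda> (tpow \<rho> n) - Psi m) $$ (i,j) = \<Lambda> (tpow \<rho> n) $$ (i,j) - of_real (1 / 2 ^ m)"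
      using ij by (simp add: Psi_def)
    also have "\<dots> = of_real ((1 - g) / 2 ^ m + (if i = 0 \<and> j = 0 then g else 0) - 1 / 2 ^ m)"
      unfolding entry[OF ij] by simp
    also have "(1 - g) / 2 ^ m + (if i = 0 \<and> j = 0 then g else 0) - 1 / 2 ^ m
       = g * ((if i = 0 \<and> j = 0 then 1 else 0) - 1 / real ?M)"
      by (simp add: field_simps)
    finally show "(\<Lambda> (tpow \<rho> n) - Psi m) $$ (i,j) =
      of_real (g * ((if i = 0 \<and> j = 0 then 1 else 0) - 1 / real ?M))" .
  qed simp
  moreover have "g \<le> atypical_prob n \<epsilon> + (real n + 1) ^ d * 2 ^ m * 2 powr (- (n * (Qcoh \<rho> - \<epsilon>)))" for \<epsilon>
    using leftover_prob_le[OF card, of \<epsilon>] by (simp add: g_def)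
  ultimately show thesis using that[OF lift _ gnn] by simp
qed

text \<open>Enlarging the class can only lower the infimum, and the lower bound holds for all
  strictly incoherent Kraus families, so every class in between has the same rate.\<close>

theorem distillable_eq_Qcoh:
  assumes PIO: "\<And>D \<Phi>. PIO_sq D \<Phi> \<Longrightarrow> Cls D \<Phi>" and Cls: "\<And>D \<Phi>. Cls D \<Phi> \<Longrightarrow> strict_kraus D \<Phi>"
  shows "distillable Cls d \<rho> = Qcoh \<rho>"
proof -
  define m where "m r n = nat \<lfloor>r * real n\<rfloor>" for r n
  define L where "L r n = {\<Lambda>. lifted Cls (d ^ n) (2 ^ m r n) \<Lambda>}" for r n
  define T where "T r n = (INF \<Lambda>\<in>L r n. trace_norm (\<Lambda> (tpow \<rho> n) - Psi (m r n)))" for r n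
  have bdd: "bdd_below ((\<lambda>\<Lambda>. trace_norm (\<Lambda> (tpow \<rho> n) - Psi (m r n))) ` L r n)" for r n
    by (rule bdd_belowI[of _ 0]) (auto simp: trace_norm_nonneg)
  \<comment> \<open>The root is kept because it vanishes for \<open>m r n = 0\<close>: rate 0 is
    then attained exactly, even when \<open>Qcoh \<rho>\<close> is 0. Nonemptiness of
    \<open>L r n\<close> is what lower bounds on the infimum require.\<close>
  have upper: "\<exists>g. T r n \<le> 2 * g * sqrt (1 - 1 / 2 ^ m r n) \<and> 0 \<le> g \<and>
      (\<forall>\<epsilon>. g \<le> atypical_prob n \<epsilon> + (real n + 1) ^ d * 2 ^ m r n * 2 powr (- (n * (Qcoh \<rho> - \<epsilon>)))) \<and> L r n \<noteq> {}"
    for r n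
  proof -
    obtain \<Lambda> g where \<Lambda>: "lifted PIO_sq (d ^ n) (2 ^ m r n) \<Lambda>"
      and g: "trace_norm (\<Lambda> (tpow \<rho> n) - Psi (m r n)) = 2 * g * sqrt (1 - 1 / 2 ^ m r n)" "0 \<le> g"
      "\<And>\<epsilon>. g \<le> atypical_prob n \<epsilon> + (real n + 1) ^ d * 2 ^ m r n * 2 powr (- (n * (Qcoh \<rho> - \<epsilon>)))"
      by (rule achievability_trace_norm[of n "m r n"]) blast
    have "\<Lambda> \<in> L r n" using \<Lambda> PIO unfolding L_def lifted_def by blast
    moreover from this have "T r n \<le> trace_norm (\<Lambda> (tpow \<rho> n) - Psi (m r n))"
      unfolding T_def by (rule cINF_lower[OF bdd])
    ultimately show ?thesis using g by auto
  qed
  have T_nonneg: "0 \<le> T r n" for r n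
    unfolding T_def using upper[of r n] by (intro cINF_greatest) (auto simp: trace_norm_nonneg)
  have lower: "1 - \<mu> - s - atypical_prob n \<epsilon> / s - 2 powr (n * (Qcoh \<rho> + \<epsilon>)) / 2 ^ m r n \<le> T r n"
    if "0 < s" for r n s \<epsilon>
    unfolding T_def
  proof (rule cINF_greatest)
    show "L r n \<noteq> {}" using upper by blast
    show "1 - \<mu> - s - atypical_prob n \<epsilon> / s - 2 powr (n * (Qcoh \<rho> + \<epsilon>)) / 2 ^ m r n
        \<le> trace_norm (\<Lambda> (tpow \<rho> n) - Psi (m r n))" if "\<Lambda> \<in> L r n" for \<Lambda>
      using converse_trace_norm[OF _ Cls \<open>0 < s\<close>, where \<Lambda> = \<Lambda>] that unfolding L_def by blast
  qed
  have pow_m: "2 ^ m r n = 2 powr real (m r n)" for r n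
    by (simp add: powr_realpow)
  have m_le: "real (m r n) \<le> r * n" if "0 \<le> r" for r n
    using that unfolding m_def by (simp add: of_nat_floor)
  have m_ge: "r * n - 1 \<le> real (m r n)" for r n
    unfolding m_def by linarith
  have achieve: "T r \<longlonglongrightarrow> 0" if r: "0 \<le> r" "r < Qcoh \<rho>" for r
  proof -
    \<comment> \<open>With half the gap, the exponent left after multiplying by the block length is
      at most \<open>- \<epsilon> * n\<close>, which beats the polynomial number of cells.\<close>
    define \<epsilon> where "\<epsilon> = (Qcoh \<rho> - r) / 2"
    have \<epsilon>: "0 < \<epsilon>" "r - (Qcoh \<rho> - \<epsilon>) = - \<epsilon>" using r by (auto simp: \<epsilon>_def field_simps)
    have "T r n \<le> 2 * (atypical_prob n \<epsilon> + (real n + 1) ^ d * 2 powr (- (\<epsilon> * n)))" for n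
    proof -
      obtain g where g: "T r n \<le> 2 * g * sqrt (1 - 1 / 2 ^ m r n)" "0 \<le> g"
        "g \<le> atypical_prob n \<epsilon> + (real n + 1) ^ d * 2 ^ m r n * 2 powr (- (n * (Qcoh \<rho> - \<epsilon>)))"
        using upper[of r n] by blast
      have "T r n \<le> 2 * g * 1"
        using g by (intro order.trans[OF g(1)] mult_left_mono) auto
      also have "\<dots> \<le> 2 * (atypical_prob n \<epsilon> + (real n + 1) ^ d * 2 ^ m r n * 2 powr (- (n * (Qcoh \<rho> - \<epsilon>))))"
        using g by simp
      finally have 1: "T r n \<le> 2 * (atypical_prob n \<epsilon> + (real n + 1) ^ d * 2 ^ m r n * 2 powr (- (n * (Qcoh \<rho> - \<epsilon>))))" .
      have "(2::real) ^ m r n * 2 powr (- (n * (Qcoh \<rho> - \<epsilon>))) \<le> 2 powr (- (\<epsilon> * n))"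
      proof -
        have "(2::real) ^ m r n * 2 powr (- (n * (Qcoh \<rho> - \<epsilon>))) = 2 powr (m r n - n * (Qcoh \<rho> - \<epsilon>))"
          unfolding pow_m by (simp flip: powr_add)
        also have "\<dots> \<le> 2 powr (- (\<epsilon> * n))"
        proof (rule powr_mono)
          have "m r n - n * (Qcoh \<rho> - \<epsilon>) \<le> r * n - n * (Qcoh \<rho> - \<epsilon>)"
            using m_le[OF r(1)] by simp
          also have "\<dots> = (r - (Qcoh \<rho> - \<epsilon>)) * n" by (simp add: algebra_simps)
          finally show "m r n - n * (Qcoh \<rho> - \<epsilon>) \<le> - (\<epsilon> * n)" unfolding \<epsilon>(2) by simp
        qed simp
        finally show ?thesis .
      qed
      then have "(real n + 1) ^ d * (2 ^ m r n * 2 powr (- (n * (Qcoh \<rho> - \<epsilon>))))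
          \<le> (real n + 1) ^ d * 2 powr (- (\<epsilon> * n))"
        by (intro mult_left_mono) auto
      then have "2 * (atypical_prob n \<epsilon> + (real n + 1) ^ d * (2 ^ m r n * 2 powr (- (n * (Qcoh \<rho> - \<epsilon>)))))
          \<le> 2 * (atypical_prob n \<epsilon> + (real n + 1) ^ d * 2 powr (- (\<epsilon> * n)))"
        by (intro mult_left_mono add_left_mono) simp_all
      then show ?thesis using 1 unfolding mult.assoc by (rule order.trans[rotated])
    qed
    moreover have "(\<lambda>n. 2 * (atypical_prob n \<epsilon> + (real n + 1) ^ d * 2 powr (- (\<epsilon> * real n)))) \<longlonglongrightarrow> 2 * (0 + 0)"
    proof (intro tendsto_intros atypical_prob_tendsto_0 \<epsilon>)
      show "(\<lambda>n. (real n + 1) ^ d * 2 powr (- (\<epsilon> * real n))) \<longlonglongrightarrow> 0"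
        using \<epsilon>(1) by real_asymp
    qed
    ultimately show ?thesis
      by (intro tendsto_sandwich[of "\<lambda>_. 0" "T r" _ "\<lambda>n. 2 * (atypical_prob n \<epsilon> + (real n + 1) ^ d * 2 powr (- (\<epsilon> * real n)))"])
        (auto simp: T_nonneg)
  qed
  have zero: "T 0 \<longlonglongrightarrow> 0"
  proof -
    have "T 0 n = 0" for n
      using upper[of 0 n] T_nonneg[of 0 n] by (auto simp: m_def)
    then have "T 0 = (\<lambda>n. 0)" by (rule ext)
    then show ?thesis by simp
  qed
  have conv: "r \<le> Qcoh \<rho>" if r: "T r \<longlonglongrightarrow> 0" for r
  proof (rule ccontr)
    assume "\<not> r \<le> Qcoh \<rho>"
    then have rQ: "Qcoh \<rho> < r" by simp
    define \<epsilon> where "\<epsilon> = (r - Qcoh \<rho>) / 2"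
    \<comment> \<open>Half of \<open>1 - \<mu>\<close> is spent on \<open>s\<close>; the other half
      remains as the limit of the lower bound.\<close>
    define s where "s = (1 - \<mu>) / 2"
    have \<epsilon>: "0 < \<epsilon>" "Qcoh \<rho> + \<epsilon> - r = - \<epsilon>" using rQ by (auto simp: \<epsilon>_def field_simps)
    have s: "0 < s" "1 - \<mu> - s = s" using mu by (auto simp: s_def field_simps)
    have "s - atypical_prob n \<epsilon> / s - 2 * 2 powr (- (\<epsilon> * n)) \<le> T r n" for n
    proof -
      have "2 powr (n * (Qcoh \<rho> + \<epsilon>)) / 2 ^ m r n = 2 powr (n * (Qcoh \<rho> + \<epsilon>) - m r n)"
        unfolding pow_m by (simp add: powr_diff)
      \<comment> \<open>The 1 in the exponent pays for rounding \<open>r * n\<close> down.\<close>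
      also have "\<dots> \<le> 2 powr (1 - \<epsilon> * n)"
      proof (rule powr_mono)
        have "n * (Qcoh \<rho> + \<epsilon>) - m r n \<le> n * (Qcoh \<rho> + \<epsilon>) - (r * n - 1)"
          using m_ge[of r n] by simp
        also have "\<dots> = 1 + (Qcoh \<rho> + \<epsilon> - r) * n" by (simp add: algebra_simps)
        finally show "n * (Qcoh \<rho> + \<epsilon>) - m r n \<le> 1 - \<epsilon> * n" unfolding \<epsilon>(2) by simp
      qed simp
      also have "\<dots> = 2 * 2 powr (- (\<epsilon> * n))" by (simp add: powr_diff powr_minus divide_simps)
      finally show ?thesis using lower[OF s(1), of n \<epsilon> r] s(2) by linarith
    qed
    moreover have "(\<lambda>n. s - atypical_prob n \<epsilon> / s - 2 * 2 powr (- (\<epsilon> * real n))) \<longlonglongrightarrow> s - 0 / s - 2 * 0"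
    proof (intro tendsto_intros atypical_prob_tendsto_0 \<epsilon>)
      show "(\<lambda>n. 2 powr (- (\<epsilon> * real n))) \<longlonglongrightarrow> 0" using \<epsilon>(1) by real_asymp
    qed (use s in simp)
    ultimately have "s - 0 / s - 2 * 0 \<le> 0"
      using r by (intro LIMSEQ_le) auto
    then show False using s by simp
  qed
  have "Sup {r. 0 \<le> r \<and> T r \<longlonglongrightarrow> 0} = Qcoh \<rho>"
  proof (rule cSup_eq_non_empty)
    show "{r. 0 \<le> r \<and> T r \<longlonglongrightarrow> 0} \<noteq> {}" using zero by blast
    show "r \<le> Qcoh \<rho>" if "r \<in> {r. 0 \<le> r \<and> T r \<longlonglongrightarrow> 0}" for r using that conv by blast
    show "Qcoh \<rho> \<le> y" if y: "\<And>r. r \<in> {r. 0 \<le> r \<and> T r \<longlonglongrightarrow> 0} \<Longrightarrow> r \<le> y" for y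
    proof (rule ccontr)
      assume "\<not> Qcoh \<rho> \<le> y"
      \<comment> \<open>Rate 0 belongs to the set, so \<open>y\<close> is nonnegative and the
        midpoint of \<open>y\<close> and \<open>Qcoh \<rho>\<close> is an admissible rate.\<close>
      moreover have "0 \<le> y" using y zero by blast
      ultimately show False using y[of "(y + Qcoh \<rho>) / 2"] achieve[of "(y + Qcoh \<rho>) / 2"] by simp
    qed
  qed
  then show ?thesis
    unfolding distillable_def T_def L_def m_def by simp
qed

end

theorem theorem1:
  fixes d :: nat and \<rho> :: "complex mat"
  assumes "density d \<rho>"
  shows "distillable SIO_sq d \<rho> = Qcoh \<rho> \<and> distillable PIO_sq d \<rho> = Qcoh \<rho>"
proof -
  obtain p l u \<mu> where "labelled_state d \<rho> p l u \<mu>"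
    by (rule density_imp_labelled_state[OF assms])
  then interpret labelled_state d \<rho> p l u \<mu> .
  have "distillable SIO_sq d \<rho> = Qcoh \<rho>"
    by (rule distillable_eq_Qcoh)
      (auto intro: strict_kraus_imp_SIO_sq PIO_sq_imp_strict_kraus SIO_sq_imp_strict_kraus)
  moreover have "distillable PIO_sq d \<rho> = Qcoh \<rho>"
    by (rule distillable_eq_Qcoh) (auto intro: PIO_sq_imp_strict_kraus)
  ultimately show ?thesis by blast
qed

end
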